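(* Let $\rho_o\in(\mathbf{L}^\infty\cap\mathbf{BV})(\mathbb{R}^2;\mathbb{R}^+)$ and let assumptions (v), (H), ($\eta$) of the context hold. Assume that $$\lambda_x\le\frac{1}{3\left(\epsilon L_f+\|v^{stat}_1\|_{\mathbf{L}^\infty}\right)},\qquad \lambda_y\le\frac{1}{3\left(\epsilon L_f+\|v^{stat}_2\|_{\mathbf{L}^\infty}\right)}.$$ Then the piecewise constant approximate solution $\rho_\Delta$, with values $\rho^n_{i,j}$, constructed by the Roe-type scheme with dimensional splitting described in the context satisfies the following estimate: for all $n=1,\dots,N_T$, $$\sum_{m=0}^{n-1}\sum_{i,j\in\mathbb{Z}}\Delta t\left(\Delta y\,|\rho^m_{i+1,j}-\rho^m_{i,j}|+\Delta x\,|\rho^m_{i,j+1}-\rho^m_{i,j}|\right)+\sum_{m=0}^{n-1}\sum_{i,j\in\mathbb{Z}}\Delta x\,\Delta y\,|\rho^{m+1}_{i,j}-\rho^m_{i,j}|\le\mathcal{C}_{xt}(t^n),$$ where $$\mathcal{C}_{xt}(t)=t\left(\mathcal{C}_x(t)+2\,\mathcal{C}_t(t)\right),$$ $$\mathcal{C}_t(s)=2\left(\|\boldsymbol{v}^{stat}\|_{\mathbf{L}^\infty}+\epsilon L_f\right)\mathcal{C}_x(s)+\left(\|\nabla\boldsymbol{v}^{stat}\|_{\mathbf{L}^\infty}+2\epsilon\|\nabla^2\eta\|_{\mathbf{L}^\infty}\|\rho_o\|_{\mathbf{L}^1}\right)\|\rho_o\|_{\mathbf{L}^1},$$ $$\mathcal{C}_x(t)=e^{2t\mathcal{K}_1}\sum_{i,j\in\mathbb{Z}}\left(\Delta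 x\,|\rho^0_{i,j+1}-\rho^0_{i,j}|+\Delta y\,|\rho^0_{i+1,j}-\rho^0_{i,j}|\right)+\frac{2\mathcal{K}_2}{\mathcal{K}_1}\left(e^{2t\mathcal{K}_1}-1\right),$$ $$\mathcal{K}_1=6\left(\|\nabla\boldsymbol{v}^{stat}\|_{\mathbf{L}^\infty}+2\epsilon L_f\|\nabla^2\eta\|_{\mathbf{L}^\infty}\|\rho_o\|_{\mathbf{L}^1}\right),$$ $$\mathcal{K}_2=\left(4\epsilon\left(c_1\|\rho_o\|_{\mathbf{L}^1}+c_2\|\rho_o\|^2_{\mathbf{L}^1}\right)+3\|\nabla^2\boldsymbol{v}^{stat}\|_{\mathbf{L}^\infty}\right)\|\rho_o\|_{\mathbf{L}^1},$$ with $c_1=2\|\nabla^3\eta\|_{\mathbf{L}^\infty}$ and $c_2=3\|\nabla^2\eta\|^2_{\mathbf{L}^\infty}$.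
   Context: Fixed: $\epsilon>0$, $\rho_{max}>0$, $T>0$. Assumptions. (v): $\boldsymbol{v}^{stat}=(v^{stat}_1,v^{stat}_2)\in\mathbf{C}^2(\mathbb{R}^2;\mathbb{R}^2)$. (H): $H$ is a smooth approximation of the Heaviside function such that, setting $f(r)=r\,H(r-\rho_{max})$, the function $f$ has bounded derivative; $L_f=\|f'\|_{\mathbf{L}^\infty(\mathbb{R})}$. ($\eta$): $\eta\in(\mathbf{C}^3\cap\mathbf{W}^{3,\infty})(\mathbb{R}^2;\mathbb{R}^+)$. Notation: $\mathbf{BV}$ is the space of integrable functions of bounded variation; $\|\cdot\|$ is the Euclidean norm. Mesh: $\Delta x,\Delta y,\Delta t>0$; $x_k=(k-\tfrac12)\Delta x$, $y_k=(k-\tfrac12)\Delta y$, $x_{k+1/2}=k\Delta x$, $y_{k+1/2}=k\Delta y$ for $k\in\mathbb{Z}$; $N_T=\lfloor T/\Delta t\rfloor$, $t^n=n\Delta t$; $\lambda_x=\Delta t/\Delta x$, $\lambda_y=\Delta t/\Delta y$; $x_{a,b}=(x_a,y_b)$ for integer or half-integer indices. Initial values: $\rho^0_{i,j}=\frac{1}{\Delta x\Delta y}\int_{x_{i-1/2}}^{x_{i+1/2}}\int_{y_{j-1/2}}^{y_{j+1/2}}\rho_o(x,y)\,dy\,dx$. Numerical fluxes: for $k=1,2$, $$V_k(x,y,u,w)=v^{stat}_k(x,y)\,u+\min\{0,v^{stat}_k(x,y)\}(w-u),\qquad F(u,w,J)=J\,f(u)+\min\{0,J\}\,(f(w)-f(u)).$$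 Non-local term: $J^n_k(x,y)=-\epsilon\,\dfrac{(\partial_k\eta*\rho^n)(x,y)}{\sqrt{1+\|(\nabla\eta*\rho^n)(x,y)\|^2}}$, $k=1,2$ ($\partial_1=\partial_x$, $\partial_2=\partial_y$), with the quadrature formula $(\partial_k\eta*\rho^n)(x_a,y_b)=\Delta x\,\Delta y\sum_{p,\ell\in\mathbb{Z}}\rho^n_{p,\ell}\,\partial_k\eta(x_{a-p},y_{b-\ell})$ at grid points (integer or half-integer $a,b$). Scheme (for $n=0,\dots,N_T-1$ and all $i,j\in\mathbb{Z}$; the numerical fluxes are evaluated at time $t^n$ in both fractional steps): $$\rho^{n+1/2}_{i,j}=\rho^n_{i,j}-\lambda_x\big[V_1(x_{i+1/2,j},\rho^n_{i,j},\rho^n_{i+1,j})-V_1(x_{i-1/2,j},\rho^n_{i-1,j},\rho^n_{i,j})+F(\rho^n_{i,j},\rho^n_{i+1,j},J^n_1(x_{i+1/2,j}))-F(\rho^n_{i-1,j},\rho^n_{i,j},J^n_1(x_{i-1/2,j}))\big],$$ $$\rho^{n+1}_{i,j}=\rho^{n+1/2}_{i,j}-\lambda_y\big[V_2(x_{i,j+1/2},\rho^n_{i,j},\rho^n_{i,j+1})-V_2(x_{i,j-1/2},\rho^n_{i,j-1},\rho^n_{i,j})+F(\rho^n_{i,j},\rho^n_{i,j+1},J^n_2(x_{i,j+1/2}))-F(\rho^n_{i,j-1},\rho^n_{i,j},J^n_2(x_{i,j-1/2}))\big].$$ Approximate solution: $\rho_\Delta(t,x,y)=\rho^n_{i,j}$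 for $t\in[t^n,t^{n+1}[$, $x\in[x_{i-1/2},x_{i+1/2}[$, $y\in[y_{j-1/2},y_{j+1/2}[$, $n=0,\dots,N_T-1$, $i,j\in\mathbb{Z}$. *)

theory Defs
  imports "HOL-Analysis.Analysis" "HOL-Probability.Essential_Supremum"
begin

definition pd :: "2 \<Rightarrow> (real^2 \<Rightarrow> real) \<Rightarrow> real^2 \<Rightarrow> real" where
  "pd k g x = deriv (\<lambda>s. g (x + s *\<^sub>R axis k 1)) 0"

text \<open>A list of directions \<open>[k\<^sub>1, \<dots>, k\<^sub>m]\<close> encodes the iterated
  partial derivative \<open>\<partial>\<^bsub>k\<^sub>1\<^esub> \<dots> \<partial>\<^bsub>k\<^sub>m\<^esub> g = foldr pd [k\<^sub>1, \<dots>, k\<^sub>m] g\<close>.\<close>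

definition C_diff :: "nat \<Rightarrow> (real^2 \<Rightarrow> real) \<Rightarrow> bool" where
  "C_diff m g \<longleftrightarrow>
     (\<forall>ks. length ks \<le> m \<longrightarrow> continuous_on UNIV (foldr pd ks g)) \<and>
     (\<forall>ks k x. length ks < m \<longrightarrow>
        (\<lambda>s. foldr pd ks g (x + s *\<^sub>R axis k 1)) differentiable (at 0))"

definition C_diff_vec :: "nat \<Rightarrow> (real^2 \<Rightarrow> real^2) \<Rightarrow> bool" where
  "C_diff_vec m v \<longleftrightarrow> (\<forall>i. C_diff m (\<lambda>x. v x $ i))"

text \<open>Pointwise Euclidean norm of the array \<open>\<nabla>\<^sup>m g\<close> of all partial
  derivatives of order \<open>m\<close> (for \<open>m = 2\<close>, the Frobenius norm of the Hessian);
  for a vector field, of the arrays of both components together.\<close>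

definition grad_norm :: "nat \<Rightarrow> (real^2 \<Rightarrow> real) \<Rightarrow> real^2 \<Rightarrow> real" where
  "grad_norm m g x = sqrt (\<Sum>ks | length ks = m. (foldr pd ks g x)\<^sup>2)"

definition grad_norm_vec :: "nat \<Rightarrow> (real^2 \<Rightarrow> real^2) \<Rightarrow> real^2 \<Rightarrow> real" where
  "grad_norm_vec m v x = sqrt (\<Sum>i\<in>UNIV. (grad_norm m (\<lambda>z. v z $ i) x)\<^sup>2)"

text \<open>Norms take values in \<^typ>\<open>ennreal\<close>, so that no finiteness is presupposed.
  Here \<open>1 / 0 = \<infinity>\<close>, \<open>1 / \<infinity> = 0\<close> and \<open>0 * \<infinity> = 0\<close>.\<close>

definition Linf :: "('a::euclidean_space \<Rightarrow> 'b::real_normed_vector) \<Rightarrow> ennreal" where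
  "Linf g = esssup lebesgue (\<lambda>x. ennreal (norm (g x)))"

definition L1 :: "('a::euclidean_space \<Rightarrow> 'b::real_normed_vector) \<Rightarrow> ennreal" where
  "L1 g = (\<integral>\<^sup>+x. ennreal (norm (g x)) \<partial>lebesgue)"

text \<open>For a function that is already of class \<open>C\<^sup>m\<close>, its weak derivatives up to order
  \<open>m\<close> are the classical ones.\<close>

definition C_W_inf :: "nat \<Rightarrow> (real^2 \<Rightarrow> real) \<Rightarrow> bool" where
  "C_W_inf m g \<longleftrightarrow> C_diff m g \<and> (\<forall>l\<le>m. Linf (grad_norm l g) < \<infinity>)"

definition divergence :: "(real^2 \<Rightarrow> real^2) \<Rightarrow> real^2 \<Rightarrow> real" where
  "divergence \<phi> x = (\<Sum>k\<in>UNIV. pd k (\<lambda>z. \<phi> z $ k) x)"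

definition total_variation :: "(real^2 \<Rightarrow> real) \<Rightarrow> ereal" where
  "total_variation g =
     (SUP \<phi>\<in>{\<phi>. C_diff_vec 1 \<phi> \<and> compact (closure {x. \<phi> x \<noteq> 0}) \<and> (\<forall>x. norm (\<phi> x) \<le> 1)}.
        ereal (LINT x|lebesgue. g x * divergence \<phi> x))"

definition BV :: "(real^2 \<Rightarrow> real) \<Rightarrow> bool" where
  "BV g \<longleftrightarrow> integrable lebesgue g \<and> total_variation g < \<infinity>"

text \<open>A \<open>C\<^sup>\<infinity>\<close> monotone transition from 0 to 1, for instance
  \<open>1/2 + arctan (c u) / pi\<close> with \<open>c > 0\<close>.\<close>

definition smooth_heaviside :: "(real \<Rightarrow> real) \<Rightarrow> bool" where
  "smooth_heaviside H \<longleftrightarrow>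
     (\<forall>m x. ((deriv ^^ m) H) differentiable (at x)) \<and> mono H \<and>
     (H \<longlongrightarrow> 0) at_bot \<and> (H \<longlongrightarrow> 1) at_top"

definition flux_fun :: "(real \<Rightarrow> real) \<Rightarrow> real \<Rightarrow> real \<Rightarrow> real" where
  "flux_fun H \<rho>max r = r * H (r - \<rho>max)"

text \<open>\<open>node h a\<close> is the coordinate with index \<open>a\<close>, integer or half-integer:
  \<open>node h k = (k - 1/2) h\<close> and \<open>node h (k + 1/2) = k h\<close>.\<close>

definition node :: "real \<Rightarrow> real \<Rightarrow> real" where
  "node h a = (a - 1/2) * h"

definition gridpt :: "real \<Rightarrow> real \<Rightarrow> real \<Rightarrow> real \<Rightarrow> real^2" where
  "gridpt \<Delta>x \<Delta>y a b = vector [node \<Delta>x a, node \<Delta>y b]"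

definition cell :: "real \<Rightarrow> real \<Rightarrow> int \<Rightarrow> int \<Rightarrow> (real^2) set" where
  "cell \<Delta>x \<Delta>y i j =
     {z. z $ 1 \<in> {node \<Delta>x (of_int i - 1/2) ..< node \<Delta>x (of_int i + 1/2)} \<and>
         z $ 2 \<in> {node \<Delta>y (of_int j - 1/2) ..< node \<Delta>y (of_int j + 1/2)}}"

definition cell_average :: "real \<Rightarrow> real \<Rightarrow> (real^2 \<Rightarrow> real) \<Rightarrow> int \<Rightarrow> int \<Rightarrow> real" where
  "cell_average \<Delta>x \<Delta>y \<rho>\<^sub>o i j =
     1 / (\<Delta>x * \<Delta>y) * (LINT z:cell \<Delta>x \<Delta>y i j|lebesgue. \<rho>\<^sub>o z)"

definition V_flux :: "(real^2 \<Rightarrow> real^2) \<Rightarrow> 2 \<Rightarrow> real^2 \<Rightarrow> real \<Rightarrow> real \<Rightarrow> real" where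
  "V_flux v k x u w = v x $ k * u + min 0 (v x $ k) * (w - u)"

definition F_flux :: "(real \<Rightarrow> real) \<Rightarrow> real \<Rightarrow> real \<Rightarrow> real \<Rightarrow> real" where
  "F_flux f u w J = J * f u + min 0 J * (f w - f u)"

definition conv_grad ::
  "real \<Rightarrow> real \<Rightarrow> (real^2 \<Rightarrow> real) \<Rightarrow> (int \<Rightarrow> int \<Rightarrow> real) \<Rightarrow> real \<Rightarrow> real \<Rightarrow> real^2" where
  "conv_grad \<Delta>x \<Delta>y \<eta> r a b =
     (\<chi> k. \<Delta>x * \<Delta>y *
       (\<Sum>\<^sub>\<infinity>(p, l)\<in>UNIV. r p l * pd k \<eta> (gridpt \<Delta>x \<Delta>y (a - of_int p) (b - of_int l))))"

definition J_term ::
  "real \<Rightarrow> real \<Rightarrow> real \<Rightarrow> (real^2 \<Rightarrow> real) \<Rightarrow> (int \<Rightarrow> int \<Rightarrow> real) \<Rightarrow> 2 \<Rightarrow> real \<Rightarrow> real \<Rightarrow> real"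
  where
  "J_term \<Delta>x \<Delta>y \<epsilon> \<eta> r k a b =
     - \<epsilon> * (conv_grad \<Delta>x \<Delta>y \<eta> r a b $ k) / sqrt (1 + (norm (conv_grad \<Delta>x \<Delta>y \<eta> r a b))\<^sup>2)"

definition x_step ::
  "real \<Rightarrow> real \<Rightarrow> real \<Rightarrow> real \<Rightarrow> (real^2 \<Rightarrow> real^2) \<Rightarrow> (real \<Rightarrow> real) \<Rightarrow> (real^2 \<Rightarrow> real) \<Rightarrow>
   (int \<Rightarrow> int \<Rightarrow> real) \<Rightarrow> int \<Rightarrow> int \<Rightarrow> real" where
  "x_step \<Delta>x \<Delta>y \<Delta>t \<epsilon> v f \<eta> r i j =
     (let P = (\<lambda>a. gridpt \<Delta>x \<Delta>y a (of_int j));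
          J = (\<lambda>a. J_term \<Delta>x \<Delta>y \<epsilon> \<eta> r 1 a (of_int j))
      in r i j - \<Delta>t / \<Delta>x *
          (V_flux v 1 (P (of_int i + 1/2)) (r i j) (r (i + 1) j)
           - V_flux v 1 (P (of_int i - 1/2)) (r (i - 1) j) (r i j)
           + F_flux f (r i j) (r (i + 1) j) (J (of_int i + 1/2))
           - F_flux f (r (i - 1) j) (r i j) (J (of_int i - 1/2))))"

text \<open>In the second fractional step only the first summand is the intermediate value
  \<open>rh = \<rho>\<^sup>n\<^sup>+\<^sup>1\<^sup>/\<^sup>2\<close>; all numerical fluxes are evaluated on
  \<open>r = \<rho>\<^sup>n\<close>.\<close>

definition y_step ::
  "real \<Rightarrow> real \<Rightarrow> real \<Rightarrow> real \<Rightarrow> (real^2 \<Rightarrow> real^2) \<Rightarrow> (real \<Rightarrow> real) \<Rightarrow> (real^2 \<Rightarrow> real) \<Rightarrow>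
   (int \<Rightarrow> int \<Rightarrow> real) \<Rightarrow> (int \<Rightarrow> int \<Rightarrow> real) \<Rightarrow> int \<Rightarrow> int \<Rightarrow> real" where
  "y_step \<Delta>x \<Delta>y \<Delta>t \<epsilon> v f \<eta> r rh i j =
     (let P = (\<lambda>b. gridpt \<Delta>x \<Delta>y (of_int i) b);
          J = (\<lambda>b. J_term \<Delta>x \<Delta>y \<epsilon> \<eta> r 2 (of_int i) b)
      in rh i j - \<Delta>t / \<Delta>y *
          (V_flux v 2 (P (of_int j + 1/2)) (r i j) (r i (j + 1))
           - V_flux v 2 (P (of_int j - 1/2)) (r i (j - 1)) (r i j)
           + F_flux f (r i j) (r i (j + 1)) (J (of_int j + 1/2))
           - F_flux f (r i (j - 1)) (r i j) (J (of_int j - 1/2))))"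

primrec roe ::
  "real \<Rightarrow> real \<Rightarrow> real \<Rightarrow> real \<Rightarrow> (real^2 \<Rightarrow> real^2) \<Rightarrow> (real \<Rightarrow> real) \<Rightarrow> (real^2 \<Rightarrow> real) \<Rightarrow>
   (real^2 \<Rightarrow> real) \<Rightarrow> nat \<Rightarrow> int \<Rightarrow> int \<Rightarrow> real" where
  "roe \<Delta>x \<Delta>y \<Delta>t \<epsilon> v f \<eta> \<rho>\<^sub>o 0 = cell_average \<Delta>x \<Delta>y \<rho>\<^sub>o"
| "roe \<Delta>x \<Delta>y \<Delta>t \<epsilon> v f \<eta> \<rho>\<^sub>o (Suc n) =
     (let r = roe \<Delta>x \<Delta>y \<Delta>t \<epsilon> v f \<eta> \<rho>\<^sub>o n;
          rh = x_step \<Delta>x \<Delta>y \<Delta>t \<epsilon> v f \<eta> r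
      in y_step \<Delta>x \<Delta>y \<Delta>t \<epsilon> v f \<eta> r rh)"

definition ennexp :: "ennreal \<Rightarrow> ennreal" where
  "ennexp s = (if s = \<infinity> then \<infinity> else ennreal (exp (enn2real s)))"

definition K1 ::
  "real \<Rightarrow> (real^2 \<Rightarrow> real^2) \<Rightarrow> (real \<Rightarrow> real) \<Rightarrow> (real^2 \<Rightarrow> real) \<Rightarrow> (real^2 \<Rightarrow> real) \<Rightarrow> ennreal"
  where
  "K1 \<epsilon> v f \<eta> \<rho>\<^sub>o =
     6 * (Linf (grad_norm_vec 1 v)
          + 2 * ennreal \<epsilon> * Linf (deriv f) * Linf (grad_norm 2 \<eta>) * L1 \<rho>\<^sub>o)"

definition K2 ::
  "real \<Rightarrow> (real^2 \<Rightarrow> real^2) \<Rightarrow> (real^2 \<Rightarrow> real) \<Rightarrow> (real^2 \<Rightarrow> real) \<Rightarrow> ennreal" where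
  "K2 \<epsilon> v \<eta> \<rho>\<^sub>o =
     (let c1 = 2 * Linf (grad_norm 3 \<eta>);
          c2 = 3 * (Linf (grad_norm 2 \<eta>))\<^sup>2
      in (4 * ennreal \<epsilon> * (c1 * L1 \<rho>\<^sub>o + c2 * (L1 \<rho>\<^sub>o)\<^sup>2)
          + 3 * Linf (grad_norm_vec 2 v)) * L1 \<rho>\<^sub>o)"

text \<open>For \<open>K1 = 0\<close> the quotient \<open>(2 K2 / K1) (exp (2 t K1) - 1)\<close> is read as
  its limit \<open>4 t K2\<close> for \<open>K1 \<rightarrow> 0\<close>.\<close>

definition Cx ::
  "real \<Rightarrow> real \<Rightarrow> real \<Rightarrow> (real^2 \<Rightarrow> real^2) \<Rightarrow> (real \<Rightarrow> real) \<Rightarrow> (real^2 \<Rightarrow> real) \<Rightarrow>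
   (real^2 \<Rightarrow> real) \<Rightarrow> real \<Rightarrow> ennreal" where
  "Cx \<Delta>x \<Delta>y \<epsilon> v f \<eta> \<rho>\<^sub>o t =
     (let k1 = K1 \<epsilon> v f \<eta> \<rho>\<^sub>o; k2 = K2 \<epsilon> v \<eta> \<rho>\<^sub>o;
          r0 = cell_average \<Delta>x \<Delta>y \<rho>\<^sub>o;
          E = ennexp (2 * ennreal t * k1)
      in E * (\<Sum>\<^sub>\<infinity>(i, j)\<in>UNIV.
                ennreal (\<Delta>x * \<bar>r0 i (j + 1) - r0 i j\<bar> + \<Delta>y * \<bar>r0 (i + 1) j - r0 i j\<bar>))
         + (if k1 = 0 then 4 * ennreal t * k2 else 2 * k2 / k1 * (E - 1)))"

definition Ct ::
  "real \<Rightarrow> real \<Rightarrow> real \<Rightarrow> (real^2 \<Rightarrow> real^2) \<Rightarrow> (real \<Rightarrow> real) \<Rightarrow> (real^2 \<Rightarrow> real) \<Rightarrow>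
   (real^2 \<Rightarrow> real) \<Rightarrow> real \<Rightarrow> ennreal" where
  "Ct \<Delta>x \<Delta>y \<epsilon> v f \<eta> \<rho>\<^sub>o s =
     2 * (Linf v + ennreal \<epsilon> * Linf (deriv f)) * Cx \<Delta>x \<Delta>y \<epsilon> v f \<eta> \<rho>\<^sub>o s
     + (Linf (grad_norm_vec 1 v) + 2 * ennreal \<epsilon> * Linf (grad_norm 2 \<eta>) * L1 \<rho>\<^sub>o) * L1 \<rho>\<^sub>o"

definition Cxt ::
  "real \<Rightarrow> real \<Rightarrow> real \<Rightarrow> (real^2 \<Rightarrow> real^2) \<Rightarrow> (real \<Rightarrow> real) \<Rightarrow> (real^2 \<Rightarrow> real) \<Rightarrow>
   (real^2 \<Rightarrow> real) \<Rightarrow> real \<Rightarrow> ennreal" where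
  "Cxt \<Delta>x \<Delta>y \<epsilon> v f \<eta> \<rho>\<^sub>o t =
     ennreal t * (Cx \<Delta>x \<Delta>y \<epsilon> v f \<eta> \<rho>\<^sub>o t + 2 * Ct \<Delta>x \<Delta>y \<epsilon> v f \<eta> \<rho>\<^sub>o t)"

end

theory Submission
  imports Defs
begin

text \<open>
  The scheme is conservative, so mass, space variation and time variation of the discrete solution
  are controlled one step at a time. Both fractional steps use the fluxes of the old time level;
  together they form one five-point map in which the fields \<open>v\<close> and \<open>J\<close> enter through their values on
  the edges of the cells.

  Mass. What leaves a cell arrives in a neighbour. Since \<open>0 \<le> H \<le> 1\<close>, the outflow is linear in the
  density with coefficients that do not involve \<open>L\<^sub>f\<close>; if it is at most the content of the cell, then
  positivity and the \<open>L\<^sup>1\<close> bound persist (\<open>roe_step_nonneg\<close>, \<open>roe_step_mass\<close>).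

  Space variation. Differences of the densities satisfy a scheme of the same kind, perturbed by
  first differences of the edge values times differences of the density and by second differences of
  the edge values times the density (\<open>upwind_diff_along\<close>, \<open>upwind_diff_across\<close>,
  \<open>roe_step_TV\<close>). For \<open>J\<close>, whose dependence on the convolution is the bounded map
  \<open>w \<mapsto> w / sqrt (1 + \<parallel>w\<parallel>\<^sup>2)\<close>, both kinds of differences are bounded by the derivatives of \<open>\<eta>\<close> and the
  mass (\<open>grid_C2_J_term\<close>). A discrete Gronwall argument gives \<open>C\<^sub>x\<close>.

  Time variation. One step changes the density by at most a multiple of the space variation plus
  first differences of the edge values times the mass (\<open>roe_step_time_diff\<close>), which gives \<open>C\<^sub>t\<close>.

  The delicate point is that the CFL condition bounds each direction by \<open>1/3\<close> for the modulus of the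
  edge values. If the edge values change sign inside a cell, the outflow can reach \<open>4/3\<close> of its content:
  positivity and conservation of the \<open>L\<^sup>1\<close> norm may fail, and the norm may grow by the factor
  \<open>5/3\<close> per step. A sign change costs at least as much variation of the fields over one mesh width,
  so this happens only if \<open>\<Delta>t (D + 2 \<epsilon> \<parallel>\<nabla>\<^sup>2\<eta>\<parallel> \<parallel>\<rho>\<^sub>o\<parallel>) > 1/6\<close>, where \<open>D = \<parallel>\<nabla>v\<parallel>\<close>. Then \<open>\<Delta>t K\<^sub>1 \<ge> 1\<close>, and the factor
  \<open>exp (2 \<Delta>t K\<^sub>1)\<close> per step in \<open>C\<^sub>x\<close> dominates the growth of all mass-dependent coefficients
  (\<open>E_minus_q3\<close>, \<open>TV_step\<close>), because the oscillation of \<open>J\<close> never exceeds \<open>2 \<epsilon>\<close>. For the time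
  variation the term \<open>D\<close> times the grown mass must still be absorbed by \<open>C\<^sub>x\<close>, whose source contains
  only \<open>\<parallel>\<nabla>\<^sup>2v\<parallel>\<close>; the Landau inequality \<open>\<parallel>\<nabla>v\<parallel>\<^sup>2 \<le> 4 \<parallel>v\<parallel> \<parallel>\<nabla>\<^sup>2v\<parallel>\<close> closes the gap
  (\<open>field_landau\<close>, \<open>time_excess_le\<close>).

  If \<open>\<parallel>\<nabla>v\<parallel>\<close> or \<open>\<parallel>\<nabla>\<^sup>2v\<parallel>\<close> is infinite, so is the right-hand side, unless \<open>\<rho>\<^sub>o\<close> vanishes almost everywhere
  and the left-hand side is zero.
\<close>

section \<open>Sums over the grid\<close>

lemma ennreal_summable_on: "(g :: 'a \<Rightarrow> ennreal) summable_on A"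
  by (rule nonneg_summable_on_complete) simp

definition grid_sum :: "(int \<Rightarrow> int \<Rightarrow> real) \<Rightarrow> ennreal" where
  "grid_sum g = (\<Sum>\<^sub>\<infinity>(i, j)\<in>UNIV. ennreal (g i j))"

lemma grid_sum_mono:
  assumes "\<And>i j. g i j \<le> h i j"
  shows "grid_sum g \<le> grid_sum h"
  unfolding grid_sum_def
  by (rule infsum_mono) (auto intro: ennreal_leI assms ennreal_summable_on)

lemma grid_sum_add:
  assumes "\<And>i j. 0 \<le> g i j" "\<And>i j. 0 \<le> h i j"
  shows "grid_sum (\<lambda>i j. g i j + h i j) = grid_sum g + grid_sum h"
  unfolding grid_sum_def
  by (subst infsum_add [symmetric])
     (auto intro!: infsum_cong ennreal_summable_on simp: assms ennreal_plus)

lemma grid_sum_cmult: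
  assumes "0 \<le> c"
  shows "grid_sum (\<lambda>i j. c * g i j) = ennreal c * grid_sum g"
proof -
  have "grid_sum (\<lambda>i j. c * g i j) = (\<Sum>\<^sub>\<infinity>p\<in>UNIV. ennreal c * (case p of (i, j) \<Rightarrow> ennreal (g i j)))"
    unfolding grid_sum_def by (rule infsum_cong) (auto simp: ennreal_mult' assms)
  also have "\<dots> = ennreal c * grid_sum g"
    unfolding grid_sum_def
    by (subst (1 2) nonneg_infsum_complete)
       (auto simp: SUP_mult_left_ennreal sum_distrib_left)
  finally show ?thesis .
qed

lemma grid_sum_shift:
  "grid_sum (\<lambda>i j. g (i + a) (j + b)) = grid_sum g"
proof -
  have "bij (\<lambda>(i::int, j::int). (i + a, j + b))"
    by (rule bij_betw_byWitness[where f' = "\<lambda>(i, j). (i - a, j - b)"]) auto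
  from infsum_reindex_bij_betw[OF this, of "\<lambda>(i, j). ennreal (g i j)"]
  show ?thesis unfolding grid_sum_def by (simp add: case_prod_unfold)
qed

lemma grid_sum_transpose: "grid_sum (\<lambda>i j. g j i) = grid_sum g"
proof -
  have "bij (\<lambda>(i::int, j::int). (j, i))"
    by (rule bij_betw_byWitness[where f' = "\<lambda>(i, j). (j, i)"]) auto
  from infsum_reindex_bij_betw[OF this, of "\<lambda>(i, j). ennreal (g i j)"]
  show ?thesis unfolding grid_sum_def by (simp add: case_prod_unfold)
qed

lemma grid_sum_zero_iff:
  assumes "grid_sum (\<lambda>i j. \<bar>g i j\<bar>) = 0"
  shows "g i j = 0"
proof -
  have "(\<lambda>(i, j). ennreal \<bar>g i j\<bar>) (i, j) \<le> grid_sum (\<lambda>i j. \<bar>g i j\<bar>)"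
    unfolding grid_sum_def
    by (rule order_trans[OF _ infsum_mono_neutral[of _ "{(i,j)}"]]) (auto intro: ennreal_summable_on)
  then show ?thesis using assms by simp
qed

text \<open>Finiteness of the sum of absolute values is what makes the quadrature sums of the
  non-local term meaningful.\<close>

lemma grid_sum_finite_summable:
  assumes "grid_sum (\<lambda>i j. \<bar>g i j\<bar>) \<le> ennreal B" "0 \<le> B"
  shows "(\<lambda>(i, j). \<bar>g i j\<bar>) summable_on UNIV"
    and "(\<Sum>\<^sub>\<infinity>(i, j)\<in>UNIV. \<bar>g i j\<bar>) \<le> B"
proof -
  let ?a = "\<lambda>(i, j). \<bar>g i j\<bar>"
  have fin: "sum ?a F \<le> B" if "finite F" for F
  proof -
    have "ennreal (sum ?a F) = (\<Sum>p\<in>F. ennreal (?a p))"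
      by (subst sum_ennreal) auto
    also have "\<dots> = (\<Sum>\<^sub>\<infinity>p\<in>F. ennreal (?a p))" using that by simp
    also have "\<dots> \<le> (\<Sum>\<^sub>\<infinity>p\<in>UNIV. ennreal (?a p))"
      by (rule infsum_mono_neutral) (auto intro: ennreal_summable_on)
    also have "\<dots> = grid_sum (\<lambda>i j. \<bar>g i j\<bar>)"
      unfolding grid_sum_def by (rule infsum_cong) auto
    finally have "ennreal (sum ?a F) \<le> ennreal B" using assms(1) by (rule order_trans)
    then show ?thesis using assms(2) by simp
  qed
  show s: "?a summable_on UNIV"
    by (rule nonneg_bdd_above_summable_on) (auto intro!: bdd_aboveI[of _ B] fin)
  show "infsum ?a UNIV \<le> B"
    by (rule infsum_le_finite_sums[OF s]) (auto intro: fin)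
qed

section \<open>The upwind difference operator\<close>

definition pos :: "real \<Rightarrow> real" where "pos a = max 0 a"
definition neg :: "real \<Rightarrow> real" where "neg a = min 0 a"

lemma pos_nonneg [simp]: "0 \<le> pos a" and neg_nonpos [simp]: "neg a \<le> 0"
  by (simp_all add: pos_def neg_def)

lemma pos_add_neg: "pos a + neg a = a"
  and abs_eq_pos_neg: "\<bar>a\<bar> = pos a - neg a"
  by (simp_all add: pos_def neg_def)

lemma neg_mult_le: "0 \<le> h \<Longrightarrow> neg b * h \<le> - neg a"
  by (rule order_trans[of _ 0]) (simp_all add: mult_nonpos_nonneg)

lemma neg_diff_le: "\<bar>neg a - neg b\<bar> \<le> \<bar>a - b\<bar>"
  and neg_pos_diff: "\<bar>neg a - neg b\<bar> + \<bar>pos a - pos b\<bar> = \<bar>a - b\<bar>"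
  by (auto simp: pos_def neg_def min_def max_def)

text \<open>With \<open>e\<close> on the edges (\<open>e i\<close> sits at \<open>i + 1/2\<close>), \<open>upwind e \<psi> i\<close> is the
  difference of the Roe fluxes through the two edges of cell \<open>i\<close>.\<close>

definition upwind :: "(int \<Rightarrow> real) \<Rightarrow> (int \<Rightarrow> real) \<Rightarrow> int \<Rightarrow> real" where
  "upwind e \<psi> i = pos (e i) * \<psi> i + neg (e i) * \<psi> (i + 1)
     - pos (e (i - 1)) * \<psi> (i - 1) - neg (e (i - 1)) * \<psi> i"

lemma upwind_nonconservative:
  "upwind e \<psi> i = pos (e (i - 1)) * (\<psi> i - \<psi> (i - 1)) + neg (e i) * (\<psi> (i + 1) - \<psi> i)
     + (e i - e (i - 1)) * \<psi> i"
proof -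
  have "e i - e (i - 1) = pos (e i) + neg (e i) - pos (e (i - 1)) - neg (e (i - 1))"
    using pos_add_neg[of "e i"] pos_add_neg[of "e (i - 1)"] by linarith
  then show ?thesis unfolding upwind_def by (simp only:) (simp add: algebra_simps)
qed

text \<open>The principal part common to the two difference identities below: every unit taken
  out of cell \<open>i\<close> by the diagonal reappears in a neighbour, so its column sums vanish.\<close>

definition upwind_core :: "(int \<Rightarrow> real) \<Rightarrow> (int \<Rightarrow> real) \<Rightarrow> int \<Rightarrow> real" where
  "upwind_core e d i = \<bar>e i\<bar> * d i - pos (e (i - 1)) * d (i - 1) + neg (e (i + 1)) * d (i + 1)"

text \<open>Differences of neighbouring cells on the same grid line. The last term is the only one that does
  not contain a difference of \<open>\<psi>\<close>; it carries a full second difference of \<open>e\<close>.\<close>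

lemma upwind_diff_along:
  "upwind e \<psi> (i + 1) - upwind e \<psi> i =
     upwind_core e (\<lambda>i. \<psi> (i + 1) - \<psi> i) i
     + (e (i + 1) - e i) * (\<psi> (i + 1) - \<psi> i)
     + (e (i + 1) - 2 * e i + e (i - 1)) * \<psi> i"
  unfolding upwind_nonconservative upwind_core_def abs_eq_pos_neg by (simp add: algebra_simps)

text \<open>Comparing two neighbouring grid lines. The positive and negative parts of \<open>e\<close> have no
  second differences of their own, so they are kept together with first differences of
  \<open>\<psi>'\<close>; only the full mixed difference of \<open>e\<close> multiplies \<open>\<psi>'\<close> itself.\<close>

lemma upwind_diff_across:
  fixes e e' \<psi> \<psi>' :: "int \<Rightarrow> real"
  defines "d \<equiv> \<lambda>j. \<psi>' j - \<psi> j"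
  defines "r \<equiv> \<lambda>j. neg (e j) - neg (e (j - 1))"
  shows "upwind e' \<psi>' j - upwind e \<psi> j =
     upwind_core e d j + r j * d j - r (j + 1) * d (j + 1)
     + (e' j - e j - (e' (j - 1) - e (j - 1))) * \<psi>' j
     + (neg (e' j) - neg (e j)) * (\<psi>' (j + 1) - \<psi>' j)
     + (pos (e' (j - 1)) - pos (e (j - 1))) * (\<psi>' j - \<psi>' (j - 1))"
proof -
  have *: "e' j - e j - (e' (j - 1) - e (j - 1)) =
      pos (e' j) + neg (e' j) - (pos (e j) + neg (e j))
       - (pos (e' (j - 1)) + neg (e' (j - 1)) - (pos (e (j - 1)) + neg (e (j - 1))))"
    by (simp only: pos_add_neg)
  show ?thesis
    unfolding * upwind_def upwind_core_def d_def r_def abs_eq_pos_neg by (simp add: algebra_simps)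
qed

lemma grid_sum_linear3:
  assumes "0 \<le> a" "0 \<le> b" "0 \<le> c" "\<And>i j. 0 \<le> f i j" "\<And>i j. 0 \<le> g i j" "\<And>i j. 0 \<le> h i j"
  shows "grid_sum (\<lambda>i j. a * f i j + b * g i j + c * h i j) =
    ennreal a * grid_sum f + ennreal b * grid_sum g + ennreal c * grid_sum h"
  using assms by (simp add: grid_sum_add grid_sum_cmult)

section \<open>One step of the scheme\<close>

text \<open>A sum over cells that only involves a cell and its four neighbours is estimated by
  collecting, for each cell, all the places in which it occurs.\<close>

lemma grid_sum_neighbours_le:
  assumes nn: "\<And>i j. 0 \<le> A i j" "\<And>i j. 0 \<le> B i j" "\<And>i j. 0 \<le> C i j" "\<And>i j. 0 \<le> D i j" "\<And>i j. 0 \<le> E i j"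
    and le: "\<And>i j. g i j \<le> A i j + B (i - 1) j + C (i + 1) j + D i (j - 1) + E i (j + 1)"
    and h: "\<And>i j. A i j + B i j + C i j + D i j + E i j \<le> h i j"
  shows "grid_sum g \<le> grid_sum h"
proof -
  have "grid_sum g \<le> grid_sum (\<lambda>i j. A i j + B (i - 1) j + C (i + 1) j + D i (j - 1) + E i (j + 1))"
    by (rule grid_sum_mono) (rule le)
  also have "\<dots> = grid_sum A + grid_sum (\<lambda>i j. B (i - 1) j) + grid_sum (\<lambda>i j. C (i + 1) j)
      + grid_sum (\<lambda>i j. D i (j - 1)) + grid_sum (\<lambda>i j. E i (j + 1))"
    by (simp add: grid_sum_add nn)
  also have "\<dots> = grid_sum A + grid_sum B + grid_sum C + grid_sum D + grid_sum E"
    using grid_sum_shift[of B "-1" 0] grid_sum_shift[of C 1 0]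
      grid_sum_shift[of D 0 "-1"] grid_sum_shift[of E 0 1]
    by simp
  also have "\<dots> = grid_sum (\<lambda>i j. A i j + B i j + C i j + D i j + E i j)"
    by (simp add: grid_sum_add nn)
  also have "\<dots> \<le> grid_sum h"
    by (rule grid_sum_mono) (rule h)
  finally show ?thesis .
qed

text \<open>One step for arbitrary edge values: \<open>a1\<close>, \<open>b1\<close> on the edges \<open>(i + 1/2, j)\<close> and
  \<open>a2\<close>, \<open>b2\<close> on the edges \<open>(i, j + 1/2)\<close>. The \<open>a\<close> transport the density, the \<open>b\<close> transport
  its image under \<open>f\<close>.\<close>

definition roe_step :: "real \<Rightarrow> real \<Rightarrow> (int \<Rightarrow> int \<Rightarrow> real) \<Rightarrow> (int \<Rightarrow> int \<Rightarrow> real) \<Rightarrow>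
    (int \<Rightarrow> int \<Rightarrow> real) \<Rightarrow> (int \<Rightarrow> int \<Rightarrow> real) \<Rightarrow> (real \<Rightarrow> real) \<Rightarrow> (int \<Rightarrow> int \<Rightarrow> real) \<Rightarrow>
    int \<Rightarrow> int \<Rightarrow> real" where
  "roe_step lx ly a1 b1 a2 b2 f r i j = r i j
     - lx * (upwind (\<lambda>i. a1 i j) (\<lambda>i. r i j) i + upwind (\<lambda>i. b1 i j) (\<lambda>i. f (r i j)) i)
     - ly * (upwind (a2 i) (r i) j + upwind (b2 i) (\<lambda>j. f (r i j)) j)"

lemma roe_step_transpose:
  "roe_step lx ly a1 b1 a2 b2 f r i j =
   roe_step ly lx (\<lambda>i j. a2 j i) (\<lambda>i j. b2 j i) (\<lambda>i j. a1 j i) (\<lambda>i j. b1 j i) f (\<lambda>i j. r j i) j i"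
  unfolding roe_step_def by simp

subsection \<open>Mass\<close>

text \<open>The share of the density of cell \<open>(i, j)\<close> that leaves it in one step, when
  \<open>f (r i j) = h i j * r i j\<close>.\<close>

definition outflow where
  "outflow lx ly a1 b1 a2 b2 h i j =
     lx * (pos (a1 i j) + pos (b1 i j) * h i j - neg (a1 (i - 1) j) - neg (b1 (i - 1) j) * h i j)
   + ly * (pos (a2 i j) + pos (b2 i j) * h i j - neg (a2 i (j - 1)) - neg (b2 i (j - 1)) * h i j)"
  for lx ly :: real and a1 b1 a2 b2 h :: "int \<Rightarrow> int \<Rightarrow> real"

lemma roe_step_eq_outflow:
  fixes lx ly :: real and a1 b1 a2 b2 h :: "int \<Rightarrow> int \<Rightarrow> real"
  assumes "\<And>i j. f (r i j) = h i j * r i j"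
  shows "roe_step lx ly a1 b1 a2 b2 f r i j =
     (1 - outflow lx ly a1 b1 a2 b2 h i j) * r i j
     + lx * (pos (a1 (i - 1) j) + pos (b1 (i - 1) j) * h (i - 1) j) * r (i - 1) j
     + lx * (- neg (a1 i j) - neg (b1 i j) * h (i + 1) j) * r (i + 1) j
     + ly * (pos (a2 i (j - 1)) + pos (b2 i (j - 1)) * h i (j - 1)) * r i (j - 1)
     + ly * (- neg (a2 i j) - neg (b2 i j) * h i (j + 1)) * r i (j + 1)"
  unfolding roe_step_def upwind_def outflow_def assms by (simp add: algebra_simps)

lemma roe_step_nonneg:
  fixes lx ly :: real and a1 b1 a2 b2 h :: "int \<Rightarrow> int \<Rightarrow> real"
  assumes "\<And>i j. f (r i j) = h i j * r i j" "\<And>i j. 0 \<le> h i j" "\<And>i j. 0 \<le> r i j"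
    and "0 \<le> lx" "0 \<le> ly" and "\<And>i j. outflow lx ly a1 b1 a2 b2 h i j \<le> 1"
  shows "0 \<le> roe_step lx ly a1 b1 a2 b2 f r i j"
  unfolding roe_step_eq_outflow[of f r h, OF assms(1)]
  using assms by (intro add_nonneg_nonneg mult_nonneg_nonneg)
    (auto intro!: add_nonneg_nonneg mult_nonneg_nonneg simp: neg_mult_le)

text \<open>Everything that leaves a cell arrives in a neighbour; mass is only created where more
  than the whole content of a cell leaves it.\<close>

lemma roe_step_mass:
  fixes lx ly q :: real and a1 b1 a2 b2 h :: "int \<Rightarrow> int \<Rightarrow> real"
  assumes f: "\<And>i j. f (r i j) = h i j * r i j" and h: "\<And>i j. 0 \<le> h i j"
    and l: "0 \<le> lx" "0 \<le> ly"
    and q: "\<And>i j. \<bar>1 - outflow lx ly a1 b1 a2 b2 h i j\<bar> + outflow lx ly a1 b1 a2 b2 h i j \<le> q"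
  shows "grid_sum (\<lambda>i j. \<bar>roe_step lx ly a1 b1 a2 b2 f r i j\<bar>) \<le> ennreal q * grid_sum (\<lambda>i j. \<bar>r i j\<bar>)"
proof -
  let ?c = "outflow lx ly a1 b1 a2 b2 h"
  have q0: "0 \<le> q" using q[of 0 0] by linarith
  define B where "B i j = lx * (pos (a1 i j) + pos (b1 i j) * h i j)" for i j
  define C where "C i j = lx * (- neg (a1 (i - 1) j) - neg (b1 (i - 1) j) * h i j)" for i j
  define D where "D i j = ly * (pos (a2 i j) + pos (b2 i j) * h i j)" for i j
  define E where "E i j = ly * (- neg (a2 i (j - 1)) - neg (b2 i (j - 1)) * h i j)" for i j
  have nn: "0 \<le> B i j" "0 \<le> C i j" "0 \<le> D i j" "0 \<le> E i j" for i j
    unfolding B_def C_def D_def E_def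
    using l h[of i j]
    by (auto intro!: mult_nonneg_nonneg add_nonneg_nonneg simp: neg_mult_le)
  have c: "?c i j = B i j + C i j + D i j + E i j" for i j
    unfolding outflow_def B_def C_def D_def E_def by (simp add: algebra_simps)
  have "grid_sum (\<lambda>i j. \<bar>roe_step lx ly a1 b1 a2 b2 f r i j\<bar>) \<le> grid_sum (\<lambda>i j. q * \<bar>r i j\<bar>)"
  proof (rule grid_sum_neighbours_le[where A = "\<lambda>i j. \<bar>1 - ?c i j\<bar> * \<bar>r i j\<bar>" and B = "\<lambda>i j. B i j * \<bar>r i j\<bar>"
        and C = "\<lambda>i j. C i j * \<bar>r i j\<bar>" and D = "\<lambda>i j. D i j * \<bar>r i j\<bar>" and E = "\<lambda>i j. E i j * \<bar>r i j\<bar>"])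
    fix i j
    have abs_nn: "\<bar>x * y\<bar> = x * \<bar>y\<bar>" if "0 \<le> x" for x y :: real using that by (simp add: abs_mult)
    have "roe_step lx ly a1 b1 a2 b2 f r i j = (1 - ?c i j) * r i j + B (i - 1) j * r (i - 1) j
        + C (i + 1) j * r (i + 1) j + D i (j - 1) * r i (j - 1) + E i (j + 1) * r i (j + 1)"
      unfolding roe_step_eq_outflow[of f r h, OF f] B_def C_def D_def E_def by simp
    then have "\<bar>roe_step lx ly a1 b1 a2 b2 f r i j\<bar> \<le> \<bar>(1 - ?c i j) * r i j\<bar> + \<bar>B (i - 1) j * r (i - 1) j\<bar>
        + \<bar>C (i + 1) j * r (i + 1) j\<bar> + \<bar>D i (j - 1) * r i (j - 1)\<bar> + \<bar>E i (j + 1) * r i (j + 1)\<bar>"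
      by linarith
    then show "\<bar>roe_step lx ly a1 b1 a2 b2 f r i j\<bar> \<le> \<bar>1 - ?c i j\<bar> * \<bar>r i j\<bar> + B (i - 1) j * \<bar>r (i - 1) j\<bar>
        + C (i + 1) j * \<bar>r (i + 1) j\<bar> + D i (j - 1) * \<bar>r i (j - 1)\<bar> + E i (j + 1) * \<bar>r i (j + 1)\<bar>"
      unfolding nn[THEN abs_nn] abs_mult[of "1 - ?c i j"] .
    have "\<bar>1 - ?c i j\<bar> * \<bar>r i j\<bar> + B i j * \<bar>r i j\<bar> + C i j * \<bar>r i j\<bar> + D i j * \<bar>r i j\<bar> + E i j * \<bar>r i j\<bar>
        = (\<bar>1 - ?c i j\<bar> + ?c i j) * \<bar>r i j\<bar>"
      unfolding c by (simp only: distrib_right add.assoc)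
    also have "\<dots> \<le> q * \<bar>r i j\<bar>" by (rule mult_right_mono) (use q in auto)
    finally show "\<bar>1 - ?c i j\<bar> * \<bar>r i j\<bar> + B i j * \<bar>r i j\<bar> + C i j * \<bar>r i j\<bar> + D i j * \<bar>r i j\<bar>
        + E i j * \<bar>r i j\<bar> \<le> q * \<bar>r i j\<bar>" .
  qed (use nn in auto)
  then show ?thesis by (simp add: grid_sum_cmult q0)
qed

subsection \<open>Total variation\<close>

text \<open>The horizontal differences are transported by the scheme itself, with slope \<open>\<theta>\<close> of \<open>f\<close>; this is the
  part estimated by \<open>\<mu>\<close>. The rest comes from the variation of the edge values: \<open>\<kappa>\<close> for variation along
  the transport direction (once for the horizontal and twice for the vertical fluxes, where a
  neighbouring edge had to be shifted), \<open>\<kappa>'\<close> for variation across it, which couples to the vertical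
  differences, and \<open>\<sigma>\<close> for second differences.\<close>

lemma roe_step_xdiff_le:
  fixes lx ly L \<mu> \<kappa> \<kappa>' \<sigma> :: real and a1 b1 a2 b2 r \<theta> :: "int \<Rightarrow> int \<Rightarrow> real" and f :: "real \<Rightarrow> real"
  assumes l: "0 \<le> lx" "0 \<le> ly" and L: "0 \<le> L"
    and f: "\<And>x. \<bar>f x\<bar> \<le> \<bar>x\<bar>" "\<And>x y. \<bar>f x - f y\<bar> \<le> L * \<bar>x - y\<bar>"
    and \<theta>: "\<And>i j. f (r (i + 1) j) - f (r i j) = \<theta> i j * (r (i + 1) j - r i j)"
    and \<mu>: "\<And>i j. \<bar>1 - (lx * (\<bar>a1 i j\<bar> + \<bar>b1 i j\<bar> * \<theta> i j) + ly * (\<bar>a2 i j\<bar> + \<bar>b2 i j\<bar> * \<theta> i j))\<bar>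
          + (lx * (\<bar>a1 i j\<bar> + \<bar>b1 i j\<bar> * \<bar>\<theta> i j\<bar>) + ly * (\<bar>a2 i j\<bar> + \<bar>b2 i j\<bar> * \<bar>\<theta> i j\<bar>)) \<le> \<mu>"
    and x1: "\<And>i j. lx * (\<bar>a1 (i + 1) j - a1 i j\<bar> + L * \<bar>b1 (i + 1) j - b1 i j\<bar>) \<le> \<kappa>"
    and y1: "\<And>i j. ly * (\<bar>a2 i (j + 1) - a2 i j\<bar> + L * \<bar>b2 i (j + 1) - b2 i j\<bar>) \<le> \<kappa>"
    and y2: "\<And>i j. ly * (\<bar>a2 (i + 1) j - a2 i j\<bar> + L * \<bar>b2 (i + 1) j - b2 i j\<bar>) \<le> \<kappa>'"
    and xx: "\<And>i j. lx * (\<bar>a1 (i + 1) j - 2 * a1 i j + a1 (i - 1) j\<bar>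
          + \<bar>b1 (i + 1) j - 2 * b1 i j + b1 (i - 1) j\<bar>) \<le> \<sigma>"
    and xy: "\<And>i j. ly * (\<bar>a2 (i + 1) j - a2 i j - (a2 (i + 1) (j - 1) - a2 i (j - 1))\<bar>
          + \<bar>b2 (i + 1) j - b2 i j - (b2 (i + 1) (j - 1) - b2 i (j - 1))\<bar>) \<le> \<sigma>"
  defines "r' \<equiv> roe_step lx ly a1 b1 a2 b2 f r"
  shows "grid_sum (\<lambda>i j. \<bar>r' (i + 1) j - r' i j\<bar>) \<le>
     ennreal (\<mu> + 3 * \<kappa>) * grid_sum (\<lambda>i j. \<bar>r (i + 1) j - r i j\<bar>)
     + ennreal \<kappa>' * grid_sum (\<lambda>i j. \<bar>r i (j + 1) - r i j\<bar>)
     + ennreal (2 * \<sigma>) * grid_sum (\<lambda>i j. \<bar>r i j\<bar>)"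
proof -
  define d where "d i j = r (i + 1) j - r i j" for i j
  define p where "p i j = f (r (i + 1) j) - f (r i j)" for i j
  define u where "u i j = r i (j + 1) - r i j" for i j
  define w where "w i j = f (r i (j + 1)) - f (r i j)" for i j
  define S where "S i j = lx * (\<bar>a1 i j\<bar> * d i j + \<bar>b1 i j\<bar> * p i j) + ly * (\<bar>a2 i j\<bar> * d i j + \<bar>b2 i j\<bar> * p i j)" for i j
  define Rt where "Rt i j = lx * (pos (a1 i j) * d i j + pos (b1 i j) * p i j)" for i j
  define Lt where "Lt i j = lx * (neg (a1 i j) * d i j + neg (b1 i j) * p i j)" for i j
  define Up where "Up i j = ly * (pos (a2 i j) * d i j + pos (b2 i j) * p i j)" for i j
  define Dn where "Dn i j = ly * (neg (a2 i j) * d i j + neg (b2 i j) * p i j)" for i j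
  define X where "X i j = lx * ((a1 (i + 1) j - a1 i j) * d i j + (b1 (i + 1) j - b1 i j) * p i j)" for i j
  define X2 where "X2 i j = lx * ((a1 (i + 1) j - 2 * a1 i j + a1 (i - 1) j) * r i j
      + (b1 (i + 1) j - 2 * b1 i j + b1 (i - 1) j) * f (r i j))" for i j
  define Y where "Y i j = ly * ((neg (a2 i j) - neg (a2 i (j - 1))) * d i j
      + (neg (b2 i j) - neg (b2 i (j - 1))) * p i j)" for i j
  define Z where "Z i j = ly * ((a2 (i + 1) j - a2 i j - (a2 (i + 1) (j - 1) - a2 i (j - 1))) * r (i + 1) j
      + (b2 (i + 1) j - b2 i j - (b2 (i + 1) (j - 1) - b2 i (j - 1))) * f (r (i + 1) j))" for i j
  define Fm where "Fm i j = ly * ((neg (a2 (i + 1) j) - neg (a2 i j)) * u (i + 1) j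
      + (neg (b2 (i + 1) j) - neg (b2 i j)) * w (i + 1) j)" for i j
  define Fp where "Fp i j = ly * ((pos (a2 (i + 1) j) - pos (a2 i j)) * u (i + 1) j
      + (pos (b2 (i + 1) j) - pos (b2 i j)) * w (i + 1) j)" for i j
  have p\<theta>: "p i j = \<theta> i j * d i j" for i j unfolding p_def d_def by (rule \<theta>)
  have pL: "\<bar>p i j\<bar> \<le> L * \<bar>d i j\<bar>" for i j unfolding p_def d_def by (rule f)
  have wL: "\<bar>w i j\<bar> \<le> L * \<bar>u i j\<bar>" for i j unfolding w_def u_def by (rule f)
  have eq: "r' (i + 1) j - r' i j = (d i j - S i j) + Rt (i - 1) j - Lt (i + 1) j + Up i (j - 1) - Dn i (j + 1)
      - X i j - X2 i j - Y i j + Y i (j + 1) - Z i j - Fm i j - Fp i (j - 1)" for i j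
  proof -
    have "r' (i + 1) j - r' i j = d i j
       - lx * ((upwind (\<lambda>i. a1 i j) (\<lambda>i. r i j) (i + 1) - upwind (\<lambda>i. a1 i j) (\<lambda>i. r i j) i)
             + (upwind (\<lambda>i. b1 i j) (\<lambda>i. f (r i j)) (i + 1) - upwind (\<lambda>i. b1 i j) (\<lambda>i. f (r i j)) i))
       - ly * ((upwind (a2 (i + 1)) (r (i + 1)) j - upwind (a2 i) (r i) j)
             + (upwind (b2 (i + 1)) (\<lambda>j. f (r (i + 1) j)) j - upwind (b2 i) (\<lambda>j. f (r i j)) j))"
      unfolding r'_def roe_step_def d_def by (simp add: algebra_simps)
    then show ?thesis
      unfolding upwind_diff_along upwind_diff_across upwind_core_def
        S_def Rt_def Lt_def Up_def Dn_def X_def X2_def Y_def Z_def Fm_def Fp_def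
        d_def p_def u_def w_def abs_eq_pos_neg
      by (simp add: algebra_simps)
  qed
  have two: "\<bar>c * (x * a + y * b)\<bar> \<le> c * (\<bar>x\<bar> + L * \<bar>y\<bar>) * \<bar>a\<bar>"
    if "0 \<le> c" "\<bar>b\<bar> \<le> L * \<bar>a\<bar>" for c x y a b :: real
  proof -
    have "\<bar>x * a + y * b\<bar> \<le> \<bar>x\<bar> * \<bar>a\<bar> + \<bar>y\<bar> * \<bar>b\<bar>"
      by (metis abs_mult abs_triangle_ineq)
    also have "\<dots> \<le> \<bar>x\<bar> * \<bar>a\<bar> + \<bar>y\<bar> * (L * \<bar>a\<bar>)"
      using that by (intro add_left_mono mult_left_mono) auto
    also have "\<dots> = (\<bar>x\<bar> + L * \<bar>y\<bar>) * \<bar>a\<bar>" by (simp add: algebra_simps)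
    finally have "c * \<bar>x * a + y * b\<bar> \<le> c * ((\<bar>x\<bar> + L * \<bar>y\<bar>) * \<bar>a\<bar>)"
      using that by (intro mult_left_mono)
    then show ?thesis using that by (simp add: abs_mult mult.assoc)
  qed
  have lip: "\<bar>neg a - neg b\<bar> \<le> \<bar>a - b\<bar>" for a b by (rule neg_diff_le)
  have bX: "\<bar>X i j\<bar> \<le> \<kappa> * \<bar>d i j\<bar>" for i j
    unfolding X_def by (rule order_trans[OF two[OF l(1) pL] mult_right_mono[OF x1]]) simp
  have bY: "\<bar>Y i j\<bar> \<le> \<kappa> * \<bar>d i j\<bar>" for i j
  proof -
    have "ly * (\<bar>neg (a2 i j) - neg (a2 i (j - 1))\<bar> + L * \<bar>neg (b2 i j) - neg (b2 i (j - 1))\<bar>)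
        \<le> ly * (\<bar>a2 i (j - 1 + 1) - a2 i (j - 1)\<bar> + L * \<bar>b2 i (j - 1 + 1) - b2 i (j - 1)\<bar>)"
      using l L lip by (intro mult_left_mono add_mono) auto
    also have "\<dots> \<le> \<kappa>" by (rule y1)
    finally show ?thesis
      unfolding Y_def by (intro order_trans[OF two[OF l(2) pL] mult_right_mono]) auto
  qed
  have bF: "\<bar>Fm i j\<bar> + \<bar>Fp i j\<bar> \<le> \<kappa>' * \<bar>u (i + 1) j\<bar>" for i j
  proof -
    have "\<bar>Fm i j\<bar> + \<bar>Fp i j\<bar> \<le>
       ly * (\<bar>neg (a2 (i + 1) j) - neg (a2 i j)\<bar> + L * \<bar>neg (b2 (i + 1) j) - neg (b2 i j)\<bar>) * \<bar>u (i + 1) j\<bar>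
     + ly * (\<bar>pos (a2 (i + 1) j) - pos (a2 i j)\<bar> + L * \<bar>pos (b2 (i + 1) j) - pos (b2 i j)\<bar>) * \<bar>u (i + 1) j\<bar>"
      unfolding Fm_def Fp_def by (intro add_mono two[OF l(2) wL])
    also have "\<dots> = ly * ((\<bar>neg (a2 (i + 1) j) - neg (a2 i j)\<bar> + \<bar>pos (a2 (i + 1) j) - pos (a2 i j)\<bar>)
       + L * (\<bar>neg (b2 (i + 1) j) - neg (b2 i j)\<bar> + \<bar>pos (b2 (i + 1) j) - pos (b2 i j)\<bar>)) * \<bar>u (i + 1) j\<bar>"
      by (simp add: algebra_simps)
    also have "\<dots> \<le> \<kappa>' * \<bar>u (i + 1) j\<bar>"
      unfolding neg_pos_diff by (rule mult_right_mono[OF y2]) simp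
    finally show ?thesis .
  qed
  have src: "\<bar>c * (x * r i j + y * f (r i j))\<bar> \<le> c * (\<bar>x\<bar> + \<bar>y\<bar>) * \<bar>r i j\<bar>" if "0 \<le> c" for c x y i j
  proof -
    have "\<bar>x * r i j + y * f (r i j)\<bar> \<le> \<bar>x\<bar> * \<bar>r i j\<bar> + \<bar>y\<bar> * \<bar>f (r i j)\<bar>"
      by (metis abs_mult abs_triangle_ineq)
    also have "\<dots> \<le> \<bar>x\<bar> * \<bar>r i j\<bar> + \<bar>y\<bar> * \<bar>r i j\<bar>"
      using f(1) by (intro add_left_mono mult_left_mono) auto
    finally have "c * \<bar>x * r i j + y * f (r i j)\<bar> \<le> c * (\<bar>x\<bar> * \<bar>r i j\<bar> + \<bar>y\<bar> * \<bar>r i j\<bar>)"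
      using that by (intro mult_left_mono)
    moreover have "\<bar>c * (x * r i j + y * f (r i j))\<bar> = c * \<bar>x * r i j + y * f (r i j)\<bar>"
      using that by (simp add: abs_mult)
    ultimately show ?thesis by (simp add: algebra_simps)
  qed
  have bX2: "\<bar>X2 i j\<bar> \<le> \<sigma> * \<bar>r i j\<bar>" for i j
    unfolding X2_def by (rule order_trans[OF src[OF l(1)] mult_right_mono[OF xx]]) simp
  have bZ: "\<bar>Z i j\<bar> \<le> \<sigma> * \<bar>r (i + 1) j\<bar>" for i j
    unfolding Z_def by (rule order_trans[OF src[OF l(2)] mult_right_mono[OF xy]]) simp
  have core: "\<bar>d i j - S i j\<bar> + \<bar>Rt i j\<bar> + \<bar>Lt i j\<bar> + \<bar>Up i j\<bar> + \<bar>Dn i j\<bar> \<le> \<mu> * \<bar>d i j\<bar>" for i j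
  proof -
    have mm: "\<bar>c * (pos a * d i j + pos b * p i j)\<bar> + \<bar>c * (neg a * d i j + neg b * p i j)\<bar>
        \<le> c * (\<bar>a\<bar> + \<bar>b\<bar> * \<bar>\<theta> i j\<bar>) * \<bar>d i j\<bar>" if "0 \<le> c" for a b c :: real
    proof -
      have "\<bar>pos a * d i j + pos b * p i j\<bar> \<le> \<bar>pos a\<bar> * \<bar>d i j\<bar> + \<bar>pos b\<bar> * \<bar>p i j\<bar>"
        "\<bar>neg a * d i j + neg b * p i j\<bar> \<le> \<bar>neg a\<bar> * \<bar>d i j\<bar> + \<bar>neg b\<bar> * \<bar>p i j\<bar>"
        by (metis abs_mult abs_triangle_ineq)+
      then have "\<bar>pos a * d i j + pos b * p i j\<bar> + \<bar>neg a * d i j + neg b * p i j\<bar>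
          \<le> (\<bar>pos a\<bar> + \<bar>neg a\<bar>) * \<bar>d i j\<bar> + (\<bar>pos b\<bar> + \<bar>neg b\<bar>) * \<bar>p i j\<bar>"
        by (simp add: algebra_simps)
      also have "\<dots> = (\<bar>a\<bar> + \<bar>b\<bar> * \<bar>\<theta> i j\<bar>) * \<bar>d i j\<bar>"
      proof -
        have parts: "\<bar>pos x\<bar> + \<bar>neg x\<bar> = \<bar>x\<bar>" for x by (simp add: pos_def neg_def)
        show ?thesis unfolding parts p\<theta> abs_mult by (simp add: algebra_simps)
      qed
      finally have "c * (\<bar>pos a * d i j + pos b * p i j\<bar> + \<bar>neg a * d i j + neg b * p i j\<bar>)
          \<le> c * ((\<bar>a\<bar> + \<bar>b\<bar> * \<bar>\<theta> i j\<bar>) * \<bar>d i j\<bar>)" using that by (intro mult_left_mono)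
      moreover have abs_c: "\<bar>c * z\<bar> = c * \<bar>z\<bar>" for z using that by (simp add: abs_mult)
      ultimately show ?thesis by (simp only: abs_c distrib_left[symmetric] mult.assoc)
    qed
    have add5: "s + a + b + c + e \<le> z" if "a + b \<le> x" "c + e \<le> y" "s + (x + y) \<le> z"
      for a b c e s x y z :: real using that by linarith
    have dS: "d i j - S i j = (1 - (lx * (\<bar>a1 i j\<bar> + \<bar>b1 i j\<bar> * \<theta> i j) + ly * (\<bar>a2 i j\<bar> + \<bar>b2 i j\<bar> * \<theta> i j))) * d i j"
      unfolding S_def p\<theta> by (simp add: algebra_simps)
    have "\<bar>d i j - S i j\<bar> + (lx * (\<bar>a1 i j\<bar> + \<bar>b1 i j\<bar> * \<bar>\<theta> i j\<bar>) * \<bar>d i j\<bar>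
        + ly * (\<bar>a2 i j\<bar> + \<bar>b2 i j\<bar> * \<bar>\<theta> i j\<bar>) * \<bar>d i j\<bar>) =
        (\<bar>1 - (lx * (\<bar>a1 i j\<bar> + \<bar>b1 i j\<bar> * \<theta> i j) + ly * (\<bar>a2 i j\<bar> + \<bar>b2 i j\<bar> * \<theta> i j))\<bar>
          + (lx * (\<bar>a1 i j\<bar> + \<bar>b1 i j\<bar> * \<bar>\<theta> i j\<bar>) + ly * (\<bar>a2 i j\<bar> + \<bar>b2 i j\<bar> * \<bar>\<theta> i j\<bar>))) * \<bar>d i j\<bar>"
      unfolding dS abs_mult by (simp only: distrib_right)
    also have "\<dots> \<le> \<mu> * \<bar>d i j\<bar>" by (rule mult_right_mono[OF \<mu>]) simp
    finally show ?thesis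
      using add5[OF mm[OF l(1), of "a1 i j" "b1 i j"] mm[OF l(2), of "a2 i j" "b2 i j"], of "\<bar>d i j - S i j\<bar>"]
      unfolding Rt_def[symmetric] Lt_def[symmetric] Up_def[symmetric] Dn_def[symmetric] by blast
  qed
  have "grid_sum (\<lambda>i j. \<bar>r' (i + 1) j - r' i j\<bar>)
     \<le> grid_sum (\<lambda>i j. (\<mu> + 3 * \<kappa>) * \<bar>d i j\<bar> + \<kappa>' * \<bar>u (i + 1) j\<bar> + (\<sigma> * \<bar>r i j\<bar> + \<sigma> * \<bar>r (i + 1) j\<bar>))"
  proof (rule grid_sum_neighbours_le[where B = "\<lambda>i j. \<bar>Rt i j\<bar>" and C = "\<lambda>i j. \<bar>Lt i j\<bar>"
        and A = "\<lambda>i j. \<bar>d i j - S i j\<bar> + \<bar>X i j\<bar> + \<bar>X2 i j\<bar> + \<bar>Y i j\<bar> + \<bar>Z i j\<bar> + \<bar>Fm i j\<bar>"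
        and D = "\<lambda>i j. \<bar>Up i j\<bar> + \<bar>Fp i j\<bar>" and E = "\<lambda>i j. \<bar>Dn i j\<bar> + \<bar>Y i j\<bar>"])
    fix i j
    (* of the absolute value only x \<le> m x and - x \<le> m x matter here *)
    define m :: "real \<Rightarrow> real" where "m = abs"
    have m: "x \<le> m x" "- x \<le> m x" for x by (simp_all add: m_def)
    note ms = m[of "d i j - S i j"] m[of "Rt (i - 1) j"] m[of "Lt (i + 1) j"] m[of "Up i (j - 1)"]
      m[of "Dn i (j + 1)"] m[of "X i j"] m[of "X2 i j"] m[of "Y i j"] m[of "Y i (j + 1)"] m[of "Z i j"]
      m[of "Fm i j"] m[of "Fp i (j - 1)"]
    show "\<bar>r' (i + 1) j - r' i j\<bar> \<le>
       \<bar>d i j - S i j\<bar> + \<bar>X i j\<bar> + \<bar>X2 i j\<bar> + \<bar>Y i j\<bar> + \<bar>Z i j\<bar> + \<bar>Fm i j\<bar> + \<bar>Rt (i - 1) j\<bar> + \<bar>Lt (i + 1) j\<bar>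
       + (\<bar>Up i (j - 1)\<bar> + \<bar>Fp i (j - 1)\<bar>) + (\<bar>Dn i (j + 1)\<bar> + \<bar>Y i (j + 1)\<bar>)"
      unfolding eq
      by (rule abs_leI; unfold m_def[symmetric]; use ms in linarith)
    have "(\<mu> + 3 * \<kappa>) * \<bar>d i j\<bar> = \<mu> * \<bar>d i j\<bar> + 3 * (\<kappa> * \<bar>d i j\<bar>)" by (simp add: algebra_simps)
    then show "\<bar>d i j - S i j\<bar> + \<bar>X i j\<bar> + \<bar>X2 i j\<bar> + \<bar>Y i j\<bar> + \<bar>Z i j\<bar> + \<bar>Fm i j\<bar> + \<bar>Rt i j\<bar> + \<bar>Lt i j\<bar>
       + (\<bar>Up i j\<bar> + \<bar>Fp i j\<bar>) + (\<bar>Dn i j\<bar> + \<bar>Y i j\<bar>)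
       \<le> (\<mu> + 3 * \<kappa>) * \<bar>d i j\<bar> + \<kappa>' * \<bar>u (i + 1) j\<bar> + (\<sigma> * \<bar>r i j\<bar> + \<sigma> * \<bar>r (i + 1) j\<bar>)"
      using core[of i j] bX[of i j] bX2[of i j] bY[of i j] bZ[of i j] bF[of i j]
      unfolding m_def[symmetric] by linarith
  qed auto
  also have "\<dots> = ennreal (\<mu> + 3 * \<kappa>) * grid_sum (\<lambda>i j. \<bar>d i j\<bar>) + ennreal \<kappa>' * grid_sum (\<lambda>i j. \<bar>u i j\<bar>)
      + ennreal (2 * \<sigma>) * grid_sum (\<lambda>i j. \<bar>r i j\<bar>)"
  proof -
    have sg: "0 \<le> lx * (\<bar>a\<bar> + \<bar>b\<bar>)" "0 \<le> lx * (\<bar>a\<bar> + L * \<bar>b\<bar>)" "0 \<le> ly * (\<bar>a\<bar> + L * \<bar>b\<bar>)" for a b :: real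
      using l L by auto
    have nn: "0 \<le> \<sigma>" "0 \<le> \<kappa>" "0 \<le> \<kappa>'"
      by (rule order_trans[OF sg(1) xx] order_trans[OF sg(2) x1] order_trans[OF sg(3) y2])+
    have "0 \<le> \<mu>" by (rule order_trans[OF _ \<mu>[of 0 0]]) (use l in auto)
    have "ennreal \<sigma> * G + ennreal \<sigma> * G = ennreal (2 * \<sigma>) * G" for G
      using nn by (simp add: ennreal_plus[symmetric] distrib_right[symmetric] del: ennreal_plus)
    then show ?thesis
      using grid_sum_shift[of "\<lambda>i j. \<bar>u i j\<bar>" 1 0] grid_sum_shift[of "\<lambda>i j. \<bar>r i j\<bar>" 1 0] nn \<open>0 \<le> \<mu>\<close>
      by (simp add: grid_sum_add grid_sum_cmult)
  qed
  finally show ?thesis unfolding d_def u_def .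
qed

text \<open>Bounds on the edge values that a smooth function with derivatives bounded by \<open>D\<close> (first
  order) and \<open>W\<close> (second order) satisfies on a grid with mesh widths \<open>dx\<close> and \<open>dy\<close>.\<close>

definition grid_C2 :: "real \<Rightarrow> real \<Rightarrow> real \<Rightarrow> real \<Rightarrow> (int \<Rightarrow> int \<Rightarrow> real) \<Rightarrow> bool" where
  "grid_C2 dx dy D W a \<longleftrightarrow> (\<forall>i j.
     \<bar>a (i + 1) j - a i j\<bar> \<le> dx * D \<and> \<bar>a i (j + 1) - a i j\<bar> \<le> dy * D \<and>
     \<bar>a (i + 1) j - 2 * a i j + a (i - 1) j\<bar> \<le> dx * dx * W \<and>
     \<bar>a i (j + 1) - 2 * a i j + a i (j - 1)\<bar> \<le> dy * dy * W \<and>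
     \<bar>a (i + 1) (j + 1) - a (i + 1) j - (a i (j + 1) - a i j)\<bar> \<le> dx * dy * W)"

lemma grid_C2D:
  assumes "grid_C2 dx dy D W a"
  shows "\<bar>a (i + 1) j - a i j\<bar> \<le> dx * D" "\<bar>a i (j + 1) - a i j\<bar> \<le> dy * D"
    "\<bar>a (i + 1) j - 2 * a i j + a (i - 1) j\<bar> \<le> dx * dx * W"
    "\<bar>a i (j + 1) - 2 * a i j + a i (j - 1)\<bar> \<le> dy * dy * W"
    "\<bar>a (i + 1) (j + 1) - a (i + 1) j - (a i (j + 1) - a i j)\<bar> \<le> dx * dy * W"
  using assms unfolding grid_C2_def by blast+

lemma grid_C2_transpose: "grid_C2 dx dy D W a \<Longrightarrow> grid_C2 dy dx D W (\<lambda>i j. a j i)"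
  unfolding grid_C2_def by (smt (verit) mult.commute)

definition grid_TV :: "real \<Rightarrow> real \<Rightarrow> (int \<Rightarrow> int \<Rightarrow> real) \<Rightarrow> ennreal" where
  "grid_TV dx dy r = grid_sum (\<lambda>i j. dx * \<bar>r i (j + 1) - r i j\<bar> + dy * \<bar>r (i + 1) j - r i j\<bar>)"

definition grid_mass :: "real \<Rightarrow> real \<Rightarrow> (int \<Rightarrow> int \<Rightarrow> real) \<Rightarrow> ennreal" where
  "grid_mass dx dy r = grid_sum (\<lambda>i j. dx * dy * \<bar>r i j\<bar>)"

lemma grid_TV_eq:
  assumes "0 \<le> dx" "0 \<le> dy"
  shows "grid_TV dx dy r = ennreal dx * grid_sum (\<lambda>i j. \<bar>r i (j + 1) - r i j\<bar>)
    + ennreal dy * grid_sum (\<lambda>i j. \<bar>r (i + 1) j - r i j\<bar>)"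
  unfolding grid_TV_def using assms by (simp add: grid_sum_add grid_sum_cmult)

lemma grid_mass_eq:
  assumes "0 \<le> dx" "0 \<le> dy"
  shows "grid_mass dx dy r = ennreal (dx * dy) * grid_sum (\<lambda>i j. \<bar>r i j\<bar>)"
  unfolding grid_mass_def using assms by (simp add: grid_sum_cmult)

text \<open>The share of the differences that stays in its cell plus the share that is passed on, for
  edge values \<open>a\<close>, \<open>b\<close> and slope \<open>t\<close> of \<open>f\<close>. It equals 1 for \<open>t \<ge> 0\<close> under a CFL condition.\<close>

definition spread :: "real \<Rightarrow> real \<Rightarrow> real \<Rightarrow> real \<Rightarrow> real \<Rightarrow> real \<Rightarrow> real \<Rightarrow> real" where
  "spread lx ly a1 b1 a2 b2 t =
     \<bar>1 - (lx * (\<bar>a1\<bar> + \<bar>b1\<bar> * t) + ly * (\<bar>a2\<bar> + \<bar>b2\<bar> * t))\<bar>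
     + (lx * (\<bar>a1\<bar> + \<bar>b1\<bar> * \<bar>t\<bar>) + ly * (\<bar>a2\<bar> + \<bar>b2\<bar> * \<bar>t\<bar>))"

lemma spread_swap: "spread lx ly a1 b1 a2 b2 t = spread ly lx a2 b2 a1 b1 t"
  unfolding spread_def by (simp add: algebra_simps)

lemma roe_step_xdiff_grid_C2:
  fixes dx dy dt L \<mu> D W G Q :: real and a1 b1 a2 b2 r :: "int \<Rightarrow> int \<Rightarrow> real" and f :: "real \<Rightarrow> real"
  assumes pos: "0 < dx" "0 < dy" "0 < dt" "0 \<le> L"
    and f: "\<And>x. \<bar>f x\<bar> \<le> \<bar>x\<bar>" "\<And>x y. \<bar>f x - f y\<bar> \<le> L * \<bar>x - y\<bar>"
    and C2: "grid_C2 dx dy D W a1" "grid_C2 dx dy D W a2" "grid_C2 dx dy G Q b1" "grid_C2 dx dy G Q b2"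
    and \<mu>: "\<And>i j i' j'. \<exists>t. f (r i' j') - f (r i j) = t * (r i' j' - r i j) \<and>
          spread (dt / dx) (dt / dy) (a1 i j) (b1 i j) (a2 i j) (b2 i j) t \<le> \<mu>"
  defines "r' \<equiv> roe_step (dt / dx) (dt / dy) a1 b1 a2 b2 f r"
  shows "grid_sum (\<lambda>i j. \<bar>r' (i + 1) j - r' i j\<bar>) \<le>
     ennreal (\<mu> + 3 * (dt * (D + L * G))) * grid_sum (\<lambda>i j. \<bar>r (i + 1) j - r i j\<bar>)
     + ennreal (dt / dy * dx * (D + L * G)) * grid_sum (\<lambda>i j. \<bar>r i (j + 1) - r i j\<bar>)
     + ennreal (2 * (dt * dx * (W + Q))) * grid_sum (\<lambda>i j. \<bar>r i j\<bar>)"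
proof -
  from \<mu> have "\<exists>t. f (r (i + 1) j) - f (r i j) = t * (r (i + 1) j - r i j) \<and>
          spread (dt / dx) (dt / dy) (a1 i j) (b1 i j) (a2 i j) (b2 i j) t \<le> \<mu>" for i j by blast
  then obtain \<theta> where \<theta>: "\<And>i j. f (r (i + 1) j) - f (r i j) = \<theta> i j * (r (i + 1) j - r i j)"
    "\<And>i j. spread (dt / dx) (dt / dy) (a1 i j) (b1 i j) (a2 i j) (b2 i j) (\<theta> i j) \<le> \<mu>" by metis
  have scale: "dt / h * (A + B) \<le> dt / h * h' * (P + R)" if "A \<le> h' * P" "B \<le> h' * R" "0 < h" for A B h h' P R
  proof -
    have "dt / h * (A + B) \<le> dt / h * (h' * P + h' * R)"
      using that pos by (intro mult_left_mono add_mono) auto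
    then show ?thesis by (simp add: algebra_simps add_divide_distrib)
  qed
  have L: "L * x \<le> h * (L * G)" if "x \<le> h * G" for x h
    using mult_left_mono[OF that pos(4)] by (simp add: algebra_simps)
  have hx: "dt / dx * dx = dt" "dt / dy * dy = dt" "dt / dx * (dx * dx) = dt * dx"
    "dt / dy * (dx * dy) = dt * dx" using pos by simp_all
  show ?thesis unfolding r'_def
  proof (rule roe_step_xdiff_le[where L = L and \<theta> = \<theta>])
    fix i j
    show "dt / dx * (\<bar>a1 (i + 1) j - a1 i j\<bar> + L * \<bar>b1 (i + 1) j - b1 i j\<bar>) \<le> dt * (D + L * G)"
      using scale[OF grid_C2D(1)[OF C2(1)] L[OF grid_C2D(1)[OF C2(3)]] pos(1)] unfolding hx .
    show "dt / dy * (\<bar>a2 i (j + 1) - a2 i j\<bar> + L * \<bar>b2 i (j + 1) - b2 i j\<bar>) \<le> dt * (D + L * G)"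
      using scale[OF grid_C2D(2)[OF C2(2)] L[OF grid_C2D(2)[OF C2(4)]] pos(2)] unfolding hx .
    show "dt / dy * (\<bar>a2 (i + 1) j - a2 i j\<bar> + L * \<bar>b2 (i + 1) j - b2 i j\<bar>) \<le> dt / dy * dx * (D + L * G)"
      by (rule scale[OF grid_C2D(1)[OF C2(2)] L[OF grid_C2D(1)[OF C2(4)]] pos(2)])
    show "dt / dx * (\<bar>a1 (i + 1) j - 2 * a1 i j + a1 (i - 1) j\<bar> + \<bar>b1 (i + 1) j - 2 * b1 i j + b1 (i - 1) j\<bar>)
        \<le> dt * dx * (W + Q)"
      using scale[OF grid_C2D(3)[OF C2(1)] grid_C2D(3)[OF C2(3)] pos(1)] unfolding hx .
    show "dt / dy * (\<bar>a2 (i + 1) j - a2 i j - (a2 (i + 1) (j - 1) - a2 i (j - 1))\<bar>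
        + \<bar>b2 (i + 1) j - b2 i j - (b2 (i + 1) (j - 1) - b2 i (j - 1))\<bar>) \<le> dt * dx * (W + Q)"
    proof -
      have "\<bar>c (i + 1) j - c i j - (c (i + 1) (j - 1) - c i (j - 1))\<bar> \<le> dx * dy * Z"
        if "grid_C2 dx dy Y Z c" for Y Z c
        using grid_C2D(5)[OF that, of i "j - 1"] by (simp add: algebra_simps)
      from scale[OF this[OF C2(2)] this[OF C2(4)] pos(2)] show ?thesis unfolding hx .
    qed
  qed (rule f \<theta>(1) \<theta>(2)[unfolded spread_def] pos(4) | use pos in simp)+
qed

text \<open>The weights \<open>dx\<close> and \<open>dy\<close> of the two partial variations are exactly those for which the
  exchange between them is symmetric.\<close>

lemma roe_step_TV:
  fixes dx dy dt L \<mu> D W G Q :: real and a1 b1 a2 b2 r :: "int \<Rightarrow> int \<Rightarrow> real" and f :: "real \<Rightarrow> real"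
  assumes pos: "0 < dx" "0 < dy" "0 < dt" "0 \<le> L" "0 \<le> \<mu>" "0 \<le> D" "0 \<le> W" "0 \<le> G" "0 \<le> Q"
    and f: "\<And>x. \<bar>f x\<bar> \<le> \<bar>x\<bar>" "\<And>x y. \<bar>f x - f y\<bar> \<le> L * \<bar>x - y\<bar>"
    and C2: "grid_C2 dx dy D W a1" "grid_C2 dx dy D W a2" "grid_C2 dx dy G Q b1" "grid_C2 dx dy G Q b2"
    and \<mu>: "\<And>i j i' j'. \<exists>t. f (r i' j') - f (r i j) = t * (r i' j' - r i j) \<and>
          spread (dt / dx) (dt / dy) (a1 i j) (b1 i j) (a2 i j) (b2 i j) t \<le> \<mu>"
  defines "r' \<equiv> roe_step (dt / dx) (dt / dy) a1 b1 a2 b2 f r"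
  shows "grid_TV dx dy r' \<le> ennreal (\<mu> + 4 * (dt * (D + L * G))) * grid_TV dx dy r
     + ennreal (4 * (dt * (W + Q))) * grid_mass dx dy r"
proof -
  define X where "X = grid_sum (\<lambda>i j. \<bar>r (i + 1) j - r i j\<bar>)"
  define Y where "Y = grid_sum (\<lambda>i j. \<bar>r i (j + 1) - r i j\<bar>)"
  define R where "R = grid_sum (\<lambda>i j. \<bar>r i j\<bar>)"
  define \<kappa> where "\<kappa> = dt * (D + L * G)"
  define \<sigma> where "\<sigma> = dt * (W + Q)"
  have \<kappa>: "0 \<le> \<kappa>" and \<sigma>: "0 \<le> \<sigma>" using pos by (simp_all add: \<kappa>_def \<sigma>_def)
  have X': "grid_sum (\<lambda>i j. \<bar>r' (i + 1) j - r' i j\<bar>) \<le>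
      ennreal (\<mu> + 3 * \<kappa>) * X + ennreal (dx / dy * \<kappa>) * Y + ennreal (2 * (dx * \<sigma>)) * R"
    using roe_step_xdiff_grid_C2[where f = f and L = L, OF pos(1-4) f C2 \<mu>]
    unfolding r'_def X_def Y_def R_def \<kappa>_def \<sigma>_def by (simp add: algebra_simps add_divide_distrib)
  have "grid_sum (\<lambda>i j. \<bar>r' j (i + 1) - r' j i\<bar>) \<le>
     ennreal (\<mu> + 3 * (dt * (D + L * G))) * grid_sum (\<lambda>i j. \<bar>r j (i + 1) - r j i\<bar>)
     + ennreal (dt / dx * dy * (D + L * G)) * grid_sum (\<lambda>i j. \<bar>r (j + 1) i - r j i\<bar>)
     + ennreal (2 * (dt * dy * (W + Q))) * grid_sum (\<lambda>i j. \<bar>r j i\<bar>)"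
    unfolding r'_def roe_step_transpose[of "dt / dx"]
    by (rule roe_step_xdiff_grid_C2[where f = f and L = L, OF pos(2,1,3,4) f])
       (use C2 \<mu> in \<open>auto intro: grid_C2_transpose simp: spread_swap[of "dt / dy"]\<close>)
  then have Y': "grid_sum (\<lambda>i j. \<bar>r' i (j + 1) - r' i j\<bar>) \<le>
      ennreal (\<mu> + 3 * \<kappa>) * Y + ennreal (dy / dx * \<kappa>) * X + ennreal (2 * (dy * \<sigma>)) * R"
    using grid_sum_transpose[of "\<lambda>i j. \<bar>r' i (j + 1) - r' i j\<bar>"]
      grid_sum_transpose[of "\<lambda>i j. \<bar>r i (j + 1) - r i j\<bar>"]
      grid_sum_transpose[of "\<lambda>i j. \<bar>r (i + 1) j - r i j\<bar>"] grid_sum_transpose[of "\<lambda>i j. \<bar>r i j\<bar>"]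
    unfolding X_def Y_def R_def \<kappa>_def \<sigma>_def by (simp add: algebra_simps add_divide_distrib)
  have comb: "ennreal a * ennreal b + ennreal c * ennreal d = ennreal (a * b + c * d)"
    if "0 \<le> a" "0 \<le> b" "0 \<le> c" "0 \<le> d" for a b c d
    using that by (simp add: ennreal_mult ennreal_plus)
  have "grid_TV dx dy r' \<le>
      ennreal dx * (ennreal (\<mu> + 3 * \<kappa>) * Y + ennreal (dy / dx * \<kappa>) * X + ennreal (2 * (dy * \<sigma>)) * R)
    + ennreal dy * (ennreal (\<mu> + 3 * \<kappa>) * X + ennreal (dx / dy * \<kappa>) * Y + ennreal (2 * (dx * \<sigma>)) * R)"
    unfolding grid_TV_eq[OF less_imp_le less_imp_le, OF pos(1,2)]
    by (intro add_mono mult_left_mono X' Y') auto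
  also have "\<dots> = (ennreal dx * ennreal (\<mu> + 3 * \<kappa>) + ennreal dy * ennreal (dx / dy * \<kappa>)) * Y
    + (ennreal dy * ennreal (\<mu> + 3 * \<kappa>) + ennreal dx * ennreal (dy / dx * \<kappa>)) * X
    + (ennreal dx * ennreal (2 * (dy * \<sigma>)) + ennreal dy * ennreal (2 * (dx * \<sigma>))) * R"
    by (simp add: algebra_simps)
  also have "ennreal dx * ennreal (\<mu> + 3 * \<kappa>) + ennreal dy * ennreal (dx / dy * \<kappa>)
      = ennreal (dx * (\<mu> + 3 * \<kappa>) + dy * (dx / dy * \<kappa>))"
    by (rule comb) (use pos \<kappa> in auto)
  also have "dx * (\<mu> + 3 * \<kappa>) + dy * (dx / dy * \<kappa>) = (\<mu> + 4 * \<kappa>) * dx"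
    using pos by (simp add: algebra_simps)
  also have "ennreal dy * ennreal (\<mu> + 3 * \<kappa>) + ennreal dx * ennreal (dy / dx * \<kappa>)
      = ennreal (dy * (\<mu> + 3 * \<kappa>) + dx * (dy / dx * \<kappa>))"
    by (rule comb) (use pos \<kappa> in auto)
  also have "dy * (\<mu> + 3 * \<kappa>) + dx * (dy / dx * \<kappa>) = (\<mu> + 4 * \<kappa>) * dy"
    using pos by (simp add: algebra_simps)
  also have "ennreal dx * ennreal (2 * (dy * \<sigma>)) + ennreal dy * ennreal (2 * (dx * \<sigma>))
      = ennreal (dx * (2 * (dy * \<sigma>)) + dy * (2 * (dx * \<sigma>)))"
    by (rule comb) (use pos \<sigma> in auto)
  also have "dx * (2 * (dy * \<sigma>)) + dy * (2 * (dx * \<sigma>)) = 4 * \<sigma> * (dx * dy)"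
    by (simp add: algebra_simps)
  finally show ?thesis
    using pos \<kappa> \<sigma> unfolding grid_TV_eq[OF less_imp_le less_imp_le, OF pos(1,2)]
      grid_mass_eq[OF less_imp_le less_imp_le, OF pos(1,2)]
      X_def[symmetric] Y_def[symmetric] R_def[symmetric] \<kappa>_def[symmetric] \<sigma>_def[symmetric]
    by (simp add: ennreal_mult distrib_left mult.assoc)
qed

subsection \<open>Variation in time\<close>

text \<open>In nonconservative form the change of a cell is a combination of differences of the density
  and of the density times a difference of edge values, so no cancellation between cells is
  needed.\<close>

lemma roe_step_time_diff:
  fixes dx dy dt L D W G Q V \<epsilon> :: real and a1 b1 a2 b2 r :: "int \<Rightarrow> int \<Rightarrow> real" and f :: "real \<Rightarrow> real"
  assumes pos: "0 < dx" "0 < dy" "0 < dt" "0 \<le> L" "0 \<le> D" "0 \<le> G"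
    and f: "\<And>x. \<bar>f x\<bar> \<le> \<bar>x\<bar>" "\<And>x y. \<bar>f x - f y\<bar> \<le> L * \<bar>x - y\<bar>"
    and C2: "grid_C2 dx dy D W a1" "grid_C2 dx dy D W a2" "grid_C2 dx dy G Q b1" "grid_C2 dx dy G Q b2"
    and bd: "\<And>i j. \<bar>a1 i j\<bar> \<le> V" "\<And>i j. \<bar>a2 i j\<bar> \<le> V" "\<And>i j. \<bar>b1 i j\<bar> \<le> \<epsilon>" "\<And>i j. \<bar>b2 i j\<bar> \<le> \<epsilon>"
  defines "r' \<equiv> roe_step (dt / dx) (dt / dy) a1 b1 a2 b2 f r"
  shows "grid_mass dx dy (\<lambda>i j. r' i j - r i j) \<le> ennreal (dt * (V + \<epsilon> * L)) * grid_TV dx dy r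
     + ennreal (2 * (dt * (D + G))) * grid_mass dx dy r"
proof -
  define K where "K = V + \<epsilon> * L"
  have "0 \<le> V" "0 \<le> \<epsilon>" using bd(1)[of 0 0] bd(3)[of 0 0] by linarith+
  then have K: "0 \<le> K" using pos by (simp add: K_def)
  have upwind_le: "\<bar>upwind e \<psi> i\<bar> \<le> pos (e (i - 1)) * l (i - 1) - neg (e i) * l i + h * E * \<bar>\<rho>\<bar>"
    if l: "\<And>i. \<bar>\<psi> (i + 1) - \<psi> i\<bar> \<le> l i" and e: "\<bar>e (i - 1 + 1) - e (i - 1)\<bar> \<le> h * E" and \<psi>: "\<bar>\<psi> i\<bar> \<le> \<bar>\<rho>\<bar>"
    for e \<psi> l :: "int \<Rightarrow> real" and i h E \<rho>
  proof -
    have "\<bar>pos (e (i - 1)) * (\<psi> i - \<psi> (i - 1))\<bar> \<le> pos (e (i - 1)) * l (i - 1)"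
      using l[of "i - 1"] by (simp add: abs_mult mult_left_mono)
    moreover have "\<bar>neg (e i) * (\<psi> (i + 1) - \<psi> i)\<bar> \<le> - neg (e i) * l i"
      using l[of i] by (simp add: abs_mult mult_left_mono_neg)
    moreover have "\<bar>(e i - e (i - 1)) * \<psi> i\<bar> \<le> h * E * \<bar>\<rho>\<bar>"
      unfolding abs_mult by (rule mult_mono) (use e \<psi> order_trans[OF abs_ge_zero e] in auto)
    ultimately show ?thesis unfolding upwind_nonconservative by linarith
  qed
  define X where "X i j = \<bar>r (i + 1) j - r i j\<bar>" for i j
  define Y where "Y i j = \<bar>r i (j + 1) - r i j\<bar>" for i j
  define A where "A i j = dt / dx * ((- neg (a1 i j) - neg (b1 i j) * L) * X i j)
      + dt / dy * ((- neg (a2 i j) - neg (b2 i j) * L) * Y i j) + 2 * (dt * (D + G)) * \<bar>r i j\<bar>" for i j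
  define B where "B i j = dt / dx * ((pos (a1 i j) + pos (b1 i j) * L) * X i j)" for i j
  define C where "C i j = dt / dy * ((pos (a2 i j) + pos (b2 i j) * L) * Y i j)" for i j
  have XY: "0 \<le> X i j" "0 \<le> Y i j" for i j by (simp_all add: X_def Y_def)
  have nn: "0 \<le> A i j" "0 \<le> B i j" "0 \<le> C i j" for i j
    unfolding A_def B_def C_def using pos XY
    by (auto intro!: add_nonneg_nonneg mult_nonneg_nonneg simp: neg_mult_le)
  have "grid_sum (\<lambda>i j. \<bar>r' i j - r i j\<bar>)
      \<le> grid_sum (\<lambda>i j. dt / dx * K * X i j + dt / dy * K * Y i j + 2 * (dt * (D + G)) * \<bar>r i j\<bar>)"
  proof (rule grid_sum_neighbours_le[where A = A and B = B and C = "\<lambda>i j. 0" and D = C and E = "\<lambda>i j. 0"])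
    fix i j
    have "\<bar>upwind (\<lambda>i. a1 i j) (\<lambda>i. r i j) i\<bar> \<le>
        pos (a1 (i - 1) j) * X (i - 1) j - neg (a1 i j) * X i j + dx * D * \<bar>r i j\<bar>"
      by (rule upwind_le) (simp_all only: X_def grid_C2D(1)[OF C2(1)] order_refl)
    moreover have "\<bar>upwind (\<lambda>i. b1 i j) (\<lambda>i. f (r i j)) i\<bar> \<le>
        pos (b1 (i - 1) j) * (L * X (i - 1) j) - neg (b1 i j) * (L * X i j) + dx * G * \<bar>r i j\<bar>"
      by (rule upwind_le) (simp_all only: X_def grid_C2D(1)[OF C2(3)] f)
    ultimately have "dt / dx * \<bar>upwind (\<lambda>i. a1 i j) (\<lambda>i. r i j) i + upwind (\<lambda>i. b1 i j) (\<lambda>i. f (r i j)) i\<bar>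
        \<le> dt / dx * (pos (a1 (i - 1) j) * X (i - 1) j - neg (a1 i j) * X i j + dx * D * \<bar>r i j\<bar>
           + (pos (b1 (i - 1) j) * (L * X (i - 1) j) - neg (b1 i j) * (L * X i j) + dx * G * \<bar>r i j\<bar>))"
      using pos by (intro mult_left_mono order_trans[OF abs_triangle_ineq] add_mono) auto
    moreover have "\<dots> = B (i - 1) j + dt / dx * ((- neg (a1 i j) - neg (b1 i j) * L) * X i j)
        + dt * (D + G) * \<bar>r i j\<bar>"
      using pos by (simp add: B_def field_simps)
    ultimately have x: "dt / dx * \<bar>upwind (\<lambda>i. a1 i j) (\<lambda>i. r i j) i + upwind (\<lambda>i. b1 i j) (\<lambda>i. f (r i j)) i\<bar>
        \<le> B (i - 1) j + dt / dx * ((- neg (a1 i j) - neg (b1 i j) * L) * X i j) + dt * (D + G) * \<bar>r i j\<bar>"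
      by linarith
    have "\<bar>upwind (a2 i) (r i) j\<bar> \<le>
        pos (a2 i (j - 1)) * Y i (j - 1) - neg (a2 i j) * Y i j + dy * D * \<bar>r i j\<bar>"
      by (rule upwind_le) (simp_all only: Y_def grid_C2D(2)[OF C2(2)] order_refl)
    moreover have "\<bar>upwind (b2 i) (\<lambda>j. f (r i j)) j\<bar> \<le>
        pos (b2 i (j - 1)) * (L * Y i (j - 1)) - neg (b2 i j) * (L * Y i j) + dy * G * \<bar>r i j\<bar>"
      by (rule upwind_le) (simp_all only: Y_def grid_C2D(2)[OF C2(4)] f)
    ultimately have "dt / dy * \<bar>upwind (a2 i) (r i) j + upwind (b2 i) (\<lambda>j. f (r i j)) j\<bar>
        \<le> dt / dy * (pos (a2 i (j - 1)) * Y i (j - 1) - neg (a2 i j) * Y i j + dy * D * \<bar>r i j\<bar>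
           + (pos (b2 i (j - 1)) * (L * Y i (j - 1)) - neg (b2 i j) * (L * Y i j) + dy * G * \<bar>r i j\<bar>))"
      using pos by (intro mult_left_mono order_trans[OF abs_triangle_ineq] add_mono) auto
    moreover have "\<dots> = C i (j - 1) + dt / dy * ((- neg (a2 i j) - neg (b2 i j) * L) * Y i j)
        + dt * (D + G) * \<bar>r i j\<bar>"
      using pos by (simp add: C_def field_simps)
    ultimately have y: "dt / dy * \<bar>upwind (a2 i) (r i) j + upwind (b2 i) (\<lambda>j. f (r i j)) j\<bar>
        \<le> C i (j - 1) + dt / dy * ((- neg (a2 i j) - neg (b2 i j) * L) * Y i j) + dt * (D + G) * \<bar>r i j\<bar>"
      by linarith
    have "\<bar>r' i j - r i j\<bar> \<le> dt / dx * \<bar>upwind (\<lambda>i. a1 i j) (\<lambda>i. r i j) i + upwind (\<lambda>i. b1 i j) (\<lambda>i. f (r i j)) i\<bar>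
        + dt / dy * \<bar>upwind (a2 i) (r i) j + upwind (b2 i) (\<lambda>j. f (r i j)) j\<bar>"
    proof -
      have c: "\<bar>c * z\<bar> = c * \<bar>z\<bar>" if "0 < c" for c z :: real using that by (simp add: abs_mult)
      have "0 < dt / dx" "0 < dt / dy" using pos by simp_all
      from c[OF this(1)] c[OF this(2)] show ?thesis
        unfolding r'_def roe_step_def by (smt (verit))
    qed
    also have "\<dots> \<le> A i j + B (i - 1) j + C i (j - 1)" using x y unfolding A_def by argo
    finally show "\<bar>r' i j - r i j\<bar> \<le> A i j + B (i - 1) j + 0 + C i (j - 1) + 0"
      by simp
    have k: "\<bar>a\<bar> + \<bar>b\<bar> * L \<le> K" if "\<bar>a\<bar> \<le> V" "\<bar>b\<bar> \<le> \<epsilon>" for a b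
      unfolding K_def using that pos by (intro add_mono mult_right_mono) auto
    have "A i j + B i j + C i j = dt / dx * ((\<bar>a1 i j\<bar> + \<bar>b1 i j\<bar> * L) * X i j)
        + dt / dy * ((\<bar>a2 i j\<bar> + \<bar>b2 i j\<bar> * L) * Y i j) + 2 * (dt * (D + G)) * \<bar>r i j\<bar>"
      unfolding A_def B_def C_def abs_eq_pos_neg[of "a1 i j"] abs_eq_pos_neg[of "b1 i j"]
        abs_eq_pos_neg[of "a2 i j"] abs_eq_pos_neg[of "b2 i j"] by (simp add: algebra_simps add_divide_distrib diff_divide_distrib)
    also have "\<dots> \<le> dt / dx * (K * X i j) + dt / dy * (K * Y i j) + 2 * (dt * (D + G)) * \<bar>r i j\<bar>"
      using pos XY bd by (intro add_mono mult_left_mono mult_right_mono k) auto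
    finally show "A i j + B i j + 0 + C i j + 0
        \<le> dt / dx * K * X i j + dt / dy * K * Y i j + 2 * (dt * (D + G)) * \<bar>r i j\<bar>"
      by (simp add: mult.assoc)
  qed (use nn in auto)
  also have "\<dots> = ennreal (dt / dx * K) * grid_sum X + ennreal (dt / dy * K) * grid_sum Y
      + ennreal (2 * (dt * (D + G))) * grid_sum (\<lambda>i j. \<bar>r i j\<bar>)"
    by (rule grid_sum_linear3) (use pos K XY in auto)
  finally have "ennreal (dx * dy) * grid_sum (\<lambda>i j. \<bar>r' i j - r i j\<bar>)
      \<le> ennreal (dx * dy) * (ennreal (dt / dx * K) * grid_sum X + ennreal (dt / dy * K) * grid_sum Y
      + ennreal (2 * (dt * (D + G))) * grid_sum (\<lambda>i j. \<bar>r i j\<bar>))"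
    by (rule mult_left_mono) simp
  also have "\<dots> = (ennreal (dx * dy) * ennreal (dt / dx * K)) * grid_sum X
      + (ennreal (dx * dy) * ennreal (dt / dy * K)) * grid_sum Y
      + ennreal (2 * (dt * (D + G))) * (ennreal (dx * dy) * grid_sum (\<lambda>i j. \<bar>r i j\<bar>))"
    by (simp add: algebra_simps)
  also have "ennreal (dx * dy) * ennreal (dt / dx * K) = ennreal (dt * K) * ennreal dy"
    using pos K by (simp add: ennreal_mult[symmetric] field_simps)
  also have "ennreal (dx * dy) * ennreal (dt / dy * K) = ennreal (dt * K) * ennreal dx"
    using pos K by (simp add: ennreal_mult[symmetric] field_simps)
  finally show ?thesis
    using pos unfolding K_def[symmetric]
    by (simp add: grid_TV_eq grid_mass_eq X_def[abs_def] Y_def[abs_def] algebra_simps)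
qed

section \<open>The saturation of the non-local term\<close>

text \<open>The component along \<open>e\<close> of the map \<open>w \<mapsto> w / sqrt (1 + \<parallel>w\<parallel>\<^sup>2)\<close>: the non-local term is \<open>- \<epsilon>\<close> times its
  value at the discrete convolution.\<close>

definition saturate :: "'a::real_inner \<Rightarrow> 'a \<Rightarrow> real" where
  "saturate e w = (e \<bullet> w) * (1 / sqrt (1 + w \<bullet> w))"

lemma has_real_derivative_inverse_sqrt:
  assumes "(n has_real_derivative 2 * c) (at s)" "0 < n s"
  shows "((\<lambda>s. 1 / sqrt (n s)) has_real_derivative - c * (1 / sqrt (n s)) ^ 3) (at s)"
proof -
  have "sqrt (n s) \<noteq> 0" using assms by simp
  then show ?thesis
    using assms
    by (auto intro!: derivative_eq_intros simp: field_simps power3_eq_cube power2_eq_square)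
qed

definition dsaturate :: "'a::real_inner \<Rightarrow> 'a \<Rightarrow> 'a \<Rightarrow> real" where
  "dsaturate e w q = (e \<bullet> q) * (1 / sqrt (1 + w \<bullet> w)) - (e \<bullet> w) * ((w \<bullet> q) * (1 / sqrt (1 + w \<bullet> w)) ^ 3)"

lemma inner_line_derivative:
  fixes b q e :: "'a::real_inner"
  shows "((\<lambda>s. 1 + (b + s *\<^sub>R q) \<bullet> (b + s *\<^sub>R q)) has_real_derivative 2 * ((b + s *\<^sub>R q) \<bullet> q)) (at s)"
    and "((\<lambda>s. e \<bullet> (b + s *\<^sub>R q)) has_real_derivative e \<bullet> q) (at s)"
proof -
  have "(\<lambda>s. 1 + (b + s *\<^sub>R q) \<bullet> (b + s *\<^sub>R q)) = (\<lambda>s. 1 + (b \<bullet> b + 2 * s * (b \<bullet> q) + s\<^sup>2 * (q \<bullet> q)))"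
    by (auto simp: inner_add_left inner_add_right inner_commute power2_eq_square algebra_simps)
  then show "((\<lambda>s. 1 + (b + s *\<^sub>R q) \<bullet> (b + s *\<^sub>R q)) has_real_derivative 2 * ((b + s *\<^sub>R q) \<bullet> q)) (at s)"
    by (auto intro!: derivative_eq_intros simp: inner_add_left algebra_simps)
  have "(\<lambda>s. e \<bullet> (b + s *\<^sub>R q)) = (\<lambda>s. e \<bullet> b + s * (e \<bullet> q))"
    by (auto simp: inner_add_right)
  then show "((\<lambda>s. e \<bullet> (b + s *\<^sub>R q)) has_real_derivative e \<bullet> q) (at s)"
    by (auto intro!: derivative_eq_intros)
qed

lemma one_plus_inner_pos: "0 < 1 + w \<bullet> w" for w :: "'a::real_inner"
  by (simp add: add_pos_nonneg)

lemma inverse_sqrt_line_derivative: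
  fixes b q :: "'a::real_inner"
  shows "((\<lambda>s. 1 / sqrt (1 + (b + s *\<^sub>R q) \<bullet> (b + s *\<^sub>R q))) has_real_derivative
    - ((b + s *\<^sub>R q) \<bullet> q) * (1 / sqrt (1 + (b + s *\<^sub>R q) \<bullet> (b + s *\<^sub>R q))) ^ 3) (at s)"
  by (rule has_real_derivative_inverse_sqrt[OF inner_line_derivative(1)]) (rule one_plus_inner_pos)

lemma saturate_line_derivative:
  "((\<lambda>s. saturate e (b + s *\<^sub>R q)) has_real_derivative dsaturate e (b + s *\<^sub>R q) q) (at s)"
proof -
  have "((\<lambda>s. (e \<bullet> (b + s *\<^sub>R q)) * (1 / sqrt (1 + (b + s *\<^sub>R q) \<bullet> (b + s *\<^sub>R q)))) has_real_derivative
    (e \<bullet> (b + s *\<^sub>R q)) * (- ((b + s *\<^sub>R q) \<bullet> q) * (1 / sqrt (1 + (b + s *\<^sub>R q) \<bullet> (b + s *\<^sub>R q))) ^ 3)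
     + (e \<bullet> q) * (1 / sqrt (1 + (b + s *\<^sub>R q) \<bullet> (b + s *\<^sub>R q)))) (at s)"
    using DERIV_mult[OF inner_line_derivative(2) inverse_sqrt_line_derivative]
    by (simp add: add.commute mult.commute)
  then show ?thesis unfolding saturate_def dsaturate_def by (simp add: algebra_simps)
qed

definition ddsaturate :: "'a::real_inner \<Rightarrow> 'a \<Rightarrow> 'a \<Rightarrow> 'a \<Rightarrow> real" where
  "ddsaturate e w q p = (let y = 1 / sqrt (1 + w \<bullet> w) in
     - (e \<bullet> q) * (w \<bullet> p) * y ^ 3 - (e \<bullet> p) * (w \<bullet> q) * y ^ 3 - (e \<bullet> w) * (p \<bullet> q) * y ^ 3
     + 3 * (e \<bullet> w) * (w \<bullet> q) * (w \<bullet> p) * y ^ 5)"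

lemma dsaturate_line_derivative:
  "((\<lambda>s. dsaturate e (b + s *\<^sub>R p) q) has_real_derivative ddsaturate e (b + s *\<^sub>R p) q p) (at s)"
proof -
  define y where "y s = 1 / sqrt (1 + (b + s *\<^sub>R p) \<bullet> (b + s *\<^sub>R p))" for s
  have y: "(y has_real_derivative - ((b + s *\<^sub>R p) \<bullet> p) * y s ^ 3) (at s)"
    unfolding y_def by (rule inverse_sqrt_line_derivative)
  have q: "((\<lambda>s. (b + s *\<^sub>R p) \<bullet> q) has_real_derivative p \<bullet> q) (at s)"
    using inner_line_derivative(2)[of q b p s] by (simp add: inner_commute)
  have "((\<lambda>s. (e \<bullet> q) * y s - (e \<bullet> (b + s *\<^sub>R p)) * (((b + s *\<^sub>R p) \<bullet> q) * y s ^ 3)) has_real_derivative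
      ddsaturate e (b + s *\<^sub>R p) q p) (at s)"
    unfolding ddsaturate_def y_def[symmetric] Let_def
    by (rule derivative_eq_intros inner_line_derivative(2) y q refl)+
       (simp add: algebra_simps power2_eq_square power3_eq_cube eval_nat_numeral)
  then show ?thesis unfolding dsaturate_def y_def .
qed

text \<open>With \<open>y = 1 / sqrt (1 + \<parallel>w\<parallel>\<^sup>2)\<close> one has \<open>\<parallel>w\<parallel>\<^sup>2 y\<^sup>2 = 1 - y\<^sup>2\<close>, so that the derivative is at most
  \<open>2 y - y\<^sup>3 \<le> 5/4\<close>; the factor \<open>5/4\<close> times \<open>sqrt 2\<close> stays below 2.\<close>

lemma abs_dsaturate_le:
  assumes "norm e \<le> 1"
  shows "\<bar>dsaturate e w q\<bar> \<le> 5 / 4 * norm q"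
proof -
  define y where "y = 1 / sqrt (1 + w \<bullet> w)"
  have y: "0 < y" "y \<le> 1" unfolding y_def by (simp_all add: one_plus_inner_pos)
  have y2: "norm w * norm w * y\<^sup>2 = 1 - y\<^sup>2"
    unfolding y_def using one_plus_inner_pos[of w]
    by (simp add: power_divide field_simps power2_eq_square[of "norm w", symmetric] power2_norm_eq_inner)
  have e: "\<bar>e \<bullet> z\<bar> \<le> norm z" for z
    using Cauchy_Schwarz_ineq2[of e z] mult_right_mono[OF assms norm_ge_zero[of z]] by simp
  have "\<bar>dsaturate e w q\<bar> \<le> \<bar>(e \<bullet> q) * y\<bar> + \<bar>(e \<bullet> w) * ((w \<bullet> q) * y ^ 3)\<bar>"
    unfolding dsaturate_def y_def[symmetric] by (rule abs_triangle_ineq4)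
  also have "\<dots> \<le> norm q * y + norm w * ((norm w * norm q) * y ^ 3)"
    unfolding abs_mult using y e by (intro add_mono mult_mono) (auto simp: Cauchy_Schwarz_ineq2)
  also have "\<dots> = norm q * (y + (norm w * norm w * y\<^sup>2) * y)"
    by (simp add: algebra_simps power2_eq_square power3_eq_cube)
  also have "y + (norm w * norm w * y\<^sup>2) * y = 2 * y - y ^ 3"
    unfolding y2 by (simp add: algebra_simps power2_eq_square power3_eq_cube)
  also have "norm q * (2 * y - y ^ 3) \<le> norm q * (5 / 4)"
  proof (rule mult_left_mono)
    have "0 \<le> (y - 4/5)\<^sup>2 * (y + 8/5)" using y by (intro mult_nonneg_nonneg) auto
    moreover have "(y - 4/5)\<^sup>2 * (y + 8/5) = y ^ 3 - 48/25 * y + 128/125"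
      by (simp add: power2_eq_square power3_eq_cube field_simps)
    ultimately have "48/25 * y - 128/125 \<le> y ^ 3" by linarith
    then show "2 * y - y ^ 3 \<le> 5 / 4" using y by simp
  qed simp
  finally show ?thesis by (simp add: mult.commute)
qed

text \<open>Every term carries \<open>\<parallel>w\<parallel> y\<^sup>3\<close> or \<open>\<parallel>w\<parallel>\<^sup>3 y\<^sup>5\<close>, and both are at most \<open>1/2\<close> because \<open>2 \<parallel>w\<parallel> \<le> 1 + \<parallel>w\<parallel>\<^sup>2\<close>.\<close>

lemma abs_ddsaturate_le:
  assumes "norm e \<le> 1"
  shows "\<bar>ddsaturate e w q p\<bar> \<le> 3 * norm q * norm p"
proof -
  define y where "y = 1 / sqrt (1 + w \<bullet> w)"
  have y: "0 < y" "y \<le> 1" unfolding y_def by (simp_all add: one_plus_inner_pos)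
  have y2: "(norm w)\<^sup>2 * y\<^sup>2 = 1 - y\<^sup>2"
    unfolding y_def using one_plus_inner_pos[of w]
    by (simp add: power_divide field_simps power2_norm_eq_inner)
  have wy: "norm w * y\<^sup>2 \<le> 1 / 2"
  proof -
    have "0 \<le> (norm w * y - y)\<^sup>2" by simp
    then have "2 * (norm w * y\<^sup>2) \<le> (norm w)\<^sup>2 * y\<^sup>2 + y\<^sup>2" by (simp add: power2_eq_square algebra_simps)
    then show ?thesis using y2 by simp
  qed
  have w3: "norm w * y ^ 3 \<le> 1 / 2"
  proof -
    have "norm w * y ^ 3 = norm w * y\<^sup>2 * y" by (simp add: power3_eq_cube power2_eq_square)
    also have "\<dots> \<le> 1 / 2 * 1" using wy y by (intro mult_mono) auto
    finally show ?thesis by simp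
  qed
  have w5: "norm w * (norm w * norm w) * y ^ 5 \<le> 1 / 2"
  proof -
    have "norm w * (norm w * norm w) * y ^ 5 = norm w * y ^ 3 * ((norm w)\<^sup>2 * y\<^sup>2)"
      by (simp add: eval_nat_numeral)
    also have "\<dots> \<le> 1 / 2 * 1" using w3 y unfolding y2 by (intro mult_mono) (auto simp: power_le_one)
    finally show ?thesis by simp
  qed
  have e: "\<bar>e \<bullet> z\<bar> \<le> norm z" for z
    using Cauchy_Schwarz_ineq2[of e z] mult_right_mono[OF assms norm_ge_zero[of z]] by simp
  have y0: "0 \<le> y" "\<bar>y\<bar> = y" using y by auto
  have "\<bar>ddsaturate e w q p\<bar> \<le> \<bar>(e \<bullet> q) * (w \<bullet> p) * y ^ 3\<bar> + \<bar>(e \<bullet> p) * (w \<bullet> q) * y ^ 3\<bar>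
      + \<bar>(e \<bullet> w) * (p \<bullet> q) * y ^ 3\<bar> + \<bar>3 * (e \<bullet> w) * (w \<bullet> q) * (w \<bullet> p) * y ^ 5\<bar>"
    unfolding ddsaturate_def Let_def y_def[symmetric] by linarith
  also have "\<dots> \<le> norm q * (norm w * norm p) * y ^ 3 + norm p * (norm w * norm q) * y ^ 3
      + norm w * (norm p * norm q) * y ^ 3 + 3 * norm w * (norm w * norm q) * (norm w * norm p) * y ^ 5"
    unfolding abs_mult power_abs y0
    using y0 e by (intro add_mono mult_mono) (auto simp: Cauchy_Schwarz_ineq2)
  also have "\<dots> = norm q * norm p * (3 * (norm w * y ^ 3) + 3 * (norm w * (norm w * norm w) * y ^ 5))"
    by (simp add: algebra_simps)
  also have "\<dots> \<le> norm q * norm p * (3 * (1/2) + 3 * (1/2))"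
    using w3 w5 by (intro mult_left_mono add_mono) auto
  finally show ?thesis by (simp add: algebra_simps)
qed

lemma abs_diff_le_of_derivative:
  fixes g g' :: "real \<Rightarrow> real"
  assumes "\<And>s. (g has_real_derivative g' s) (at s)" "\<And>s. \<bar>g' s\<bar> \<le> B"
  shows "\<bar>g b - g a\<bar> \<le> B * \<bar>b - a\<bar>"
proof -
  have "norm (g b - g a) \<le> B * norm (b - a)"
    by (rule field_differentiable_bound[of UNIV g g']) (use assms in \<open>auto intro: has_field_derivative_at_within\<close>)
  then show ?thesis by simp
qed

lemma saturate_diff_le:
  assumes "norm e \<le> 1"
  shows "\<bar>saturate e (w + p) - saturate e w\<bar> \<le> 5 / 4 * norm p"
  using abs_diff_le_of_derivative[of "\<lambda>s. saturate e (w + s *\<^sub>R p)", OF saturate_line_derivative, of "5 / 4 * norm p" 1 0]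
    abs_dsaturate_le[OF assms] by simp

text \<open>The vector \<open>r\<close> is the mixed difference of the arguments; the remaining four points form a
  parallelogram, on which the second derivative is integrated twice.\<close>

lemma saturate_second_diff_le:
  assumes "norm e \<le> 1"
  shows "\<bar>saturate e (w + p + q + r) - saturate e (w + p) - (saturate e (w + q) - saturate e w)\<bar>
    \<le> 5 / 4 * norm r + 3 * norm p * norm q"
proof -
  define g where "g s = saturate e (w + p + s *\<^sub>R q) - saturate e (w + s *\<^sub>R q)" for s
  have "\<bar>g 1 - g 0\<bar> \<le> 3 * norm p * norm q * \<bar>1 - 0\<bar>"
  proof (rule abs_diff_le_of_derivative)
    show "(g has_real_derivative dsaturate e (w + p + s *\<^sub>R q) q - dsaturate e (w + s *\<^sub>R q) q) (at s)" for s
      unfolding g_def by (intro DERIV_diff saturate_line_derivative)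
    show "\<bar>dsaturate e (w + p + s *\<^sub>R q) q - dsaturate e (w + s *\<^sub>R q) q\<bar> \<le> 3 * norm p * norm q" for s
    proof -
      have "\<bar>dsaturate e (w + s *\<^sub>R q + 1 *\<^sub>R p) q - dsaturate e (w + s *\<^sub>R q + 0 *\<^sub>R p) q\<bar>
          \<le> 3 * norm q * norm p * \<bar>1 - 0\<bar>"
        by (rule abs_diff_le_of_derivative[OF dsaturate_line_derivative abs_ddsaturate_le[OF assms]])
      then show ?thesis by (simp add: add_ac mult_ac)
    qed
  qed
  moreover have "\<bar>saturate e (w + p + q + r) - saturate e (w + p + q)\<bar> \<le> 5 / 4 * norm r"
    by (rule saturate_diff_le[OF assms])
  moreover have "g 1 = saturate e (w + p + q) - saturate e (w + q)" "g 0 = saturate e (w + p) - saturate e w"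
    by (simp_all add: g_def)
  moreover have "3 * norm p * norm q * \<bar>1 - 0\<bar> = 3 * norm p * norm q" by simp
  ultimately show ?thesis by linarith
qed

lemma abs_saturate_le:
  assumes "norm e \<le> 1"
  shows "\<bar>saturate e w\<bar> \<le> 1"
proof -
  have "\<bar>e \<bullet> w\<bar> \<le> norm w"
    using Cauchy_Schwarz_ineq2[of e w] mult_right_mono[OF assms norm_ge_zero[of w]] by simp
  also have "\<dots> \<le> sqrt (1 + w \<bullet> w)"
    by (simp add: real_le_rsqrt power2_norm_eq_inner)
  finally show ?thesis
    unfolding saturate_def using one_plus_inner_pos[of w] by (simp add: abs_mult field_simps)
qed

section \<open>Smooth functions and their samples on the grid\<close>

text \<open>A nonempty open set is not a null set, so a continuous function cannot exceed its essential
  supremum anywhere.\<close>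

lemma norm_le_Linf:
  fixes g :: "'a::euclidean_space \<Rightarrow> 'b::real_normed_vector"
  assumes "continuous_on UNIV g"
  shows "ennreal (norm (g x)) \<le> Linf g"
proof (rule ccontr)
  assume "\<not> ?thesis"
  then have lt: "Linf g < ennreal (norm (g x))" by simp
  then obtain l where l: "Linf g = ennreal l" "0 \<le> l"
    by (cases "Linf g") auto
  have "open {z. l < norm (g z)}"
    by (intro open_Collect_less continuous_intros assms)
  moreover have "x \<in> {z. l < norm (g z)}" using lt l by (simp add: ennreal_less_iff)
  ultimately have "\<not> negligible {z. l < norm (g z)}" by (auto dest: open_not_negligible)
  moreover have "AE z in lebesgue. ennreal (norm (g z)) \<le> ennreal l"
    using esssup_AE[of "\<lambda>z. ennreal (norm (g z))" lebesgue] unfolding l(1)[symmetric] Linf_def .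
  then have "AE z in lebesgue. z \<notin> {z. l < norm (g z)}"
    by eventually_elim (use l in \<open>simp add: ennreal_le_iff not_less\<close>)
  then have "{z. l < norm (g z)} \<in> null_sets lebesgue"
    by (simp add: AE_iff_null completion.AE_iff_null_sets null_sets_completion_iff)
  ultimately show False by (simp add: negligible_iff_null_sets)
qed

lemma finite_length_eq: "finite {ks :: 2 list. length ks = m}"
  using finite_lists_length_eq[of "UNIV :: 2 set" m] by simp

lemma abs_le_grad_norm: "\<bar>foldr pd ks g x\<bar> \<le> grad_norm (length ks) g x"
proof -
  have "(foldr pd ks g x)\<^sup>2 \<le> (\<Sum>ks' | length ks' = length ks. (foldr pd ks' g x)\<^sup>2)"
    by (rule member_le_sum) (auto simp: finite_length_eq)
  then show ?thesis unfolding grad_norm_def by (rule real_le_rsqrt[of "\<bar>_\<bar>", simplified])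
qed

lemma grad_norm_nonneg: "0 \<le> grad_norm m g x"
  unfolding grad_norm_def by (simp add: sum_nonneg)

lemma grad_norm_le_vec: "grad_norm m (\<lambda>z. v z $ i) x \<le> grad_norm_vec m v x"
proof -
  have "(grad_norm m (\<lambda>z. v z $ i) x)\<^sup>2 \<le> (\<Sum>i\<in>UNIV. (grad_norm m (\<lambda>z. v z $ i) x)\<^sup>2)"
    by (rule member_le_sum[of i]) auto
  then show ?thesis unfolding grad_norm_vec_def by (rule real_le_rsqrt)
qed

lemma continuous_on_grad_norm:
  assumes "C_diff m g" "l \<le> m"
  shows "continuous_on UNIV (grad_norm l g)"
proof -
  have "continuous_on UNIV (foldr pd ks g)" if "length ks = l" for ks
    using assms that unfolding C_diff_def by auto
  then show ?thesis unfolding grad_norm_def[abs_def]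
    by (intro continuous_intros) auto
qed

lemma abs_pd_le_Linf:
  assumes "C_diff m g" "length ks \<le> m" "Linf (grad_norm (length ks) g) \<le> ennreal B" "0 \<le> B"
  shows "\<bar>foldr pd ks g x\<bar> \<le> B"
proof -
  have "ennreal (norm (grad_norm (length ks) g x)) \<le> ennreal B"
    using norm_le_Linf[OF continuous_on_grad_norm[OF assms(1,2)]] assms(3) by (rule order_trans)
  then have "grad_norm (length ks) g x \<le> B"
    using assms(4) grad_norm_nonneg[of "length ks" g x] by simp
  then show ?thesis using abs_le_grad_norm[of ks g x] by linarith
qed

lemma abs_pd_vec_le_Linf:
  assumes "C_diff_vec m v" "length ks \<le> m" "Linf (grad_norm_vec (length ks) v) \<le> ennreal B" "0 \<le> B"
  shows "\<bar>foldr pd ks (\<lambda>x. v x $ i) x\<bar> \<le> B"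
proof -
  have "continuous_on UNIV (grad_norm (length ks) (\<lambda>z. v z $ i))" for i
    using assms by (intro continuous_on_grad_norm[of m]) (auto simp: C_diff_vec_def)
  then have "continuous_on UNIV (grad_norm_vec (length ks) v)"
    unfolding grad_norm_vec_def[abs_def] by (intro continuous_intros)
  then have "ennreal (norm (grad_norm_vec (length ks) v x)) \<le> ennreal B"
    using assms(3) by (rule order_trans[OF norm_le_Linf])
  then have "grad_norm_vec (length ks) v x \<le> B"
    using assms(4) by (simp add: grad_norm_vec_def sum_nonneg)
  then show ?thesis
    using abs_le_grad_norm[of ks "\<lambda>x. v x $ i" x] grad_norm_le_vec[of "length ks" v i x] by linarith
qed

definition pdiff :: "(real^2 \<Rightarrow> real) \<Rightarrow> bool" where
  "pdiff u \<longleftrightarrow> (\<forall>k x. (\<lambda>s. u (x + s *\<^sub>R axis k 1)) differentiable (at 0))"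

lemma C_diff_pdiff:
  assumes "C_diff m g" "length ks < m"
  shows "pdiff (foldr pd ks g)"
  using assms unfolding C_diff_def pdiff_def by blast

lemma pdiff_line_derivative:
  assumes "pdiff u"
  shows "((\<lambda>s. u (x + s *\<^sub>R axis k 1)) has_real_derivative pd k u (x + s *\<^sub>R axis k 1)) (at s)"
proof -
  let ?y = "x + s *\<^sub>R axis k 1"
  have "(\<lambda>t. u (?y + t *\<^sub>R axis k 1)) differentiable (at 0)" using assms by (auto simp: pdiff_def)
  then have "((\<lambda>t. u (?y + t *\<^sub>R axis k 1)) has_real_derivative pd k u ?y) (at 0)"
    unfolding pd_def by (simp add: DERIV_deriv_iff_real_differentiable)
  then have "((\<lambda>t. u (?y + (t - s) *\<^sub>R axis k 1)) has_real_derivative pd k u ?y) (at s)"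
    using DERIV_shift[of "\<lambda>t. u (?y + (t - s) *\<^sub>R axis k 1)" "pd k u ?y" 0 s] by simp
  then show ?thesis by (simp add: scaleR_left_diff_distrib)
qed

lemma pdiff_diff_le:
  assumes "pdiff u" "\<And>x. \<bar>pd k u x\<bar> \<le> B"
  shows "\<bar>u (x + h *\<^sub>R axis k 1) - u x\<bar> \<le> \<bar>h\<bar> * B"
  using abs_diff_le_of_derivative[OF pdiff_line_derivative[OF assms(1)] assms(2), of x h 0]
  by (simp add: mult.commute)

lemma pdiff_second_diff_le:
  assumes "pdiff u" "pdiff (pd k u)" "\<And>x. \<bar>pd l (pd k u) x\<bar> \<le> B"
  shows "\<bar>u (x + h *\<^sub>R axis k 1 + h' *\<^sub>R axis l 1) - u (x + h *\<^sub>R axis k 1)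
     - (u (x + h' *\<^sub>R axis l 1) - u x)\<bar> \<le> \<bar>h\<bar> * \<bar>h'\<bar> * B"
proof -
  define g where "g s = u (x + h' *\<^sub>R axis l 1 + s *\<^sub>R axis k 1) - u (x + s *\<^sub>R axis k 1)" for s
  have "\<bar>g h - g 0\<bar> \<le> \<bar>h'\<bar> * B * \<bar>h - 0\<bar>"
  proof (rule abs_diff_le_of_derivative)
    show "(g has_real_derivative pd k u (x + h' *\<^sub>R axis l 1 + s *\<^sub>R axis k 1)
        - pd k u (x + s *\<^sub>R axis k 1)) (at s)" for s
      unfolding g_def by (intro DERIV_diff pdiff_line_derivative assms)
    show "\<bar>pd k u (x + h' *\<^sub>R axis l 1 + s *\<^sub>R axis k 1) - pd k u (x + s *\<^sub>R axis k 1)\<bar> \<le> \<bar>h'\<bar> * B" for s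
      using pdiff_diff_le[OF assms(2,3), of "x + s *\<^sub>R axis k 1" h'] by (simp add: add_ac)
  qed
  then show ?thesis unfolding g_def by (simp add: algebra_simps)
qed

lemma grid_C2_sample:
  assumes "0 < dx" "0 < dy" "pdiff u" "\<And>k. pdiff (pd k u)"
    and "\<And>k x. \<bar>pd k u x\<bar> \<le> D" "\<And>k l x. \<bar>pd l (pd k u) x\<bar> \<le> W"
  shows "grid_C2 dx dy D W (\<lambda>i j. u (gridpt dx dy (of_int i + \<alpha>) (of_int j + \<beta>)))"
  unfolding grid_C2_def
proof (intro allI conjI)
  fix i j :: int
  let ?z = "gridpt dx dy (of_int i + \<alpha>) (of_int j + \<beta>)"
  let ?e = "axis 1 1 :: real^2" let ?f = "axis 2 1 :: real^2"
  have P: "gridpt dx dy (of_int (i + 1) + \<alpha>) (of_int j + \<beta>) = ?z + dx *\<^sub>R ?e"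
    "gridpt dx dy (of_int (i - 1) + \<alpha>) (of_int j + \<beta>) = ?z - dx *\<^sub>R ?e"
    "gridpt dx dy (of_int i + \<alpha>) (of_int (j + 1) + \<beta>) = ?z + dy *\<^sub>R ?f"
    "gridpt dx dy (of_int i + \<alpha>) (of_int (j - 1) + \<beta>) = ?z - dy *\<^sub>R ?f"
    "gridpt dx dy (of_int (i + 1) + \<alpha>) (of_int (j + 1) + \<beta>) = ?z + dx *\<^sub>R ?e + dy *\<^sub>R ?f"
    unfolding gridpt_def node_def vec_eq_iff forall_2 by (simp_all add: axis_def algebra_simps)
  note sd = pdiff_second_diff_le[OF assms(3,4,6)]
  show "\<bar>u (gridpt dx dy (of_int (i + 1) + \<alpha>) (of_int j + \<beta>)) - u ?z\<bar> \<le> dx * D"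
    unfolding P using pdiff_diff_le[OF assms(3,5), of ?z dx 1] assms(1) by simp
  show "\<bar>u (gridpt dx dy (of_int i + \<alpha>) (of_int (j + 1) + \<beta>)) - u ?z\<bar> \<le> dy * D"
    unfolding P using pdiff_diff_le[OF assms(3,5), of ?z dy 2] assms(2) by simp
  have second: "\<bar>u (?z + h *\<^sub>R a) - 2 * u ?z + u (?z - h *\<^sub>R a)\<bar> \<le> h * h * W"
    if "0 < h" "a = axis k 1" for h a k
    using sd[of "?z - h *\<^sub>R a" h k h k] that by (simp add: algebra_simps)
  show "\<bar>u (gridpt dx dy (of_int (i + 1) + \<alpha>) (of_int j + \<beta>)) - 2 * u ?z
      + u (gridpt dx dy (of_int (i - 1) + \<alpha>) (of_int j + \<beta>))\<bar> \<le> dx * dx * W"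
    unfolding P by (rule second[OF assms(1) refl])
  show "\<bar>u (gridpt dx dy (of_int i + \<alpha>) (of_int (j + 1) + \<beta>)) - 2 * u ?z
      + u (gridpt dx dy (of_int i + \<alpha>) (of_int (j - 1) + \<beta>))\<bar> \<le> dy * dy * W"
    unfolding P by (rule second[OF assms(2) refl])
  show "\<bar>u (gridpt dx dy (of_int (i + 1) + \<alpha>) (of_int (j + 1) + \<beta>))
      - u (gridpt dx dy (of_int (i + 1) + \<alpha>) (of_int j + \<beta>))
      - (u (gridpt dx dy (of_int i + \<alpha>) (of_int (j + 1) + \<beta>)) - u ?z)\<bar> \<le> dx * dy * W"
    unfolding P using sd[of ?z dx 1 dy 2] assms(1,2) by simp
qed

subsection \<open>The discrete convolution\<close>

lemma abs_weighted_infsum_le: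
  fixes r G :: "'a \<Rightarrow> real"
  assumes "(\<lambda>p. \<bar>r p\<bar>) summable_on UNIV" "\<And>p. \<bar>G p\<bar> \<le> B"
  shows "(\<lambda>p. r p * G p) summable_on UNIV"
    and "\<bar>\<Sum>\<^sub>\<infinity>p. r p * G p\<bar> \<le> (\<Sum>\<^sub>\<infinity>p. \<bar>r p\<bar>) * B"
proof -
  have le: "norm (r p * G p) \<le> \<bar>r p\<bar> * B" for p
    using assms(2) by (simp add: abs_mult mult_left_mono)
  have s: "(\<lambda>p. \<bar>r p\<bar> * B) summable_on UNIV" by (rule summable_on_cmult_left[OF assms(1)])
  have a: "(\<lambda>p. norm (r p * G p)) summable_on UNIV"
    by (rule Infinite_Sum.abs_summable_on_comparison_test'[OF s]) (rule le)
  then show "(\<lambda>p. r p * G p) summable_on UNIV" by (rule abs_summable_summable)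
  have "norm (\<Sum>\<^sub>\<infinity>p. r p * G p) \<le> (\<Sum>\<^sub>\<infinity>p. norm (r p * G p))" by (rule norm_infsum_bound[OF a])
  also have "\<dots> \<le> (\<Sum>\<^sub>\<infinity>p. \<bar>r p\<bar> * B)" by (rule infsum_mono[OF a s le])
  also have "\<dots> = (\<Sum>\<^sub>\<infinity>p. \<bar>r p\<bar>) * B" by (rule infsum_cmult_left) (use assms in auto)
  finally show "\<bar>\<Sum>\<^sub>\<infinity>p. r p * G p\<bar> \<le> (\<Sum>\<^sub>\<infinity>p. \<bar>r p\<bar>) * B" by simp
qed

lemma summable_on_real_diff:
  fixes f g :: "'a \<Rightarrow> real"
  assumes "f summable_on A" "g summable_on A"
  shows "(\<lambda>x. f x - g x) summable_on A" "(\<Sum>\<^sub>\<infinity>x\<in>A. f x - g x) = infsum f A - infsum g A"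
proof -
  have m: "(\<lambda>x. - g x) summable_on A" using assms(2) by (simp add: summable_on_uminus)
  show "(\<lambda>x. f x - g x) summable_on A" using summable_on_add[OF assms(1) m] by simp
  show "(\<Sum>\<^sub>\<infinity>x\<in>A. f x - g x) = infsum f A - infsum g A"
    using infsum_add[OF assms(1) m] by (simp add: infsum_uminus)
qed

text \<open>Differences of grid functions commute with the sum. Applied to the translates of a derivative of
  \<open>\<eta>\<close>, this puts all differences of the discrete convolution on \<open>\<eta>\<close> and leaves only the mass of the
  density.\<close>

lemma grid_C2_superposition:
  fixes r :: "'a \<Rightarrow> real" and g :: "'a \<Rightarrow> int \<Rightarrow> int \<Rightarrow> real"
  assumes r: "(\<lambda>p. \<bar>r p\<bar>) summable_on UNIV" "c * (\<Sum>\<^sub>\<infinity>p. \<bar>r p\<bar>) \<le> m" "0 \<le> c"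
    and g: "\<And>p. grid_C2 dx dy D W (g p)" "\<And>p i j. \<bar>g p i j\<bar> \<le> K" and "0 \<le> D" "0 \<le> W" "0 < dx" "0 < dy"
  shows "grid_C2 dx dy (m * D) (m * W) (\<lambda>i j. c * (\<Sum>\<^sub>\<infinity>p. r p * g p i j))"
proof -
  note sm = abs_weighted_infsum_le(1)[OF r(1) g(2)]
  have bound: "\<bar>c * (\<Sum>\<^sub>\<infinity>p. r p * G p)\<bar> \<le> h * (m * B)" if "\<And>p. \<bar>G p\<bar> \<le> h * B" "0 \<le> h * B" for G h B
  proof -
    have "\<bar>c * (\<Sum>\<^sub>\<infinity>p. r p * G p)\<bar> \<le> c * ((\<Sum>\<^sub>\<infinity>p. \<bar>r p\<bar>) * (h * B))"
      using abs_weighted_infsum_le(2)[OF r(1) that(1)] r(3) by (simp add: abs_mult mult_left_mono)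
    also have "\<dots> = (c * (\<Sum>\<^sub>\<infinity>p. \<bar>r p\<bar>)) * (h * B)" by simp
    also have "\<dots> \<le> m * (h * B)" using r(2) that(2) by (rule mult_right_mono)
    finally show ?thesis by (simp add: algebra_simps)
  qed
  let ?w = "\<lambda>i j. c * (\<Sum>\<^sub>\<infinity>p. r p * g p i j)"
  have diff: "?w i j - ?w i' j' = c * (\<Sum>\<^sub>\<infinity>p. r p * (g p i j - g p i' j'))" for i j i' j'
    by (simp add: right_diff_distrib summable_on_real_diff(2)[OF sm sm])
  have diff2: "?w i1 j1 - ?w i2 j2 - (?w i3 j3 - ?w i4 j4)
      = c * (\<Sum>\<^sub>\<infinity>p. r p * (g p i1 j1 - g p i2 j2 - (g p i3 j3 - g p i4 j4)))" for i1 j1 i2 j2 i3 j3 i4 j4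
    by (simp add: right_diff_distrib summable_on_real_diff sm)
  have two: "a - 2 * b + d = a - b - (b - d)" for a b d :: real by simp
  have nn: "0 \<le> dx * D" "0 \<le> dy * D" "0 \<le> dx * dx * W" "0 \<le> dy * dy * W" "0 \<le> dx * dy * W"
    using assms by simp_all
  note C = grid_C2D[OF g(1)]
  show ?thesis unfolding grid_C2_def two diff diff2[unfolded diff]
    by (intro allI conjI bound nn C[unfolded two])
qed

subsection \<open>The non-local term\<close>

lemma norm_vec2_le:
  fixes p :: "real^2"
  assumes "\<And>k. \<bar>p $ k\<bar> \<le> c"
  shows "norm p \<le> sqrt 2 * c"
proof -
  have c: "0 \<le> c" using assms[of 1] by linarith
  have sq: "(p $ k)\<^sup>2 \<le> c\<^sup>2" for k using assms[of k] c by (simp add: abs_le_square_iff[symmetric])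
  have "(norm p)\<^sup>2 \<le> 2 * c\<^sup>2"
    unfolding power2_norm_eq_inner inner_vec_def sum_2 using sq[of 1] sq[of 2] by (simp add: power2_eq_square)
  then have "norm p \<le> sqrt (2 * c\<^sup>2)" by (rule real_le_rsqrt)
  then show ?thesis using c by (simp add: real_sqrt_mult)
qed

text \<open>The factor \<open>6\<close> arises as \<open>3 * sqrt 2 * sqrt 2\<close>, from the bound 3 on the second derivative and the
  passage from components to norms.\<close>

lemma grid_C2_saturate:
  fixes w :: "int \<Rightarrow> int \<Rightarrow> real^2"
  assumes w: "\<And>k. grid_C2 dx dy S T (\<lambda>i j. w i j $ k)" and e: "norm e \<le> 1"
    and pos: "0 < dx" "0 < dy" "0 \<le> S" "0 \<le> T"
  shows "grid_C2 dx dy (2 * S) (2 * T + 6 * S\<^sup>2) (\<lambda>i j. saturate e (w i j))"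
proof -
  have s2: "5 / 4 * (sqrt 2 * c) \<le> 2 * c" if "0 \<le> c" for c
  proof -
    have "sqrt 2 \<le> 8 / 5" by (rule real_le_lsqrt) (auto simp: power2_eq_square)
    then have "5 / 4 * sqrt 2 * c \<le> 2 * c" using that by (intro mult_right_mono) auto
    then show ?thesis by simp
  qed
  have first: "\<bar>saturate e b - saturate e a\<bar> \<le> 2 * c" if "\<And>k. \<bar>b $ k - a $ k\<bar> \<le> c" for a b c
  proof -
    have "0 \<le> c" using that[of 1] by linarith
    have "\<bar>saturate e (a + (b - a)) - saturate e a\<bar> \<le> 5 / 4 * norm (b - a)" by (rule saturate_diff_le[OF e])
    also have "\<dots> \<le> 5 / 4 * (sqrt 2 * c)" using norm_vec2_le[of "b - a" c] that by simp
    also have "\<dots> \<le> 2 * c" using s2[OF \<open>0 \<le> c\<close>] .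
    finally show ?thesis by simp
  qed
  have second: "\<bar>saturate e d - saturate e b - (saturate e c - saturate e a)\<bar> \<le> h * h' * (2 * T + 6 * S\<^sup>2)"
    if "0 < h" "0 < h'" "\<And>k. \<bar>b $ k - a $ k\<bar> \<le> h * S" "\<And>k. \<bar>c $ k - a $ k\<bar> \<le> h' * S"
      "\<And>k. \<bar>d $ k - b $ k - (c $ k - a $ k)\<bar> \<le> h * h' * T" for a b c d h h'
  proof -
    have "\<bar>saturate e (a + (b - a) + (c - a) + (d - b - (c - a))) - saturate e (a + (b - a))
        - (saturate e (a + (c - a)) - saturate e a)\<bar>
        \<le> 5 / 4 * norm (d - b - (c - a)) + 3 * norm (b - a) * norm (c - a)"
      by (rule saturate_second_diff_le[OF e])
    also have "\<dots> \<le> 5 / 4 * (sqrt 2 * (h * h' * T)) + 3 * (sqrt 2 * (h * S)) * (sqrt 2 * (h' * S))"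
    proof (intro add_mono mult_mono order_refl)
      show "norm (d - b - (c - a)) \<le> sqrt 2 * (h * h' * T)" by (rule norm_vec2_le) (use that(5) in simp)
      show "norm (b - a) \<le> sqrt 2 * (h * S)" by (rule norm_vec2_le) (use that(3) in simp)
      show "norm (c - a) \<le> sqrt 2 * (h' * S)" by (rule norm_vec2_le) (use that(4) in simp)
    qed (use that(1,2) pos in \<open>simp_all\<close>)
    also have "3 * (sqrt 2 * (h * S)) * (sqrt 2 * (h' * S)) = 3 * (sqrt 2 * sqrt 2) * (h * h') * S\<^sup>2"
      by (simp add: power2_eq_square del: real_sqrt_mult_self)
    also have "\<dots> = 6 * (h * h') * S\<^sup>2" by simp
    also have "5 / 4 * (sqrt 2 * (h * h' * T)) + 6 * (h * h') * S\<^sup>2 \<le> 2 * (h * h' * T) + 6 * (h * h') * S\<^sup>2"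
      using s2[of "h * h' * T"] that pos by simp
    also have "\<dots> = h * h' * (2 * T + 6 * S\<^sup>2)" by (simp add: algebra_simps)
    moreover have "a + (b - a) + (c - a) + (d - b - (c - a)) = d" "a + (b - a) = b" "a + (c - a) = c"
      by (simp_all add: algebra_simps)
    ultimately show ?thesis by simp
  qed
  have two: "a - 2 * b + d = a - b - (b - d)" for a b d :: real by simp
  note C = grid_C2D[OF w]
  have shifted: "\<bar>w i j $ k - w (i - 1) j $ k\<bar> \<le> dx * S" "\<bar>w i j $ k - w i (j - 1) $ k\<bar> \<le> dy * S" for i j k
    using C(1)[of "i - 1" j k] C(2)[of i "j - 1" k] by simp_all
  show ?thesis unfolding grid_C2_def two
  proof (intro allI conjI)
    fix i j
    have "\<bar>saturate e (w (i + 1) j) - saturate e (w i j)\<bar> \<le> 2 * (dx * S)" by (rule first) (rule C)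
    then show "\<bar>saturate e (w (i + 1) j) - saturate e (w i j)\<bar> \<le> dx * (2 * S)" by simp
    have "\<bar>saturate e (w i (j + 1)) - saturate e (w i j)\<bar> \<le> 2 * (dy * S)" by (rule first) (rule C)
    then show "\<bar>saturate e (w i (j + 1)) - saturate e (w i j)\<bar> \<le> dy * (2 * S)" by simp
    show "\<bar>saturate e (w (i + 1) j) - saturate e (w i j) - (saturate e (w i j) - saturate e (w (i - 1) j))\<bar>
        \<le> dx * dx * (2 * T + 6 * S\<^sup>2)"
      by (rule second[OF pos(1) pos(1)]) (rule shifted C[unfolded two])+
    show "\<bar>saturate e (w i (j + 1)) - saturate e (w i j) - (saturate e (w i j) - saturate e (w i (j - 1)))\<bar>
        \<le> dy * dy * (2 * T + 6 * S\<^sup>2)"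
      by (rule second[OF pos(2) pos(2)]) (rule shifted C[unfolded two])+
    show "\<bar>saturate e (w (i + 1) (j + 1)) - saturate e (w (i + 1) j) - (saturate e (w i (j + 1)) - saturate e (w i j))\<bar>
        \<le> dx * dy * (2 * T + 6 * S\<^sup>2)"
      by (rule second[OF pos(1) pos(2)]) (rule C)+
  qed
qed

lemma grid_C2_cmult:
  assumes "grid_C2 dx dy D W a"
  shows "grid_C2 dx dy (\<bar>c\<bar> * D) (\<bar>c\<bar> * W) (\<lambda>i j. c * a i j)"
proof -
  have le: "\<bar>c * x\<bar> \<le> h * (\<bar>c\<bar> * B)" if "\<bar>x\<bar> \<le> h * B" for x h B
    using mult_left_mono[OF that, of "\<bar>c\<bar>"] by (simp add: abs_mult algebra_simps)
  note C = le[OF grid_C2D(1)[OF assms]] le[OF grid_C2D(2)[OF assms]] le[OF grid_C2D(3)[OF assms]]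
    le[OF grid_C2D(4)[OF assms]] le[OF grid_C2D(5)[OF assms]]
  have lin: "c * x - 2 * (c * y) + c * z = c * (x - 2 * y + z)" "c * x - c * y = c * (x - y)" for x y z
    by (simp_all add: algebra_simps)
  show ?thesis unfolding grid_C2_def lin using C by blast
qed

lemma grid_mass_summable:
  assumes "grid_mass dx dy r \<le> ennreal m" "0 < dx" "0 < dy" "0 \<le> m"
  shows "(\<lambda>p. \<bar>case p of (i, j) \<Rightarrow> r i j\<bar>) summable_on UNIV"
    and "dx * dy * (\<Sum>\<^sub>\<infinity>p. \<bar>case p of (i, j) \<Rightarrow> r i j\<bar>) \<le> m"
proof -
  have eq: "(\<lambda>p. \<bar>case p of (i, j) \<Rightarrow> r i j\<bar>) = (\<lambda>(i, j). \<bar>r i j\<bar>)" by auto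
  have d: "0 < dx * dy" using assms by simp
  have m: "ennreal (dx * dy) * grid_sum (\<lambda>i j. \<bar>r i j\<bar>) \<le> ennreal m"
    using assms by (simp add: grid_mass_eq)
  have "grid_sum (\<lambda>i j. \<bar>r i j\<bar>) \<le> ennreal (m / (dx * dy))"
  proof (cases "grid_sum (\<lambda>i j. \<bar>r i j\<bar>)")
    case (real g)
    then have "dx * dy * g \<le> m" using m d assms by (simp add: ennreal_mult[symmetric])
    then show ?thesis using real d assms by (simp add: field_simps)
  next
    case top
    then have "ennreal (dx * dy) * grid_sum (\<lambda>i j. \<bar>r i j\<bar>) = top" using assms(2,3) by (simp add: ennreal_mult_top)
    then show ?thesis using m by (simp add: top_unique)
  qed
  from grid_sum_finite_summable[OF this] d assms
  have s: "(\<lambda>(i, j). \<bar>r i j\<bar>) summable_on UNIV" "(\<Sum>\<^sub>\<infinity>(i, j)\<in>UNIV. \<bar>r i j\<bar>) \<le> m / (dx * dy)" by auto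
  show "(\<lambda>p. \<bar>case p of (i, j) \<Rightarrow> r i j\<bar>) summable_on UNIV" unfolding eq by (rule s)
  show "dx * dy * (\<Sum>\<^sub>\<infinity>p. \<bar>case p of (i, j) \<Rightarrow> r i j\<bar>) \<le> m"
    unfolding eq using s(2) d by (simp add: field_simps)
qed

lemma J_term_eq_saturate:
  "J_term dx dy \<epsilon> \<eta> r k a b = (- \<epsilon>) * saturate (axis k 1) (conv_grad dx dy \<eta> r a b)"
  unfolding J_term_def saturate_def by (simp add: inner_axis' power2_norm_eq_inner)

lemma abs_J_term_le:
  assumes "0 \<le> \<epsilon>"
  shows "\<bar>J_term dx dy \<epsilon> \<eta> r k a b\<bar> \<le> \<epsilon>"
  unfolding J_term_eq_saturate abs_mult
  using mult_left_mono[OF abs_saturate_le, of "axis k 1" \<epsilon> "conv_grad dx dy \<eta> r a b"] assms by simp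

lemma grid_C2_J_term:
  assumes pos: "0 < dx" "0 < dy" "0 \<le> \<epsilon>" "0 \<le> m" "0 \<le> N2" "0 \<le> N3"
    and \<eta>: "C_W_inf 3 \<eta>" "Linf (grad_norm 2 \<eta>) \<le> ennreal N2" "Linf (grad_norm 3 \<eta>) \<le> ennreal N3"
    and r: "grid_mass dx dy r \<le> ennreal m"
  shows "grid_C2 dx dy (\<epsilon> * (2 * (m * N2))) (\<epsilon> * (2 * (m * N3) + 6 * (m * N2)\<^sup>2))
     (\<lambda>i j. J_term dx dy \<epsilon> \<eta> r k (of_int i + \<alpha>) (of_int j + \<beta>))"
proof -
  have C3: "C_diff 3 \<eta>" using \<eta>(1) by (simp add: C_W_inf_def)
  have "Linf (grad_norm 1 \<eta>) < \<infinity>" using \<eta>(1) by (auto simp: C_W_inf_def)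
  then obtain N1 where N1: "Linf (grad_norm 1 \<eta>) = ennreal N1" "0 \<le> N1"
    by (cases "Linf (grad_norm 1 \<eta>)") auto
  have b1: "\<bar>pd k \<eta> x\<bar> \<le> N1" for k x
    using abs_pd_le_Linf[OF C3, of "[k]" N1] N1 by simp
  have b2: "\<bar>pd l (pd k \<eta>) x\<bar> \<le> N2" for k l x
    using abs_pd_le_Linf[OF C3, of "[l, k]" N2] \<eta> pos by (simp add: numeral_2_eq_2)
  have b3: "\<bar>pd l (pd l' (pd k \<eta>)) x\<bar> \<le> N3" for k l l' x
    using abs_pd_le_Linf[OF C3, of "[l, l', k]" N3] \<eta> pos by (simp add: numeral_3_eq_3)
  have p1: "pdiff (pd k \<eta>)" for k using C_diff_pdiff[OF C3, of "[k]"] by simp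
  have p2: "pdiff (pd l (pd k \<eta>))" for k l using C_diff_pdiff[OF C3, of "[l, k]"] by simp
  have conv: "grid_C2 dx dy (m * N2) (m * N3) (\<lambda>i j. conv_grad dx dy \<eta> r (of_int i + \<alpha>) (of_int j + \<beta>) $ k)" for k
  proof -
    have "grid_C2 dx dy (m * N2) (m * N3) (\<lambda>i j. dx * dy * (\<Sum>\<^sub>\<infinity>p. (case p of (i, j) \<Rightarrow> r i j) *
        (case p of (p, l) \<Rightarrow> \<lambda>i j. pd k \<eta> (gridpt dx dy (of_int i + (\<alpha> - of_int p)) (of_int j + (\<beta> - of_int l)))) i j))"
    proof (rule grid_C2_superposition[where K = N1])
      fix p :: "int \<times> int"
      show "grid_C2 dx dy N2 N3 (case p of (p, l) \<Rightarrow>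
          \<lambda>i j. pd k \<eta> (gridpt dx dy (of_int i + (\<alpha> - of_int p)) (of_int j + (\<beta> - of_int l))))"
        by (cases p) (simp only: prod.case, rule grid_C2_sample[OF pos(1,2) p1 p2 b2 b3])
      show "\<bar>(case p of (p, l) \<Rightarrow> \<lambda>i j. pd k \<eta> (gridpt dx dy (of_int i + (\<alpha> - of_int p)) (of_int j + (\<beta> - of_int l)))) i j\<bar> \<le> N1" for i j
        by (cases p) (simp only: prod.case b1)
    qed (rule grid_mass_summable[OF r pos(1,2,4)] | use pos in simp)+
    then show ?thesis unfolding conv_grad_def by (simp add: case_prod_unfold add_diff_eq)
  qed
  have "grid_C2 dx dy (2 * (m * N2)) (2 * (m * N3) + 6 * (m * N2)\<^sup>2)
      (\<lambda>i j. saturate (axis k 1) (conv_grad dx dy \<eta> r (of_int i + \<alpha>) (of_int j + \<beta>)))"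
    by (rule grid_C2_saturate[OF conv]) (use pos in auto)
  from grid_C2_cmult[OF this, of "- \<epsilon>"] show ?thesis
    unfolding J_term_eq_saturate using pos by simp
qed

section \<open>The flux function\<close>

lemma smooth_heaviside_bounds:
  assumes "smooth_heaviside H"
  shows "0 \<le> H x" "H x \<le> 1"
proof -
  have mono: "mono H" and l: "(H \<longlongrightarrow> 0) at_bot" "(H \<longlongrightarrow> 1) at_top"
    using assms by (auto simp: smooth_heaviside_def)
  show "0 \<le> H x"
    by (rule tendsto_upperbound[OF l(1)])
       (auto intro!: eventually_mono[OF eventually_le_at_bot[of x]] monoD[OF mono])
  show "H x \<le> 1"
    by (rule tendsto_lowerbound[OF l(2)])
       (auto intro!: eventually_mono[OF eventually_ge_at_top[of x]] monoD[OF mono])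
qed

lemma flux_fun_abs_le:
  assumes "smooth_heaviside H"
  shows "\<bar>flux_fun H \<rho>max x\<bar> \<le> \<bar>x\<bar>"
  unfolding flux_fun_def abs_mult
  using smooth_heaviside_bounds[OF assms, of "x - \<rho>max"] mult_left_mono[of _ 1 "\<bar>x\<bar>"] by simp

lemma flux_fun_lipschitz:
  assumes H: "smooth_heaviside H" and L: "Linf (deriv (flux_fun H \<rho>max)) \<le> ennreal L" "0 \<le> L"
  shows "\<bar>flux_fun H \<rho>max x - flux_fun H \<rho>max y\<bar> \<le> L * \<bar>x - y\<bar>"
proof -
  have d: "((deriv ^^ m) H) differentiable (at x)" for m x using H by (auto simp: smooth_heaviside_def)
  have H1: "(H has_real_derivative deriv H x) (at x)" for x
    using d[of 0 x] by (simp add: DERIV_deriv_iff_real_differentiable)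
  have f': "(flux_fun H \<rho>max has_real_derivative H (x - \<rho>max) + x * deriv H (x - \<rho>max)) (at x)" for x
  proof -
    have "((\<lambda>r. H (r - \<rho>max)) has_real_derivative deriv H (x - \<rho>max)) (at x)"
      by (rule DERIV_chain2[OF H1, where g = "\<lambda>r. r - \<rho>max" and Db = 1, simplified])
         (auto intro!: derivative_eq_intros)
    then show ?thesis unfolding flux_fun_def[abs_def] by (auto intro!: derivative_eq_intros)
  qed
  have "deriv (flux_fun H \<rho>max) = (\<lambda>x. H (x - \<rho>max) + x * deriv H (x - \<rho>max))"
    using f' by (intro ext DERIV_imp_deriv)
  moreover have cont: "continuous_on UNIV H" "continuous_on UNIV (deriv H)"
    using d[of 0] d[of 1]
    by (auto intro!: continuous_at_imp_continuous_on differentiable_imp_continuous_within)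
  have "continuous_on UNIV (\<lambda>x. H (x - \<rho>max))" "continuous_on UNIV (\<lambda>x. deriv H (x - \<rho>max))"
    by (rule continuous_on_compose2[OF cont(1)] continuous_on_compose2[OF cont(2)];
        auto intro!: continuous_intros)+
  then have "continuous_on UNIV (\<lambda>x. H (x - \<rho>max) + x * deriv H (x - \<rho>max))"
    by (intro continuous_intros)
  ultimately have "ennreal (norm (H (x - \<rho>max) + x * deriv H (x - \<rho>max))) \<le> ennreal L" for x
    using order_trans[OF norm_le_Linf[of "deriv (flux_fun H \<rho>max)" x] L(1)] by simp
  then have "\<bar>H (x - \<rho>max) + x * deriv H (x - \<rho>max)\<bar> \<le> L" for x using L(2) by simp
  from abs_diff_le_of_derivative[OF f' this] show ?thesis .
qed

text \<open>The quotient \<open>f r / r\<close> tends to 1. Hence \<open>\<epsilon> \<le> \<epsilon> * L\<close>, and a CFL condition stated with \<open>L\<close> also controls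
  the outflow of mass, in which \<open>L\<close> does not occur.\<close>

lemma flux_fun_lipschitz_ge_1:
  assumes H: "smooth_heaviside H" and L: "Linf (deriv (flux_fun H \<rho>max)) \<le> ennreal L" "0 \<le> L"
  shows "1 \<le> L"
proof -
  have "(H \<longlongrightarrow> 1) at_top" using H by (auto simp: smooth_heaviside_def)
  moreover have "H x \<le> L" if "1 - \<rho>max \<le> x" for x
  proof -
    have "\<bar>(x + \<rho>max) * H x\<bar> \<le> L * (x + \<rho>max)"
      using flux_fun_lipschitz[OF assms, of "x + \<rho>max" 0] that by (simp add: flux_fun_def)
    then have "(x + \<rho>max) * H x \<le> (x + \<rho>max) * L" by (simp only: abs_le_iff mult.commute[of L])
    then show ?thesis using that by simp
  qed
  ultimately show ?thesis
    by (intro tendsto_upperbound[of H 1 at_top]) (auto intro!: eventually_mono[OF eventually_ge_at_top[of "1 - \<rho>max"]])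
qed

text \<open>On nonnegative arguments \<open>f\<close> is a product of nonnegative increasing functions; elsewhere its
  slope can have either sign.\<close>

lemma flux_fun_slope:
  assumes H: "smooth_heaviside H" and L: "Linf (deriv (flux_fun H \<rho>max)) \<le> ennreal L" "0 \<le> L"
  obtains t where "flux_fun H \<rho>max x - flux_fun H \<rho>max y = t * (x - y)" "\<bar>t\<bar> \<le> L" "0 \<le> x \<Longrightarrow> 0 \<le> y \<Longrightarrow> 0 \<le> t"
proof (cases "x = y")
  case True
  then show ?thesis using that[of 0] L by simp
next
  case False
  let ?f = "flux_fun H \<rho>max"
  define t where "t = (?f x - ?f y) / (x - y)"
  have eq: "?f x - ?f y = t * (x - y)" using False by (simp add: t_def)
  have "\<bar>t\<bar> \<le> L"
    using flux_fun_lipschitz[OF assms, of x y] False unfolding eq abs_mult by simp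
  moreover have "0 \<le> t" if "0 \<le> x" "0 \<le> y"
  proof -
    have m: "?f a \<le> ?f b" if "0 \<le> a" "a \<le> b" for a b
      unfolding flux_fun_def using that smooth_heaviside_bounds[OF H] H
      by (intro mult_mono) (auto simp: smooth_heaviside_def intro: monoD)
    show ?thesis unfolding t_def
      using m[of x y] m[of y x] that by (cases "x \<le> y") (auto intro: divide_nonneg_nonneg divide_nonpos_nonpos)
  qed
  ultimately show ?thesis using that[OF eq] by blast
qed

section \<open>An interpolation inequality\<close>

text \<open>The Landau inequality on the line: a Taylor expansion at both sides of the origin gives
  \<open>2 h \<bar>g'\<bar> \<le> 2 V + h\<^sup>2 W\<close> for every step \<open>h > 0\<close>.\<close>

lemma landau_inequality:
  fixes g g' g'' :: "real \<Rightarrow> real"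
  assumes g: "\<And>s. (g has_real_derivative g' s) (at s)" "\<And>s. (g' has_real_derivative g'' s) (at s)"
    and V: "\<And>s. \<bar>g s\<bar> \<le> V" and W: "\<And>s. \<bar>g'' s\<bar> \<le> W"
  shows "(g' 0)\<^sup>2 \<le> 2 * V * W"
proof -
  define G where "G = \<bar>g' 0\<bar>"
  have V0: "0 \<le> V" and W0: "0 \<le> W" using V[of 0] W[of 0] by linarith+
  have step: "2 * h * G \<le> 2 * V + h\<^sup>2 * W" if h: "0 < h" for h
  proof -
    have main: "2 * h * (c * g' 0) \<le> 2 * V + h\<^sup>2 * W" if c: "\<bar>c\<bar> = 1" for c
    proof -
      define \<phi> where "\<phi> s = c * (g s - g (- s) - 2 * s * g' 0) + s\<^sup>2 * W" for s
      have "\<phi> 0 \<le> \<phi> h"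
      proof (rule DERIV_nonneg_imp_nondecreasing[of 0 h \<phi>])
        fix s assume s: "0 \<le> s" "s \<le> h"
        have "((\<lambda>s. g (- s)) has_real_derivative - g' (- s)) (at s)"
          by (rule DERIV_cong[OF DERIV_chain2[OF g(1)]]) (auto intro!: derivative_eq_intros)
        then have "(\<phi> has_real_derivative c * (g' s + g' (- s) - 2 * g' 0) + 2 * s * W) (at s)"
          unfolding \<phi>_def by (auto intro!: derivative_eq_intros g)
        moreover have "\<bar>g' s - g' 0\<bar> \<le> W * s" "\<bar>g' (- s) - g' 0\<bar> \<le> W * s"
          using abs_diff_le_of_derivative[OF g(2) W, of s 0] abs_diff_le_of_derivative[OF g(2) W, of "- s" 0] s
          by simp_all
        then have "\<bar>c * (g' s + g' (- s) - 2 * g' 0)\<bar> \<le> 2 * s * W"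
            unfolding abs_mult c by (simp add: abs_le_iff algebra_simps)
        then have "0 \<le> c * (g' s + g' (- s) - 2 * g' 0) + 2 * s * W" by linarith
        ultimately show "\<exists>y. (\<phi> has_real_derivative y) (at s) \<and> 0 \<le> y" by blast
      qed (use h in simp)
      then have "2 * h * (c * g' 0) \<le> c * (g h - g (- h)) + h\<^sup>2 * W" by (simp add: \<phi>_def algebra_simps)
      moreover have "\<bar>c * (g h - g (- h))\<bar> \<le> 2 * V" unfolding abs_mult c using V[of h] V[of "- h"] by simp
      ultimately show ?thesis by linarith
    qed
    show ?thesis using main[of 1] main[of "-1"] unfolding G_def by (cases "0 \<le> g' 0") auto
  qed
  have "G\<^sup>2 \<le> 2 * V * W"
  proof (cases "G = 0 \<or> W = 0")
    case False
    then have p: "0 < G" "0 < W" using W0 by (auto simp: G_def)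
    have "2 * (G / W) * G \<le> 2 * V + (G / W)\<^sup>2 * W" using p by (intro step) simp
    moreover have "2 * (G / W) * G = 2 * (G\<^sup>2 / W)" "(G / W)\<^sup>2 * W = G\<^sup>2 / W"
      using p by (simp_all add: power2_eq_square)
    ultimately have "G\<^sup>2 / W \<le> 2 * V" by linarith
    then show ?thesis using p by (simp add: pos_divide_le_eq)
  next
    case True
    have "G = 0" if "W = 0"
    proof (rule ccontr)
      assume "G \<noteq> 0"
      then have p: "0 < G" by (simp add: G_def)
      have "2 * ((V + 1) / G) * G \<le> 2 * V" using step[of "(V + 1) / G"] p V0 that by simp
      then show False using p by simp
    qed
    then show ?thesis using True V0 W0 by auto
  qed
  then show ?thesis by (simp add: G_def)
qed

text \<open>For a planar field, the inequality is applied on each coordinate line to the component of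
  the field along its own derivative at the point under consideration.\<close>

lemma field_landau_pointwise:
  assumes v: "C_diff_vec 2 v" and V: "\<And>x. norm (v x) \<le> V" and W: "\<And>x. grad_norm_vec 2 v x \<le> W"
  shows "(grad_norm_vec 1 v x)\<^sup>2 \<le> 4 * V * W"
proof -
  have len1: "{ks :: 2 list. length ks = 1} = (\<lambda>k. [k]) ` UNIV"
    by (auto simp: length_Suc_conv)
  have C: "C_diff 2 (\<lambda>x. v x $ i)" for i using v by (auto simp: C_diff_vec_def)
  have pd0: "pdiff (\<lambda>x. v x $ i)" for i using C_diff_pdiff[OF C, of "[]"] by simp
  have pd1: "pdiff (pd k (\<lambda>x. v x $ i))" for i k using C_diff_pdiff[OF C, of "[k]"] by simp
  have line: "(\<Sum>i\<in>UNIV. (pd k (\<lambda>x. v x $ i) x)\<^sup>2) \<le> 2 * V * W" for k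
  proof -
    define P where "P i = pd k (\<lambda>x. v x $ i) x" for i
    define N where "N = (P 1)\<^sup>2 + (P 2)\<^sup>2"
    define z where "z s = x + s *\<^sub>R axis k 1" for s
    define g where "g s = P 1 * v (z s) $ 1 + P 2 * v (z s) $ 2" for s
    define g' where "g' s = P 1 * pd k (\<lambda>x. v x $ 1) (z s) + P 2 * pd k (\<lambda>x. v x $ 2) (z s)" for s
    define g'' where "g'' s = P 1 * pd k (pd k (\<lambda>x. v x $ 1)) (z s) + P 2 * pd k (pd k (\<lambda>x. v x $ 2)) (z s)" for s
    have cs: "\<bar>P 1 * a + P 2 * b\<bar> \<le> sqrt N * c" if "sqrt (a\<^sup>2 + b\<^sup>2) \<le> c" for a b c
    proof -
      have "(P 1 * a + P 2 * b)\<^sup>2 + (P 1 * b - P 2 * a)\<^sup>2 = N * (a\<^sup>2 + b\<^sup>2)"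
        by (simp add: N_def power2_eq_square algebra_simps)
      then have "(P 1 * a + P 2 * b)\<^sup>2 \<le> N * (a\<^sup>2 + b\<^sup>2)"
        using zero_le_power2[of "P 1 * b - P 2 * a"] by linarith
      then have "\<bar>P 1 * a + P 2 * b\<bar> \<le> sqrt (N * (a\<^sup>2 + b\<^sup>2))" by (intro real_le_rsqrt) simp
      also have "\<dots> = sqrt N * sqrt (a\<^sup>2 + b\<^sup>2)" by (rule real_sqrt_mult)
      also have "\<dots> \<le> sqrt N * c" using that by (intro mult_left_mono) (auto simp: N_def)
      finally show ?thesis .
    qed
    have "(g' 0)\<^sup>2 \<le> 2 * (sqrt N * V) * (sqrt N * W)"
    proof (rule landau_inequality)
      show "(g has_real_derivative g' s) (at s)" for s
        unfolding g_def g'_def z_def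
        by (intro DERIV_add DERIV_cmult pdiff_line_derivative[OF pd0])
      show "(g' has_real_derivative g'' s) (at s)" for s
        unfolding g'_def g''_def z_def
        by (intro DERIV_add DERIV_cmult pdiff_line_derivative[OF pd1])
      show "\<bar>g s\<bar> \<le> sqrt N * V" for s
      proof -
        have "sqrt ((v (z s) $ 1)\<^sup>2 + (v (z s) $ 2)\<^sup>2) = norm (v (z s))"
          by (simp add: norm_vec_def L2_set_def sum_2)
        then show ?thesis unfolding g_def using V[of "z s"] by (intro cs) simp
      qed
      show "\<bar>g'' s\<bar> \<le> sqrt N * W" for s
      proof -
        have le: "(pd k (pd k (\<lambda>x. v x $ i)) (z s))\<^sup>2 \<le> (grad_norm 2 (\<lambda>x. v x $ i) (z s))\<^sup>2" for i
          using abs_le_grad_norm[of "[k, k]" "\<lambda>x. v x $ i" "z s"] grad_norm_nonneg[of 2 "\<lambda>x. v x $ i" "z s"]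
          by (intro abs_le_square_iff[THEN iffD1]) (simp add: numeral_2_eq_2)
        have "sqrt ((pd k (pd k (\<lambda>x. v x $ 1)) (z s))\<^sup>2 + (pd k (pd k (\<lambda>x. v x $ 2)) (z s))\<^sup>2)
            \<le> grad_norm_vec 2 v (z s)"
          unfolding grad_norm_vec_def sum_2 using le by (intro real_sqrt_le_mono add_mono)
        then show ?thesis unfolding g''_def by (intro cs) (use W[of "z s"] in linarith)
      qed
    qed
    moreover have "g' 0 = N" by (simp add: g'_def z_def P_def N_def power2_eq_square)
    moreover have "2 * (sqrt N * V) * (sqrt N * W) = N * (2 * V * W)"
    proof -
      have "sqrt N * sqrt N = N" by (simp add: N_def)
      then show ?thesis by (simp add: algebra_simps)
    qed
    ultimately have "N * N \<le> N * (2 * V * W)" by (simp add: power2_eq_square)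
    moreover have "0 \<le> N" by (simp add: N_def)
    moreover have "0 \<le> V" "0 \<le> W"
      by (rule order_trans[OF norm_ge_zero V[of x]])
         (rule order_trans[OF _ W[of x]], simp add: grad_norm_vec_def sum_nonneg)
    ultimately have "N \<le> 2 * V * W" by (cases "N = 0") auto
    then show ?thesis by (simp add: sum_2 N_def P_def)
  qed
  have "(grad_norm_vec 1 v x)\<^sup>2 = (\<Sum>i\<in>UNIV. \<Sum>ks | length ks = 1. (foldr pd ks (\<lambda>z. v z $ i) x)\<^sup>2)"
    unfolding grad_norm_vec_def grad_norm_def by (simp add: sum_nonneg)
  also have "\<dots> = (\<Sum>i\<in>UNIV. \<Sum>k\<in>UNIV. (pd k (\<lambda>z. v z $ i) x)\<^sup>2)"
    unfolding len1 by (simp add: sum.reindex inj_on_def)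
  also have "\<dots> = (\<Sum>k\<in>UNIV. \<Sum>i\<in>UNIV. (pd k (\<lambda>z. v z $ i) x)\<^sup>2)"
    by (rule sum.swap)
  also have "\<dots> \<le> 4 * V * W" using line[of 1] line[of 2] by (simp add: sum_2)
  finally show ?thesis .
qed

lemma Linf_le_bound:
  assumes "continuous_on UNIV g" "\<And>x. norm (g x) \<le> B"
  shows "Linf g \<le> ennreal B"
  unfolding Linf_def
proof (rule esssup_I)
  have "(\<lambda>x. ennreal (norm (g x))) \<in> borel_measurable borel"
    by (intro measurable_compose[OF borel_measurable_continuous_onI measurable_ennreal] continuous_intros assms)
  then have "(\<lambda>x. ennreal (norm (g x))) \<in> borel_measurable lborel" by (subst measurable_cong_sets[OF sets_lborel refl])
  then show "(\<lambda>x. ennreal (norm (g x))) \<in> borel_measurable lebesgue" by (rule measurable_completion)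
qed (use assms in \<open>auto intro: ennreal_leI\<close>)

lemma continuous_on_vec_components:
  fixes v :: "'a::topological_space \<Rightarrow> real^2"
  assumes "\<And>i. continuous_on S (\<lambda>x. v x $ i)"
  shows "continuous_on S v"
proof -
  have "continuous_on S (\<lambda>x. \<chi> i. v x $ i)" by (rule continuous_on_vec_lambda) (rule assms)
  then show ?thesis by simp
qed

lemma C_diff_vec_continuous: "C_diff_vec m v \<Longrightarrow> continuous_on UNIV v"
  by (rule continuous_on_vec_components) (auto simp: C_diff_vec_def C_diff_def dest!: spec[of _ "[]"])

lemma grad_norm_vec_continuous: "C_diff_vec m v \<Longrightarrow> l \<le> m \<Longrightarrow> continuous_on UNIV (grad_norm_vec l v)"
  unfolding grad_norm_vec_def[abs_def]
  by (intro continuous_intros continuous_on_grad_norm[of m]) (auto simp: C_diff_vec_def)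

lemma field_landau:
  assumes v: "C_diff_vec 2 v" and "Linf v \<le> ennreal V" "Linf (grad_norm_vec 2 v) \<le> ennreal W"
    and D: "Linf (grad_norm_vec 1 v) = ennreal D" and nn: "0 \<le> V" "0 \<le> W" "0 \<le> D"
  shows "D\<^sup>2 \<le> 4 * V * W"
proof -
  have V: "norm (v x) \<le> V" for x
    using order_trans[OF norm_le_Linf[OF C_diff_vec_continuous[OF v]] assms(2)] nn by simp
  have W: "grad_norm_vec 2 v x \<le> W" for x
    using order_trans[OF norm_le_Linf[OF grad_norm_vec_continuous[OF v, of 2]] assms(3)] nn
    by (simp add: grad_norm_vec_def sum_nonneg)
  have "norm (grad_norm_vec 1 v x) \<le> sqrt (4 * V * W)" for x
    using field_landau_pointwise[OF v V W, of x] by (simp add: real_le_rsqrt)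
  from Linf_le_bound[OF grad_norm_vec_continuous[OF v] this] D nn have "D \<le> sqrt (4 * V * W)" by simp
  then have "D\<^sup>2 \<le> (sqrt (4 * V * W))\<^sup>2" using nn by (intro power_mono)
  then show ?thesis using nn by simp
qed

section \<open>Initial values\<close>

lemma cell_measurable: "cell dx dy i j \<in> sets borel"
  unfolding cell_def by measurable

lemma cell_disjoint:
  assumes "0 < dx" "0 < dy" "z \<in> cell dx dy i j" "z \<in> cell dx dy i' j'"
  shows "i = i' \<and> j = j'"
proof -
  have *: "i = i'" if "0 < h" "(of_int i - 1) * h \<le> y" "y < of_int i * h" "(of_int i' - 1) * h \<le> y" "y < of_int i' * h"
    for i i' :: int and h y :: real
  proof -
    have "(of_int i - 1) * h < of_int i' * h" "(of_int i' - 1) * h < of_int i * h" using that by linarith+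
    then have "real_of_int i - 1 < of_int i'" "real_of_int i' - 1 < of_int i" using that(1) by simp_all
    then show ?thesis by linarith
  qed
  show ?thesis using assms unfolding cell_def node_def
    by (auto intro!: *[of dx i "z $ 1" i'] *[of dy j "z $ 2" j'])
qed

lemma cell_average_nonneg:
  assumes "0 < dx" "0 < dy" "\<And>x. 0 \<le> \<rho> x"
  shows "0 \<le> cell_average dx dy \<rho> i j"
  unfolding cell_average_def set_lebesgue_integral_def
  using assms by (intro mult_nonneg_nonneg integral_nonneg_AE) auto

text \<open>The cells are disjoint, so finitely many cell integrals add up to at most the whole integral.\<close>

lemma cell_average_mass:
  assumes dx: "0 < dx" "0 < dy" and nn: "\<And>x. 0 \<le> \<rho> x" and int: "integrable lebesgue \<rho>"
  shows "grid_mass dx dy (cell_average dx dy \<rho>) \<le> L1 \<rho>"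
proof -
  let ?c = "\<lambda>p. cell dx dy (fst p) (snd p)"
  have m: "?c p \<in> sets lebesgue" for p using cell_measurable by (auto intro: sets_completionI_sets)
  have cell_int: "ennreal (dx * dy * \<bar>cell_average dx dy \<rho> i j\<bar>) = (\<integral>\<^sup>+z. ennreal (\<rho> z) * indicator (?c (i, j)) z \<partial>lebesgue)"
    for i j
  proof -
    have "dx * dy * \<bar>cell_average dx dy \<rho> i j\<bar> = (LINT z|lebesgue. indicator (?c (i, j)) z *\<^sub>R \<rho> z)"
      unfolding abs_of_nonneg[OF cell_average_nonneg[OF dx nn]] using dx
      by (simp add: cell_average_def set_lebesgue_integral_def)
    also have "ennreal \<dots> = (\<integral>\<^sup>+z. ennreal (indicator (?c (i, j)) z *\<^sub>R \<rho> z) \<partial>lebesgue)"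
      by (rule nn_integral_eq_integral[OF integrable_mult_indicator[OF m int], symmetric]) (simp add: nn)
    also have "\<dots> = (\<integral>\<^sup>+z. ennreal (\<rho> z) * indicator (?c (i, j)) z \<partial>lebesgue)"
      by (rule nn_integral_cong) (auto split: split_indicator)
    finally show ?thesis .
  qed
  have fin: "(\<Sum>p\<in>F. \<integral>\<^sup>+z. ennreal (\<rho> z) * indicator (?c p) z \<partial>lebesgue) \<le> L1 \<rho>" if F: "finite F" for F
  proof -
    have disj: "disjoint_family_on ?c F"
      using cell_disjoint[OF dx] by (fastforce simp: disjoint_family_on_def)
    have "(\<Sum>p\<in>F. \<integral>\<^sup>+z. ennreal (\<rho> z) * indicator (?c p) z \<partial>lebesgue)
        = (\<integral>\<^sup>+z. (\<Sum>p\<in>F. ennreal (\<rho> z) * indicator (?c p) z) \<partial>lebesgue)"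
      by (rule nn_integral_sum[symmetric]) (use m int in measurable)
    also have "\<dots> = (\<integral>\<^sup>+z. ennreal (\<rho> z) * indicator (\<Union>p\<in>F. ?c p) z \<partial>lebesgue)"
      by (simp add: sum_distrib_left[symmetric] indicator_UN_disjoint[OF F disj])
    also have "\<dots> \<le> (\<integral>\<^sup>+z. ennreal (norm (\<rho> z)) \<partial>lebesgue)"
      by (rule nn_integral_mono) (auto simp: nn split: split_indicator)
    finally show ?thesis unfolding L1_def .
  qed
  have "grid_mass dx dy (cell_average dx dy \<rho>)
      = (\<Sum>\<^sub>\<infinity>p\<in>UNIV. \<integral>\<^sup>+z. ennreal (\<rho> z) * indicator (?c p) z \<partial>lebesgue)"
    unfolding grid_mass_def grid_sum_def by (rule infsum_cong) (auto simp: cell_int)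
  also have "\<dots> \<le> L1 \<rho>"
    by (subst nonneg_infsum_complete) (auto intro!: SUP_least fin)
  finally show ?thesis .
qed

section \<open>The scheme as a one-step map\<close>

lemma roe_flux_pos_neg: "a * x + min 0 a * (y - x) = pos a * x + neg a * y"
proof -
  have "a * x = pos a * x + neg a * x" by (simp only: pos_add_neg flip: distrib_right)
  then show ?thesis unfolding neg_def[symmetric] right_diff_distrib by linarith
qed

definition edge_v where
  "edge_v dx dy v k \<alpha> \<beta> i j = v (gridpt dx dy (of_int i + \<alpha>) (of_int j + \<beta>)) $ k"
  for v :: "real^2 \<Rightarrow> real^2" and \<alpha> \<beta> :: real and i j :: int

definition edge_J where
  "edge_J dx dy \<epsilon> \<eta> r k \<alpha> \<beta> i j = J_term dx dy \<epsilon> \<eta> r k (of_int i + \<alpha>) (of_int j + \<beta>)"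
  for \<alpha> \<beta> :: real and i j :: int

lemma roe_Suc:
  assumes r_def: "r = roe dx dy dt \<epsilon> v f \<eta> \<rho>\<^sub>o n"
  shows "roe dx dy dt \<epsilon> v f \<eta> \<rho>\<^sub>o (Suc n) = roe_step (dt / dx) (dt / dy)
     (edge_v dx dy v 1 (1/2) 0) (edge_J dx dy \<epsilon> \<eta> r 1 (1/2) 0)
     (edge_v dx dy v 2 0 (1/2)) (edge_J dx dy \<epsilon> \<eta> r 2 0 (1/2)) f r"
proof (intro ext)
  fix i j
  have half: "real_of_int i - 1 + 1/2 = real_of_int i - 1/2" for i :: int by simp
  show "roe dx dy dt \<epsilon> v f \<eta> \<rho>\<^sub>o (Suc n) i j = roe_step (dt / dx) (dt / dy)
     (edge_v dx dy v 1 (1/2) 0) (edge_J dx dy \<epsilon> \<eta> r 1 (1/2) 0)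
     (edge_v dx dy v 2 0 (1/2)) (edge_J dx dy \<epsilon> \<eta> r 2 0 (1/2)) f r i j"
    unfolding roe.simps r_def[symmetric] Let_def y_step_def x_step_def V_flux_def F_flux_def roe_flux_pos_neg
      roe_step_def upwind_def edge_v_def edge_J_def of_int_diff of_int_1 half add_0_right diff_add_cancel
    by (simp add: algebra_simps)
qed

section \<open>Numerical inequalities\<close>

text \<open>From \<open>exp 1 \<ge> 5/2\<close> and the slope of the exponential function.\<close>

lemma exp_ge_linear:
  fixes k :: real
  assumes "1 \<le> k"
  shows "25 / 4 * k \<le> exp (2 * k)" "625 / 16 * k \<le> exp (4 * k)"
proof -
  have e1: "5 / 2 \<le> exp (1 :: real)"
    using exp_lower_Taylor_quadratic[of "1 :: real"] by simp
  have e2: "25 / 4 \<le> exp (2 :: real)"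
    using power_mono[OF e1, of 2] exp_of_nat_mult[of 2 "1 :: real"] by (simp add: power2_eq_square)
  have e4: "625 / 16 \<le> exp (4 :: real)"
    using power_mono[OF e1, of 4] exp_of_nat_mult[of 4 "1 :: real"] by (simp add: eval_nat_numeral)
  have k: "k \<le> exp (c * (k - 1))" if "1 \<le> c" for c
  proof -
    have "k = 1 + 1 * (k - 1)" by simp
    also have "\<dots> \<le> 1 + c * (k - 1)" using that assms by (intro add_left_mono mult_right_mono) auto
    also have "\<dots> \<le> exp (c * (k - 1))" by (rule exp_ge_add_one_self)
    finally show ?thesis .
  qed
  have "25 / 4 * k \<le> exp 2 * exp (2 * (k - 1))"
    using e2 k[of 2] assms by (intro mult_mono) auto
  then show "25 / 4 * k \<le> exp (2 * k)" by (simp add: exp_add[symmetric])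
  have "625 / 16 * k \<le> exp 4 * exp (4 * (k - 1))"
    using e4 k[of 4] assms by (intro mult_mono) auto
  then show "625 / 16 * k \<le> exp (4 * k)" by (simp add: exp_add[symmetric])
qed

text \<open>The mass may grow by the factor \<open>5/3\<close> per step, its square by \<open>25/9\<close>; the right-hand side
  grows at least by \<open>exp 2\<close> per step, and it is one step ahead because \<open>m < n\<close>.\<close>

lemma excess_le:
  fixes x s L E :: real
  assumes x: "0 \<le> x" "0 \<le> s" "1 \<le> L" and big: "1 / 6 \<le> x + s"
    and E: "E = exp (2 * (6 * (x + L * s)))" and m: "1 \<le> m" "m < n"
  shows "2 * (x + s * (5 / 3) ^ m) * (5 / 3) ^ m * (x + L * s) \<le> (3 / 4 * x\<^sup>2 + 3 * L * s\<^sup>2) * (E ^ n - 1)"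
proof -
  define y where "y = x + L * s"
  have sy: "x + s \<le> y" using mult_right_mono[OF x(3,2)] by (simp add: y_def)
  have k: "1 \<le> 6 * y" using sy big by simp
  (* E ^ 2 = exp (4 * k) with k = 6 * y \<ge> 1 and 625 / 16 - 1 \<ge> 38, and 228 = 38 * 6 *)
  have E2: "228 * y \<le> E\<^sup>2 - 1"
  proof -
    have "E\<^sup>2 = exp (4 * (6 * y))" unfolding E y_def by (simp add: power2_eq_square exp_add[symmetric])
    then show ?thesis using exp_ge_linear(2)[OF k] k by simp
  qed
  have E1: "25 / 9 \<le> E" using exp_ge_linear(1)[OF k] k unfolding E y_def by simp
  define r :: real where "r = (25 / 9) ^ (m - 1)"
  have r: "1 \<le> r" unfolding r_def by (rule one_le_power) simp
  have rm: "((5 / 3) ^ m)\<^sup>2 = 25 / 9 * r"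
    using m unfolding r_def by (cases m) (simp_all add: power2_eq_square power_mult_distrib[symmetric])
  have pm: "1 \<le> (5 / 3 :: real) ^ m" by (rule one_le_power) simp
  have "r * (228 * y) \<le> r * (E\<^sup>2 - 1)" using E2 r by (intro mult_left_mono) auto
  also have "\<dots> \<le> E ^ (m - 1) * E\<^sup>2 - 1"
  proof -
    have "r * E\<^sup>2 \<le> E ^ (m - 1) * E\<^sup>2" unfolding r_def using E1 by (intro mult_right_mono power_mono) auto
    then show ?thesis using r by (simp add: right_diff_distrib)
  qed
  also have "E ^ (m - 1) * E\<^sup>2 = E ^ (m + 1)" using m by (simp flip: power_add)
  also have "E ^ (m + 1) - 1 \<le> E ^ n - 1" using E1 m power_increasing[of "m + 1" n E] by simp
  finally have En: "r * (228 * y) \<le> E ^ n - 1" .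
  have "2 * (x + s * (5 / 3) ^ m) * (5 / 3) ^ m * y \<le> 2 * ((x + s) * (5 / 3) ^ m) * (5 / 3) ^ m * y"
  proof -
    have "x * 1 \<le> x * (5 / 3) ^ m" using pm x by (intro mult_left_mono)
    then have "x + s * (5 / 3) ^ m \<le> (x + s) * (5 / 3) ^ m" by (simp add: distrib_right)
    then show ?thesis using k pm by (intro mult_right_mono) auto
  qed
  also have "\<dots> = (50 / 9 * (x + s)) * (r * y)"
  proof -
    have "2 * ((x + s) * (5 / 3) ^ m) * (5 / 3) ^ m * y = 2 * (x + s) * y * ((5 / 3) ^ m)\<^sup>2"
      by (simp add: power2_eq_square)
    also have "\<dots> = (50 / 9 * (x + s)) * (r * y)" unfolding rm by simp
    finally show ?thesis .
  qed
  also have "\<dots> \<le> ((3 / 4 * x\<^sup>2 + 3 * L * s\<^sup>2) * 228) * (r * y)"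
  proof (rule mult_right_mono)
    have "0 \<le> (x - s)\<^sup>2" by simp
    then have "(x + s)\<^sup>2 \<le> 2 * x\<^sup>2 + 2 * s\<^sup>2" by (simp add: power2_eq_square algebra_simps)
    moreover have "x + s \<le> 6 * (x + s)\<^sup>2"
    proof -
      have "(x + s) * 1 \<le> (x + s) * (6 * (x + s))" using big x by (intro mult_left_mono) auto
      then show ?thesis by (simp only: power2_eq_square mult_1_right mult.left_commute[of "x + s" 6])
    qed
    moreover have "1 * s\<^sup>2 \<le> L * s\<^sup>2" using x by (intro mult_right_mono) auto
    moreover have "0 \<le> x\<^sup>2" "0 \<le> s\<^sup>2" by simp_all
    moreover have "(3 / 4 * x\<^sup>2 + 3 * L * s\<^sup>2) * 228 = 171 * x\<^sup>2 + 684 * (L * s\<^sup>2)" by simp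
    moreover have "50 / 9 * w \<le> 171 * a + 684 * b"
      if "p \<le> 2 * a + 2 * c" "w \<le> 6 * p" "1 * c \<le> b" "0 \<le> a" "0 \<le> c" for a b c p w :: real
    proof -
      have "w \<le> 12 * a + 12 * b" using that by linarith
      then have "50 / 9 * w \<le> 50 / 9 * (12 * a + 12 * b)" by (rule mult_left_mono) simp
      also have "\<dots> = 200 / 3 * a + 200 / 3 * b" by simp
      also have "\<dots> \<le> 171 * a + 684 * b" using that by (intro add_mono mult_right_mono) auto
      finally show ?thesis .
    qed
    ultimately show "50 / 9 * (x + s) \<le> (3 / 4 * x\<^sup>2 + 3 * L * s\<^sup>2) * 228"
      by metis
  qed (use r k in simp)
  also have "\<dots> = (3 / 4 * x\<^sup>2 + 3 * L * s\<^sup>2) * (r * (228 * y))" by simp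
  also have "\<dots> \<le> (3 / 4 * x\<^sup>2 + 3 * L * s\<^sup>2) * (E ^ n - 1)"
    using En x by (intro mult_left_mono) auto
  finally show ?thesis unfolding y_def .
qed

section \<open>Estimates for the approximate solution\<close>

lemma grid_C2_bounded:
  assumes "grid_C2 dx dy D W a" "\<And>i j. \<bar>a i j\<bar> \<le> e" "2 * e \<le> dx * G" "2 * e \<le> dy * G"
  shows "grid_C2 dx dy G W a"
proof -
  have "\<bar>a i j - a i' j'\<bar> \<le> 2 * e" for i j i' j' using assms(2)[of i j] assms(2)[of i' j'] by linarith
  then show ?thesis using assms(1,3,4) unfolding grid_C2_def by (meson order_trans)
qed

text \<open>The constants of the theorem as real numbers, for data for which all of them are finite. The
  bounds \<open>V1\<close> and \<open>V2\<close> of the components enter the CFL condition, the bound \<open>V\<close> of the field enters the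
  estimate.\<close>

locale nonlocal_scheme =
  fixes \<epsilon> \<rho>max dx dy dt :: real and v :: "real^2 \<Rightarrow> real^2" and H :: "real \<Rightarrow> real"
    and \<eta> \<rho>\<^sub>o :: "real^2 \<Rightarrow> real" and M D W V V1 V2 L N2 N3 :: real and f :: "real \<Rightarrow> real"
  assumes pos: "0 < \<epsilon>" "0 < dx" "0 < dy" "0 < dt"
    and v: "C_diff_vec 2 v" and H: "smooth_heaviside H" and f: "f = flux_fun H \<rho>max"
    and \<eta>: "C_W_inf 3 \<eta>"
    and \<rho>\<^sub>o: "integrable lebesgue \<rho>\<^sub>o" "\<And>x. 0 \<le> \<rho>\<^sub>o x"
    and nn: "0 \<le> M" "0 \<le> D" "0 \<le> W" "0 \<le> V" "0 \<le> L" "0 \<le> N2" "0 \<le> N3"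
    and M: "L1 \<rho>\<^sub>o = ennreal M" and D: "Linf (grad_norm_vec 1 v) = ennreal D"
    and W: "Linf (grad_norm_vec 2 v) = ennreal W" and V: "Linf v = ennreal V"
    and L: "Linf (deriv f) = ennreal L"
    and N2: "Linf (grad_norm 2 \<eta>) = ennreal N2" and N3: "Linf (grad_norm 3 \<eta>) = ennreal N3"
    and V12: "\<And>x. \<bar>v x $ 1\<bar> \<le> V1" "\<And>x. \<bar>v x $ 2\<bar> \<le> V2"
    and cfl: "dt / dx * (V1 + \<epsilon> * L) \<le> 1 / 3" "dt / dy * (V2 + \<epsilon> * L) \<le> 1 / 3"
begin

abbreviation sol :: "nat \<Rightarrow> int \<Rightarrow> int \<Rightarrow> real" where
  "sol \<equiv> roe dx dy dt \<epsilon> v f \<eta> \<rho>\<^sub>o"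

abbreviation a1 where "a1 \<equiv> edge_v dx dy v 1 (1/2) 0"
abbreviation a2 where "a2 \<equiv> edge_v dx dy v 2 0 (1/2)"
abbreviation b1 where "b1 r \<equiv> edge_J dx dy \<epsilon> \<eta> r 1 (1/2) 0"
abbreviation b2 where "b2 r \<equiv> edge_J dx dy \<epsilon> \<eta> r 2 0 (1/2)"

definition k1 where "k1 = 6 * (D + 2 * \<epsilon> * L * N2 * M)"
definition k2 where "k2 = (4 * \<epsilon> * (2 * N3 * M + 3 * N2\<^sup>2 * M\<^sup>2) + 3 * W) * M"
definition E where "E = exp (2 * dt * k1)"

text \<open>Growth factor of the mass. It is 1 where the edge values change so little over a mesh width
  that no cell loses more than its content in one step.\<close>

definition q :: real where "q = (if dt * (D + 2 * \<epsilon> * N2 * M) \<le> 1 / 6 then 1 else 5 / 3)"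

lemma L_ge_1: "1 \<le> L"
  using flux_fun_lipschitz_ge_1[OF H, of \<rho>max L] L nn unfolding f by simp

lemma f_bounds: "\<bar>f x\<bar> \<le> \<bar>x\<bar>" "\<bar>f x - f y\<bar> \<le> L * \<bar>x - y\<bar>"
  using flux_fun_abs_le[OF H] flux_fun_lipschitz[OF H, of \<rho>max L] L nn unfolding f by simp_all

lemma f_slope:
  obtains t where "f x - f y = t * (x - y)" "\<bar>t\<bar> \<le> L" "0 \<le> x \<and> 0 \<le> y \<longrightarrow> 0 \<le> t"
  using flux_fun_slope[OF H, of \<rho>max L x y] L nn unfolding f by (metis order_refl)

lemma edge_a_bounds: "\<bar>a1 i j\<bar> \<le> V1" "\<bar>a2 i j\<bar> \<le> V2" "\<bar>a1 i j\<bar> \<le> V" "\<bar>a2 i j\<bar> \<le> V"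
proof -
  have "norm (v x) \<le> V" for x
    using norm_le_Linf[OF C_diff_vec_continuous[OF v], of x] V nn by simp
  then have "\<bar>v x $ k\<bar> \<le> V" for x k using component_le_norm_cart[of "v x" k] order_trans by blast
  then show "\<bar>a1 i j\<bar> \<le> V" "\<bar>a2 i j\<bar> \<le> V" unfolding edge_v_def by simp_all
qed (simp_all add: edge_v_def V12)

lemma edge_b_bounds: "\<bar>b1 r i j\<bar> \<le> \<epsilon>" "\<bar>b2 r i j\<bar> \<le> \<epsilon>"
  unfolding edge_J_def using abs_J_term_le[of \<epsilon>] pos by simp_all

lemma grid_C2_edge_a: "grid_C2 dx dy D W a1" "grid_C2 dx dy D W a2"
proof -
  have C: "C_diff 2 (\<lambda>x. v x $ k)" for k using v by (auto simp: C_diff_vec_def)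
  have "grid_C2 dx dy D W (edge_v dx dy v k \<alpha> \<beta>)" for k \<alpha> \<beta>
    unfolding edge_v_def
  proof (rule grid_C2_sample)
    show "pdiff (\<lambda>x. v x $ k)" using C_diff_pdiff[OF C, of "[]"] by simp
    show "pdiff (pd l (\<lambda>x. v x $ k))" for l using C_diff_pdiff[OF C, of "[l]"] by simp
    show "\<bar>pd l (\<lambda>x. v x $ k) x\<bar> \<le> D" for l x
      using abs_pd_vec_le_Linf[OF v, of "[l]" D] D nn by simp
    show "\<bar>pd l' (pd l (\<lambda>x. v x $ k)) x\<bar> \<le> W" for l l' x
      using abs_pd_vec_le_Linf[OF v, of "[l', l]" W] W nn by (simp add: numeral_2_eq_2)
  qed (use pos in auto)
  then show "grid_C2 dx dy D W a1" "grid_C2 dx dy D W a2" by simp_all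
qed

lemma grid_C2_edge_b:
  assumes "grid_mass dx dy r \<le> ennreal m" "0 \<le> m"
  shows "grid_C2 dx dy (\<epsilon> * (2 * (m * N2))) (\<epsilon> * (2 * (m * N3) + 6 * (m * N2)\<^sup>2)) (b1 r)"
    "grid_C2 dx dy (\<epsilon> * (2 * (m * N2))) (\<epsilon> * (2 * (m * N3) + 6 * (m * N2)\<^sup>2)) (b2 r)"
  unfolding edge_J_def
  by (rule grid_C2_J_term[OF _ _ _ _ _ _ \<eta> _ _ assms(1)]; use pos nn assms N2 N3 in simp)+

lemma q_ge_1: "1 \<le> q" and q_cases: "q = 1 \<or> q = 5 / 3"
  unfolding q_def by auto

subsection \<open>Mass and positivity\<close>

text \<open>At most \<open>2/3\<close> of a cell leaves it through edges at which the edge values on both sides have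
  the same sign; a change of sign over the cell adds at most the variation of the edge values. In
  any case the outflow is at most \<open>4/3\<close>.\<close>

lemma outflow_bounds:
  assumes r: "grid_mass dx dy r \<le> ennreal m" "0 \<le> m" and h: "\<And>i j. 0 \<le> h i j" "\<And>i j. h i j \<le> 1"
  defines "c \<equiv> outflow (dt / dx) (dt / dy) a1 (b1 r) a2 (b2 r) h"
  shows "0 \<le> c i j" "c i j \<le> 4 / 3" "c i j \<le> 2 / 3 + 2 * (dt * (D + \<epsilon> * (2 * (m * N2))))"
proof -
  let ?G = "\<epsilon> * (2 * (m * N2))"
  have eL: "\<epsilon> \<le> \<epsilon> * L" using L_ge_1 pos by simp
  have lx: "0 < dt / dx" "0 < dt / dy" using pos by simp_all
  have part: "pos a - neg a' + (pos b - neg b') * hh \<le> 2 * (V' + \<epsilon>)"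
    "pos a - neg a' + (pos b - neg b') * hh \<le> V' + \<epsilon> + k * (D + ?G)"
    "0 \<le> pos a - neg a' + (pos b - neg b') * hh"
    if "\<bar>a\<bar> \<le> V'" "\<bar>a'\<bar> \<le> V'" "\<bar>b\<bar> \<le> \<epsilon>" "\<bar>b'\<bar> \<le> \<epsilon>" "\<bar>a - a'\<bar> \<le> k * D" "\<bar>b - b'\<bar> \<le> k * ?G" "0 \<le> hh" "hh \<le> 1"
    for a a' b b' hh V' k
  proof -
    have two: "pos a - neg a' \<le> 2 * V'" "pos a - neg a' \<le> V' + \<delta>"
      if "\<bar>a\<bar> \<le> V'" "\<bar>a'\<bar> \<le> V'" "\<bar>a - a'\<bar> \<le> \<delta>" for a a' V' \<delta>
      using that by (auto simp: pos_def neg_def)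
    have b0: "0 \<le> pos b - neg b'" using neg_nonpos[of b'] pos_nonneg[of b] by linarith
    have "(pos b - neg b') * hh \<le> (pos b - neg b') * 1" using that b0 by (intro mult_left_mono)
    then show "pos a - neg a' + (pos b - neg b') * hh \<le> 2 * (V' + \<epsilon>)"
      "pos a - neg a' + (pos b - neg b') * hh \<le> V' + \<epsilon> + k * (D + ?G)"
      using two[OF that(1,2,5)] two[OF that(3,4,6)] by (simp_all add: algebra_simps)
    show "0 \<le> pos a - neg a' + (pos b - neg b') * hh"
      using b0 that neg_nonpos[of a'] pos_nonneg[of a] by (intro add_nonneg_nonneg mult_nonneg_nonneg) linarith+
  qed
  define X where "X = pos (a1 i j) - neg (a1 (i - 1) j) + (pos (b1 r i j) - neg (b1 r (i - 1) j)) * h i j"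
  define Y where "Y = pos (a2 i j) - neg (a2 i (j - 1)) + (pos (b2 r i j) - neg (b2 r i (j - 1))) * h i j"
  have c: "c i j = dt / dx * X + dt / dy * Y"
    unfolding c_def outflow_def X_def Y_def by (simp add: algebra_simps)
  note Cb = grid_C2_edge_b[OF r]
  have X: "X \<le> 2 * (V1 + \<epsilon>)" "X \<le> V1 + \<epsilon> + dx * (D + ?G)" "0 \<le> X" unfolding X_def
    using part[where V' = V1 and a = "a1 i j" and a' = "a1 (i - 1) j" and b = "b1 r i j" and b' = "b1 r (i - 1) j" and k = dx and hh = "h i j"]
      edge_a_bounds edge_b_bounds
      grid_C2D(1)[OF grid_C2_edge_a(1), of "i - 1" j] grid_C2D(1)[OF Cb(1), of "i - 1" j] h by simp_all
  have Y: "Y \<le> 2 * (V2 + \<epsilon>)" "Y \<le> V2 + \<epsilon> + dy * (D + ?G)" "0 \<le> Y" unfolding Y_def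
    using part[where V' = V2 and a = "a2 i j" and a' = "a2 i (j - 1)" and b = "b2 r i j" and b' = "b2 r i (j - 1)" and k = dy and hh = "h i j"]
      edge_a_bounds edge_b_bounds
      grid_C2D(2)[OF grid_C2_edge_a(2), of i "j - 1"] grid_C2D(2)[OF Cb(2), of i "j - 1"] h by simp_all
  have cx: "dt / dx * (V1 + \<epsilon>) \<le> 1 / 3"
    by (rule order_trans[OF mult_left_mono cfl(1)]) (use lx eL in auto)
  have cy: "dt / dy * (V2 + \<epsilon>) \<le> 1 / 3"
    by (rule order_trans[OF mult_left_mono cfl(2)]) (use lx eL in auto)
  show "0 \<le> c i j" unfolding c
    by (intro add_nonneg_nonneg mult_nonneg_nonneg X(3) Y(3) less_imp_le[OF lx(1)] less_imp_le[OF lx(2)])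
  have "dt / dx * X \<le> dt / dx * (2 * (V1 + \<epsilon>))" "dt / dy * Y \<le> dt / dy * (2 * (V2 + \<epsilon>))"
    by (intro mult_left_mono X(1) Y(1) less_imp_le[OF lx(1)] less_imp_le[OF lx(2)])+
  moreover have "dt / dx * (2 * (V1 + \<epsilon>)) = 2 * (dt / dx * (V1 + \<epsilon>))"
    "dt / dy * (2 * (V2 + \<epsilon>)) = 2 * (dt / dy * (V2 + \<epsilon>))" by simp_all
  ultimately show "c i j \<le> 4 / 3" unfolding c using cx cy by linarith
  have "dt / dx * X \<le> dt / dx * (V1 + \<epsilon> + dx * (D + ?G))" "dt / dy * Y \<le> dt / dy * (V2 + \<epsilon> + dy * (D + ?G))"
    by (intro mult_left_mono X(2) Y(2) less_imp_le[OF lx(1)] less_imp_le[OF lx(2)])+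
  moreover have "dt / dx * (V1 + \<epsilon> + dx * (D + ?G)) = dt / dx * (V1 + \<epsilon>) + dt * (D + ?G)"
    "dt / dy * (V2 + \<epsilon> + dy * (D + ?G)) = dt / dy * (V2 + \<epsilon>) + dt * (D + ?G)"
    using pos by (simp_all add: distrib_left)
  ultimately show "c i j \<le> 2 / 3 + 2 * (dt * (D + ?G))" unfolding c using cx cy by linarith
qed

lemma mass_growth:
  "grid_mass dx dy (sol n) \<le> ennreal (q ^ n * M) \<and> (q = 1 \<longrightarrow> (\<forall>i j. 0 \<le> sol n i j))"
proof (induction n)
  case 0
  show ?case using cell_average_mass[of dx dy \<rho>\<^sub>o] cell_average_nonneg[of dx dy \<rho>\<^sub>o] pos \<rho>\<^sub>o M by simp
next
  case (Suc n)
  let ?r = "sol n"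
  define h where "h i j = H (?r i j - \<rho>max)" for i j
  have h: "0 \<le> h i j" "h i j \<le> 1" for i j
    unfolding h_def using smooth_heaviside_bounds[OF H] by simp_all
  have fh: "f (?r i j) = h i j * ?r i j" for i j unfolding f flux_fun_def h_def by simp
  let ?c = "outflow (dt / dx) (dt / dy) a1 (b1 ?r) a2 (b2 ?r) h"
  have m: "grid_mass dx dy ?r \<le> ennreal (q ^ n * M)" "0 \<le> q ^ n * M"
    using Suc q_ge_1 nn by simp_all
  note c = outflow_bounds[where h = h, OF m h]
  have c1: "?c i j \<le> 1" if "q = 1" for i j
  proof -
    have "dt * (D + 2 * \<epsilon> * N2 * M) \<le> 1 / 6" using that unfolding q_def by (auto split: if_splits)
    moreover have "?c i j \<le> 2 / 3 + 2 * (dt * (D + 2 * \<epsilon> * N2 * M))"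
      using c(3)[of i j] that by (simp add: mult_ac)
    ultimately show ?thesis by linarith
  qed
  have eq: "sol (Suc n) = roe_step (dt / dx) (dt / dy) a1 (b1 ?r) a2 (b2 ?r) f ?r"
    by (rule roe_Suc[OF refl])
  have l: "0 \<le> dt / dx" "0 \<le> dt / dy" using pos by simp_all
  have "\<bar>1 - ?c i j\<bar> + ?c i j \<le> q" for i j
    using q_cases c1[of i j] c(2)[of i j] q_ge_1 by (auto simp: abs_if)
  from roe_step_mass[where f = f and h = h, OF fh h(1) l this]
  have "grid_sum (\<lambda>i j. \<bar>sol (Suc n) i j\<bar>) \<le> ennreal q * grid_sum (\<lambda>i j. \<bar>?r i j\<bar>)"
    unfolding eq by simp
  then have "grid_mass dx dy (sol (Suc n)) \<le> ennreal (dx * dy) * (ennreal q * grid_sum (\<lambda>i j. \<bar>?r i j\<bar>))"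
    unfolding grid_mass_eq[OF less_imp_le less_imp_le, OF pos(2,3)] by (rule mult_left_mono) simp
  also have "\<dots> = ennreal q * grid_mass dx dy ?r"
    unfolding grid_mass_eq[OF less_imp_le less_imp_le, OF pos(2,3)] by (simp add: mult.left_commute)
  also have "\<dots> \<le> ennreal q * ennreal (q ^ n * M)" using m by (intro mult_left_mono) auto
  also have "\<dots> = ennreal (q ^ Suc n * M)" using q_ge_1 nn by (simp add: ennreal_mult[symmetric] mult.assoc)
  finally have "grid_mass dx dy (sol (Suc n)) \<le> ennreal (q ^ Suc n * M)" .
  moreover have "0 \<le> sol (Suc n) i j" if "q = 1" for i j
    unfolding eq using Suc that
    by (intro roe_step_nonneg[where h = h] fh h l c1) auto
  ultimately show ?case by blast
qed

lemma q_power_nonneg: "0 \<le> q ^ n"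
  using one_le_power[OF q_ge_1, of n] by simp

lemma mass_le: "grid_mass dx dy (sol n) \<le> ennreal (q ^ n * M)" and mass_bound_nonneg: "0 \<le> q ^ n * M"
  and sol_nonneg: "q = 1 \<Longrightarrow> 0 \<le> sol n i j"
  using mass_growth[of n] q_ge_1 nn by auto

subsection \<open>Total variation\<close>

lemma k1_nonneg: "0 \<le> k1" and k2_nonneg: "0 \<le> k2"
  unfolding k1_def k2_def using nn pos by (auto intro!: add_nonneg_nonneg mult_nonneg_nonneg)

lemma rough_case:
  assumes "q \<noteq> 1"
  shows "q = 5 / 3" "1 / 6 \<le> dt * D + 2 * dt * \<epsilon> * N2 * M" "1 \<le> dt * k1"
    "dt * k1 = 6 * (dt * D + L * (2 * dt * \<epsilon> * N2 * M))"
proof -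
  show "q = 5 / 3" using assms q_cases by blast
  show s: "1 / 6 \<le> dt * D + 2 * dt * \<epsilon> * N2 * M"
    using assms unfolding q_def by (auto split: if_splits simp: algebra_simps)
  show eq: "dt * k1 = 6 * (dt * D + L * (2 * dt * \<epsilon> * N2 * M))"
    unfolding k1_def by (simp add: algebra_simps)
  have "1 * (2 * dt * \<epsilon> * N2 * M) \<le> L * (2 * dt * \<epsilon> * N2 * M)"
    using L_ge_1 pos nn by (intro mult_right_mono) auto
  then show "1 \<le> dt * k1" unfolding eq using s by simp
qed

lemma E_eq: "E = exp (2 * (dt * k1))" unfolding E_def by (simp add: mult.assoc)

lemma E_ge_1: "1 \<le> E"
  unfolding E_eq using k1_nonneg pos by simp

text \<open>One step multiplies a source that is cubic in the mass by \<open>q ^ 3\<close>. The gap to \<open>E\<close> makes the sum of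
  all sources, each amplified by \<open>E\<close> in the later steps, a telescoping one.\<close>

lemma E_minus_q3: "dt * k1 \<le> E - q ^ 3"
proof (cases "q = 1")
  case True
  have "1 + 2 * (dt * k1) \<le> E" unfolding E_eq by (rule exp_ge_add_one_self)
  moreover have "0 \<le> dt * k1" using k1_nonneg pos by simp
  ultimately show ?thesis using True by simp
next
  case False
  have "q ^ 3 = 125 / 27" unfolding rough_case(1)[OF False] by (simp add: eval_nat_numeral)
  then show ?thesis using exp_ge_linear(1)[OF rough_case(3)[OF False]] rough_case(3)[OF False]
    unfolding E_eq by simp
qed

text \<open>In the smooth regime the discrete solution is nonnegative, so that \<open>f\<close> is increasing on its
  values and the transport part of the scheme does not increase the variation. In the rough
  regime both the slope of \<open>f\<close> may be negative and the gradient of the non-local term may have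
  grown with the mass; but the oscillation of the non-local term over one mesh never exceeds
  \<open>2 * \<epsilon>\<close>, and \<open>E\<close> is so large that this crude bound is sufficient.\<close>

lemma TV_step:
  "grid_TV dx dy (sol (Suc n)) \<le> ennreal E * grid_TV dx dy (sol n) + ennreal (2 * dt * k2 * q ^ (3 * n))"
proof -
  let ?r = "sol n"
  let ?m = "q ^ n * M"
  define Q where "Q = \<epsilon> * (2 * (?m * N3) + 6 * (?m * N2)\<^sup>2)"
  (* 7/3 = 1 + 2 * (2/3), where 2/3 is the sum of the two CFL bounds; the second value of G is the
     largest slope over one mesh that an oscillation 2 * \<epsilon> can have under the CFL condition *)
  define \<mu> :: real where "\<mu> = (if q = 1 then 1 else 7 / 3)"
  define G where "G = (if q = 1 then \<epsilon> * (2 * (?m * N2)) else 2 / (3 * dt * L))"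
  have L1: "1 \<le> L" by (rule L_ge_1)
  have qn: "1 \<le> q ^ n" using q_ge_1 by (rule one_le_power)
  have qn0: "0 \<le> q ^ n" using qn by linarith
  have Q0: "0 \<le> Q" unfolding Q_def using pos nn qn0 by (intro mult_nonneg_nonneg add_nonneg_nonneg) auto
  have G0: "0 \<le> G" unfolding G_def using pos nn qn0 L1 by auto
  have l: "0 < dt / dx" "0 < dt / dy" using pos by simp_all
  have V: "0 \<le> V1" "0 \<le> V2" using V12[of 0] by linarith+
  have cap: "2 * \<epsilon> \<le> h * (2 / (3 * dt * L))" if "0 < h" "dt / h * (V' + \<epsilon> * L) \<le> 1 / 3" "0 \<le> V'" for h V'
  proof -
    have "dt / h * (\<epsilon> * L) \<le> dt / h * (V' + \<epsilon> * L)" using that pos by (intro mult_left_mono) auto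
    then have "dt / h * (\<epsilon> * L) \<le> 1 / 3" using that by linarith
    then show ?thesis using that pos L1 by (simp add: field_simps)
  qed
  have b: "grid_C2 dx dy G Q (b1 ?r)" "grid_C2 dx dy G Q (b2 ?r)"
  proof -
    note C = grid_C2_edge_b[OF mass_le mass_bound_nonneg, of n]
    have "grid_C2 dx dy G Q (b1 ?r) \<and> grid_C2 dx dy G Q (b2 ?r)"
    proof (cases "q = 1")
      case True
      then have G: "G = \<epsilon> * (2 * (?m * N2))" unfolding G_def by (rule if_P)
      show ?thesis unfolding G Q_def by (intro conjI C)
    next
      case False
      then have G: "G = 2 / (3 * dt * L)" unfolding G_def by (rule if_not_P)
      show ?thesis unfolding G Q_def
        by (intro conjI grid_C2_bounded[OF C(1) edge_b_bounds(1)] grid_C2_bounded[OF C(2) edge_b_bounds(2)]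
            cap[OF pos(2) cfl(1) V(1)] cap[OF pos(3) cfl(2) V(2)])
    qed
    then show "grid_C2 dx dy G Q (b1 ?r)" "grid_C2 dx dy G Q (b2 ?r)" by simp_all
  qed
  have spread: "\<exists>t. f (?r i' j') - f (?r i j) = t * (?r i' j' - ?r i j) \<and>
      spread (dt / dx) (dt / dy) (a1 i j) (b1 ?r i j) (a2 i j) (b2 ?r i j) t \<le> \<mu>" for i j i' j'
  proof -
    obtain t where t: "f (?r i' j') - f (?r i j) = t * (?r i' j' - ?r i j)" "\<bar>t\<bar> \<le> L"
      "0 \<le> ?r i' j' \<and> 0 \<le> ?r i j \<longrightarrow> 0 \<le> t" by (rule f_slope[of "?r i' j'" "?r i j"])
    define s where "s u = dt / dx * (\<bar>a1 i j\<bar> + \<bar>b1 ?r i j\<bar> * u) + dt / dy * (\<bar>a2 i j\<bar> + \<bar>b2 ?r i j\<bar> * u)" for u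
    have s_le: "\<bar>s u\<bar> \<le> 2 / 3" if "\<bar>u\<bar> \<le> L" for u
    proof -
      have e: "\<bar>a + b * u\<bar> \<le> V' + \<epsilon> * L" if "\<bar>a\<bar> \<le> V'" "\<bar>b\<bar> \<le> \<epsilon>" for a b V'
      proof -
        have "\<bar>b * u\<bar> \<le> \<epsilon> * L" unfolding abs_mult using that \<open>\<bar>u\<bar> \<le> L\<close> pos by (intro mult_mono) auto
        then show ?thesis using that by linarith
      qed
      have "\<bar>dt / dx * (\<bar>a1 i j\<bar> + \<bar>b1 ?r i j\<bar> * u)\<bar> \<le> dt / dx * (V1 + \<epsilon> * L)"
        "\<bar>dt / dy * (\<bar>a2 i j\<bar> + \<bar>b2 ?r i j\<bar> * u)\<bar> \<le> dt / dy * (V2 + \<epsilon> * L)"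
        unfolding abs_mult abs_of_pos[OF l(1)] abs_of_pos[OF l(2)]
        using l edge_a_bounds[of i j] edge_b_bounds[of ?r i j] by (intro mult_left_mono e; simp)+
      from order_trans[OF abs_triangle_ineq add_mono[OF this]]
      have "\<bar>s u\<bar> \<le> dt / dx * (V1 + \<epsilon> * L) + dt / dy * (V2 + \<epsilon> * L)" unfolding s_def .
      also have "\<dots> \<le> 1 / 3 + 1 / 3" by (rule add_mono[OF cfl])
      finally show ?thesis by simp
    qed
    have sp: "spread (dt / dx) (dt / dy) (a1 i j) (b1 ?r i j) (a2 i j) (b2 ?r i j) t = \<bar>1 - s t\<bar> + s \<bar>t\<bar>"
      unfolding spread_def s_def by simp
    have "\<bar>1 - s t\<bar> + s \<bar>t\<bar> \<le> \<mu>"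
    proof (cases "q = 1")
      case True
      then have "0 \<le> t" using t(3) sol_nonneg by simp
      then show ?thesis using s_le[OF t(2)] True by (simp add: \<mu>_def)
    next
      case False
      then show ?thesis using s_le[OF t(2)] s_le[of "\<bar>t\<bar>"] t(2) unfolding \<mu>_def by simp
    qed
    then show ?thesis using t(1) sp by auto
  qed
  have \<mu>0: "0 \<le> \<mu>" by (simp add: \<mu>_def)
  have "grid_TV dx dy (sol (Suc n)) \<le> ennreal (\<mu> + 4 * (dt * (D + L * G))) * grid_TV dx dy ?r
     + ennreal (4 * (dt * (W + Q))) * grid_mass dx dy ?r"
    unfolding roe_Suc[OF refl]
    by (rule roe_step_TV[OF pos(2,3,4) nn(5) \<mu>0 nn(2,3) G0 Q0 f_bounds grid_C2_edge_a b spread])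
  also have "\<dots> \<le> ennreal E * grid_TV dx dy ?r + ennreal (2 * dt * k2 * q ^ (3 * n))"
  proof (rule add_mono)
    have "\<mu> + 4 * (dt * (D + L * G)) \<le> E"
    proof (cases "q = 1")
      case True
      have "1 + 2 * (dt * k1) \<le> E" unfolding E_eq by (rule exp_ge_add_one_self)
      moreover have "4 * (dt * (D + L * G)) \<le> 2 * (dt * k1)"
      proof -
        have "0 \<le> dt * (D + L * G)" using pos nn G0 by simp
        moreover have "2 * (dt * k1) = 12 * (dt * (D + L * G))"
          unfolding k1_def G_def using True by (simp add: algebra_simps)
        ultimately show ?thesis by linarith
      qed
      ultimately show ?thesis using True by (simp add: \<mu>_def)
    next
      case False
      note R = rough_case[OF False]
      have "dt * (L * G) = 2 / 3" using False pos L1 by (simp add: G_def)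
      then have "\<mu> + 4 * (dt * (D + L * G)) = 5 + 4 * (dt * D)" using False by (simp add: \<mu>_def distrib_left)
      moreover have "0 \<le> L * (2 * dt * \<epsilon> * N2 * M)" using pos nn by (intro mult_nonneg_nonneg) auto
      moreover have "5 + 4 * x \<le> e" if "0 \<le> y" "25 / 4 * k \<le> e" "1 \<le> k" "k = 6 * (x + y)" for e k x y :: real
      proof -
        have "6 * x \<le> k" using that(1,4) by simp
        then show ?thesis using that(2,3) by linarith
      qed
      from this[OF _ exp_ge_linear(1)[OF R(3)] R(3,4)] calculation(2)
      have "5 + 4 * (dt * D) \<le> E" unfolding E_eq by blast
      ultimately show ?thesis by simp
    qed
    then show "ennreal (\<mu> + 4 * (dt * (D + L * G))) * grid_TV dx dy ?r \<le> ennreal E * grid_TV dx dy ?r"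
      by (intro mult_right_mono ennreal_leI) auto
    have "ennreal (4 * (dt * (W + Q))) * grid_mass dx dy ?r \<le> ennreal (4 * (dt * (W + Q))) * ennreal ?m"
      by (rule mult_left_mono[OF mass_le]) simp
    also have "\<dots> = ennreal (4 * (dt * (W + Q)) * ?m)"
      using pos nn Q0 mass_bound_nonneg[of n] by (simp add: ennreal_mult)
    also have "\<dots> \<le> ennreal (2 * dt * k2 * q ^ (3 * n))"
    proof (rule ennreal_leI)
      define p where "p = q ^ n"
      have p: "1 \<le> p" "q ^ (3 * n) = p ^ 3" using qn by (simp_all add: p_def power_mult[symmetric] mult.commute)
      have p0: "0 \<le> p" using p(1) by linarith
      have mono: "p * z \<le> p ^ 3 * z" "p ^ 2 * z \<le> p ^ 3 * z" if "0 \<le> z" for z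
        using that p(1) power_increasing[of 1 3 p] power_increasing[of 2 3 p] by (auto intro!: mult_right_mono)
      have "2 * (W + Q) * (p * M) = 2 * (p * (W * M)) + 4 * \<epsilon> * (p\<^sup>2 * (N3 * M * M)) + 12 * \<epsilon> * (p ^ 3 * (N2\<^sup>2 * M\<^sup>2 * M))"
        unfolding Q_def p_def[symmetric] by (simp add: algebra_simps power2_eq_square power3_eq_cube)
      also have "\<dots> \<le> 2 * (p ^ 3 * (W * M)) + 4 * \<epsilon> * (p ^ 3 * (N3 * M * M)) + 12 * \<epsilon> * (p ^ 3 * (N2\<^sup>2 * M\<^sup>2 * M))"
        using nn pos p0 by (intro add_mono mult_left_mono mono) auto
      also have "\<dots> \<le> 3 * (p ^ 3 * (W * M)) + 8 * \<epsilon> * (p ^ 3 * (N3 * M * M)) + 12 * \<epsilon> * (p ^ 3 * (N2\<^sup>2 * M\<^sup>2 * M))"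
        using nn pos p0 by (intro add_mono mult_right_mono) auto
      also have "\<dots> = k2 * p ^ 3" unfolding k2_def by (simp add: algebra_simps)
      finally have "2 * dt * (2 * (W + Q) * (p * M)) \<le> 2 * dt * (k2 * p ^ 3)"
        using pos by (intro mult_left_mono) auto
      then show "4 * (dt * (W + Q)) * ?m \<le> 2 * dt * k2 * q ^ (3 * n)"
        unfolding p(2) p_def[symmetric] by (simp add: algebra_simps)
    qed
    finally show "ennreal (4 * (dt * (W + Q))) * grid_mass dx dy ?r \<le> ennreal (2 * dt * k2 * q ^ (3 * n))" .
  qed
  finally show ?thesis .
qed

text \<open>The part of \<open>C\<^sub>x\<close> that does not stem from the variation of the initial values.\<close>

definition source :: "nat \<Rightarrow> real" where
  "source n = (if k1 = 0 then 4 * (real n * dt) * k2 else 2 * k2 / k1 * (E ^ n - 1))"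

lemma source_nonneg: "0 \<le> source n"
  unfolding source_def using k1_nonneg k2_nonneg pos one_le_power[OF E_ge_1, of n] by auto

lemma k1_zero: "k1 = 0 \<Longrightarrow> q = 1 \<and> E = 1"
proof
  assume 0: "k1 = 0"
  show "E = 1" using 0 by (simp add: E_def)
  show "q = 1" using rough_case(3) 0 by fastforce
qed

lemma TV_le: "grid_TV dx dy (sol n) \<le> ennreal (E ^ n) * grid_TV dx dy (sol 0) + ennreal (source n)"
proof -
  (* the exact sum of the amplified sources has q ^ (3 * n) in place of the 1 in source *)
  define \<sigma> where "\<sigma> n = (if k1 = 0 then 4 * (real n * dt) * k2 else 2 * k2 / k1 * (E ^ n - q ^ (3 * n)))" for n
  have Eq: "q ^ 3 \<le> E" using E_minus_q3 k1_nonneg pos by (smt (verit) mult_nonneg_nonneg)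
  have \<sigma>0: "0 \<le> \<sigma> n" for n
  proof -
    have "(q ^ 3) ^ n \<le> E ^ n" using Eq q_ge_1 by (intro power_mono) auto
    then show ?thesis unfolding \<sigma>_def power_mult using k1_nonneg k2_nonneg pos by auto
  qed
  have step: "E * \<sigma> n + 2 * dt * k2 * q ^ (3 * n) \<le> \<sigma> (Suc n)" for n
  proof (cases "k1 = 0")
    case True
    then show ?thesis using k1_zero pos k2_nonneg by (simp add: \<sigma>_def algebra_simps)
  next
    case False
    then have k: "0 < k1" using k1_nonneg by simp
    have "2 * k2 / k1 * q ^ (3 * n) * (dt * k1) \<le> 2 * k2 / k1 * q ^ (3 * n) * (E - q ^ 3)"
      using E_minus_q3 k k2_nonneg q_ge_1 by (intro mult_left_mono) auto
    then have "2 * dt * k2 * q ^ (3 * n) \<le> 2 * k2 / k1 * q ^ (3 * n) * (E - q ^ 3)" using k by (simp add: mult_ac)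
    moreover have "\<sigma> (Suc n) - E * \<sigma> n = 2 * k2 / k1 * q ^ (3 * n) * (E - q ^ 3)"
    proof -
      define z where "z = 2 * k2 / k1"
      have \<sigma>z: "\<sigma> n = z * (E ^ n - q ^ (3 * n))" for n using False by (simp add: \<sigma>_def z_def)
      have "q ^ (3 * Suc n) = q ^ 3 * q ^ (3 * n)" by (simp flip: power_add)
      then show ?thesis unfolding \<sigma>z z_def[symmetric] by (simp add: algebra_simps)
    qed
    ultimately show ?thesis by linarith
  qed
  have "grid_TV dx dy (sol n) \<le> ennreal (E ^ n) * grid_TV dx dy (sol 0) + ennreal (\<sigma> n)"
  proof (induction n)
    case 0
    show ?case by simp
  next
    case (Suc n)
    have "grid_TV dx dy (sol (Suc n)) \<le> ennreal E * grid_TV dx dy (sol n) + ennreal (2 * dt * k2 * q ^ (3 * n))"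
      by (rule TV_step)
    also have "\<dots> \<le> ennreal E * (ennreal (E ^ n) * grid_TV dx dy (sol 0) + ennreal (\<sigma> n))
        + ennreal (2 * dt * k2 * q ^ (3 * n))"
      by (intro add_right_mono mult_left_mono Suc) simp
    also have "\<dots> = ennreal (E ^ Suc n) * grid_TV dx dy (sol 0) + ennreal (E * \<sigma> n + 2 * dt * k2 * q ^ (3 * n))"
      using E_ge_1 \<sigma>0[of n] pos k2_nonneg q_ge_1
      by (simp add: distrib_left ennreal_mult ennreal_plus mult.assoc add.assoc del: ennreal_plus[symmetric])
    also have "\<dots> \<le> ennreal (E ^ Suc n) * grid_TV dx dy (sol 0) + ennreal (\<sigma> (Suc n))"
      by (intro add_left_mono ennreal_leI step)
    finally show ?case .
  qed
  also have "\<dots> \<le> ennreal (E ^ n) * grid_TV dx dy (sol 0) + ennreal (source n)"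
  proof (intro add_left_mono ennreal_leI)
    have "1 \<le> q ^ (3 * n)" by (rule one_le_power[OF q_ge_1])
    then show "\<sigma> n \<le> source n" unfolding \<sigma>_def source_def
      using k1_nonneg k2_nonneg by (auto intro!: mult_left_mono divide_nonneg_nonneg simp del: times_divide_eq_left)
  qed
  finally show ?thesis .
qed

lemma source_mono:
  assumes "m \<le> n"
  shows "source m \<le> source n"
proof -
  have "E ^ m \<le> E ^ n" using assms E_ge_1 by (rule power_increasing)
  then show ?thesis
    unfolding source_def using k1_nonneg k2_nonneg pos assms
    by (auto intro!: mult_left_mono mult_right_mono divide_nonneg_nonneg simp del: times_divide_eq_left)
qed

lemma Cx_eq: "Cx dx dy \<epsilon> v f \<eta> \<rho>\<^sub>o (real n * dt) = ennreal (E ^ n) * grid_TV dx dy (sol 0) + ennreal (source n)"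
proof -
  have K1: "K1 \<epsilon> v f \<eta> \<rho>\<^sub>o = ennreal k1"
  proof -
    have "ennreal k1 = 6 * ennreal (D + 2 * \<epsilon> * L * N2 * M)"
      unfolding k1_def using nn pos by (subst ennreal_mult) auto
    moreover have "ennreal (D + 2 * \<epsilon> * L * N2 * M) = ennreal D + 2 * ennreal \<epsilon> * ennreal L * ennreal N2 * ennreal M"
      using nn pos by (simp add: ennreal_mult ennreal_plus)
    ultimately show ?thesis unfolding K1_def D L N2 M by simp
  qed
  have K2: "K2 \<epsilon> v \<eta> \<rho>\<^sub>o = ennreal k2"
    unfolding K2_def Let_def W N2 N3 M k2_def using nn pos
    by (simp add: ennreal_mult ennreal_plus ennreal_power algebra_simps)
  have t0: "0 \<le> real n * dt" using pos by simp
  have "2 * ennreal (real n * dt) * ennreal k1 = ennreal (2 * (real n * dt) * k1)"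
    using t0 k1_nonneg by (simp add: ennreal_mult)
  moreover have "exp (2 * (real n * dt) * k1) = E ^ n"
    unfolding E_def exp_of_nat_mult[symmetric] by (simp add: mult_ac)
  ultimately have exp: "ennexp (2 * ennreal (real n * dt) * ennreal k1) = ennreal (E ^ n)"
    unfolding ennexp_def using t0 k1_nonneg by (simp del: ennreal_eq_0_iff)
  have src: "(if ennreal k1 = 0 then 4 * ennreal (real n * dt) * ennreal k2
      else 2 * ennreal k2 / ennreal k1 * (ennreal (E ^ n) - 1)) = ennreal (source n)"
  proof (cases "k1 = 0")
    case True
    have "4 * ennreal (real n * dt) * ennreal k2 = ennreal (4 * (real n * dt) * k2)"
      using t0 k2_nonneg by (simp add: ennreal_mult)
    then show ?thesis using True by (simp add: source_def)
  next
    case False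
    then have k: "0 < k1" using k1_nonneg by simp
    have e: "1 \<le> E ^ n" by (rule one_le_power[OF E_ge_1])
    have "2 * ennreal k2 / ennreal k1 = ennreal (2 * k2 / k1)"
      using k k2_nonneg by (simp add: divide_ennreal[symmetric] ennreal_mult)
    moreover have "ennreal (E ^ n) - 1 = ennreal (E ^ n - 1)"
      using e ennreal_minus[of 1 "E ^ n"] by simp
    ultimately show ?thesis
      using k k2_nonneg e by (simp add: source_def ennreal_mult[symmetric] del: times_divide_eq_left)
  qed
  show ?thesis
    unfolding Cx_def Let_def K1 K2 exp src grid_TV_def grid_sum_def by simp
qed

lemma TV_le_Cx:
  assumes "m \<le> n"
  shows "grid_TV dx dy (sol m) \<le> Cx dx dy \<epsilon> v f \<eta> \<rho>\<^sub>o (real n * dt)"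
proof -
  have "E ^ m \<le> E ^ n" using assms E_ge_1 by (rule power_increasing)
  then show ?thesis
    unfolding Cx_eq
    by (intro order_trans[OF TV_le] add_mono mult_right_mono ennreal_leI source_mono assms) auto
qed

subsection \<open>Variation in time\<close>

lemma time_diff_le:
  "grid_mass dx dy (\<lambda>i j. sol (Suc m) i j - sol m i j) \<le> ennreal (dt * (V + \<epsilon> * L)) * grid_TV dx dy (sol m)
    + ennreal (2 * (dt * (D + \<epsilon> * (2 * (q ^ m * M * N2)))) * (q ^ m * M))"
proof -
  let ?G = "\<epsilon> * (2 * (q ^ m * M * N2))"
  have G: "0 \<le> ?G" using q_power_nonneg[of m] nn pos by (intro mult_nonneg_nonneg) auto
  note b = grid_C2_edge_b[OF mass_le mass_bound_nonneg, of m]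
  have "grid_mass dx dy (\<lambda>i j. sol (Suc m) i j - sol m i j) \<le> ennreal (dt * (V + \<epsilon> * L)) * grid_TV dx dy (sol m)
    + ennreal (2 * (dt * (D + ?G))) * grid_mass dx dy (sol m)"
    unfolding roe_Suc[OF refl]
    by (rule roe_step_time_diff[OF pos(2,3,4) nn(5,2) G f_bounds grid_C2_edge_a b edge_a_bounds(3,4) edge_b_bounds])
  also have "\<dots> \<le> ennreal (dt * (V + \<epsilon> * L)) * grid_TV dx dy (sol m) + ennreal (2 * (dt * (D + ?G))) * ennreal (q ^ m * M)"
    by (intro add_left_mono mult_left_mono mass_le) simp
  also have "ennreal (2 * (dt * (D + ?G))) * ennreal (q ^ m * M) = ennreal (2 * (dt * (D + ?G)) * (q ^ m * M))"
    using G nn pos mass_bound_nonneg[of m] by (intro ennreal_mult[symmetric]) auto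
  finally show ?thesis .
qed

text \<open>In the rough regime the mass, and with it the zeroth order part of the time difference, may
  grow geometrically. The interpolation inequality \<open>D\<^sup>2 \<le> 4 * V * W\<close> bounds the first derivatives that
  cause the growth by the second derivatives, and these enter the bound on the total variation
  with the much faster growing factor \<open>E\<close>.\<close>

lemma time_excess_le:
  assumes "m < n"
  shows "2 * (dt * (D + \<epsilon> * (2 * (q ^ m * M * N2)))) * (q ^ m * M)
    \<le> 2 * dt * ((D + 2 * \<epsilon> * N2 * M) * M) + 3 * (dt * (V + \<epsilon> * L)) * source n"
proof -
  define K where "K = V + \<epsilon> * L"
  have K: "0 \<le> K" unfolding K_def using nn pos by simp
  have rest: "0 \<le> 3 * (dt * K) * source n" using K pos source_nonneg by simp
  show ?thesis unfolding K_def[symmetric]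
  proof (cases "q ^ m = 1")
    case True
    have "2 * (dt * (D + \<epsilon> * (2 * (q ^ m * M * N2)))) * (q ^ m * M) = 2 * dt * ((D + 2 * \<epsilon> * N2 * M) * M)"
      unfolding True by (simp add: algebra_simps)
    then show "2 * (dt * (D + \<epsilon> * (2 * (q ^ m * M * N2)))) * (q ^ m * M)
      \<le> 2 * dt * ((D + 2 * \<epsilon> * N2 * M) * M) + 3 * (dt * K) * source n" using rest by linarith
  next
    case False
    then have q1: "q \<noteq> 1" and m: "1 \<le> m" by (auto simp: Suc_le_eq intro: gr0I)
    note R = rough_case[OF q1]
    define x where "x = dt * D"
    define s where "s = 2 * dt * \<epsilon> * N2 * M"
    define p where "p = q ^ m"
    have xs: "0 \<le> x" "0 \<le> s" unfolding x_def s_def using pos nn by simp_all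
    have y: "dt * k1 = 6 * (x + L * s)" unfolding x_def s_def by (rule R(4))
    have k: "0 < k1" using R(3) pos by (metis k1_nonneg less_eq_real_def mult_zero_right not_one_le_zero)
    have En: "0 \<le> E ^ n - 1" using one_le_power[OF E_ge_1, of n] by simp
    have "2 * (x + s * (5 / 3) ^ m) * (5 / 3) ^ m * (x + L * s) \<le> (3 / 4 * x\<^sup>2 + 3 * L * s\<^sup>2) * (E ^ n - 1)"
    proof (rule excess_le[OF xs L_ge_1 _ _ m assms])
      show "1 / 6 \<le> x + s" unfolding x_def s_def by (rule R(2))
      show "E = exp (2 * (6 * (x + L * s)))" unfolding E_eq y ..
    qed
    then have "2 * (x + s * p) * p * (x + L * s) * M \<le> (3 / 4 * x\<^sup>2 + 3 * L * s\<^sup>2) * (E ^ n - 1) * M"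
      unfolding p_def R(1) by (rule mult_right_mono) (rule nn)
    also have "\<dots> = ((3 / 4 * x\<^sup>2 + 3 * L * s\<^sup>2) * M) * (E ^ n - 1)" by simp
    also have "\<dots> \<le> (dt * dt * K * k2) * (E ^ n - 1)"
    proof (rule mult_right_mono[OF _ En])
      have DVW: "D\<^sup>2 \<le> 4 * V * W" by (rule field_landau[OF v _ _ D]) (use V W nn in auto)
      have "(3 / 4 * x\<^sup>2 + 3 * L * s\<^sup>2) * M = dt * dt * (3 / 4 * D\<^sup>2 * M) + dt * dt * (12 * L * \<epsilon>\<^sup>2 * N2\<^sup>2 * M\<^sup>2 * M)"
        unfolding x_def s_def by (simp add: power2_eq_square algebra_simps)
      also have "\<dots> \<le> dt * dt * (3 / 4 * (4 * V * W) * M) + dt * dt * (12 * L * \<epsilon>\<^sup>2 * N2\<^sup>2 * M\<^sup>2 * M)"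
        using DVW nn pos by (intro add_right_mono mult_left_mono mult_right_mono) auto
      also have "\<dots> = dt * dt * ((3 * V * W + \<epsilon> * L * (12 * \<epsilon> * N2\<^sup>2 * M\<^sup>2)) * M)"
        by (simp add: power2_eq_square algebra_simps)
      also have "\<dots> \<le> dt * dt * (K * k2)"
      proof (rule mult_left_mono)
        define A where "A = 12 * \<epsilon> * N2\<^sup>2 * M\<^sup>2"
        define B where "B = 8 * \<epsilon> * N3 * M"
        have AB: "0 \<le> A" "0 \<le> B" unfolding A_def B_def using nn pos by simp_all
        have "3 * V * W + \<epsilon> * L * A \<le> (V + \<epsilon> * L) * (B + A + 3 * W)"
        proof -
          have "0 \<le> V * B" "0 \<le> V * A" "0 \<le> \<epsilon> * L * B" "0 \<le> \<epsilon> * L * W" using nn pos AB by simp_all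
          then show ?thesis by (simp add: algebra_simps)
        qed
        then have "(3 * V * W + \<epsilon> * L * A) * M \<le> (V + \<epsilon> * L) * (B + A + 3 * W) * M"
          using nn by (intro mult_right_mono)
        then show "(3 * V * W + \<epsilon> * L * (12 * \<epsilon> * N2\<^sup>2 * M\<^sup>2)) * M \<le> K * k2"
          unfolding K_def k2_def A_def B_def by (simp add: algebra_simps)
      qed (use pos in simp)
      finally show "(3 / 4 * x\<^sup>2 + 3 * L * s\<^sup>2) * M \<le> dt * dt * K * k2" by simp
    qed
    also have "\<dots> = 3 * (dt * K) * source n * (x + L * s)"
    proof -
      have e: "x + L * s = dt * k1 / 6" using y by simp
      show ?thesis unfolding e using k by (simp add: source_def)
    qed
    finally have "2 * (x + s * p) * p * M * (x + L * s) \<le> 3 * (dt * K) * source n * (x + L * s)"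
      by (simp add: mult_ac)
    moreover have "0 < x + L * s" using y R(3) by simp
    ultimately have "2 * (x + s * p) * p * M \<le> 3 * (dt * K) * source n" by simp
    moreover have "2 * (dt * (D + \<epsilon> * (2 * (q ^ m * M * N2)))) * (q ^ m * M) = 2 * (x + s * p) * p * M"
      unfolding x_def s_def p_def by (simp add: algebra_simps)
    moreover have "0 \<le> 2 * dt * ((D + 2 * \<epsilon> * N2 * M) * M)" using nn pos by simp
    ultimately show "2 * (dt * (D + \<epsilon> * (2 * (q ^ m * M * N2)))) * (q ^ m * M)
      \<le> 2 * dt * ((D + 2 * \<epsilon> * N2 * M) * M) + 3 * (dt * K) * source n" by linarith
  qed
qed

text \<open>The space variation accounts for one summand \<open>C\<^sub>x\<close>; the time variation uses one quarter of the
  multiple of \<open>C\<^sub>x\<close> contained in \<open>2 * C\<^sub>t\<close> for the transport part and three quarters for the excess of the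
  mass.\<close>

lemma step_le:
  assumes "m < n"
  shows "ennreal dt * grid_TV dx dy (sol m) + grid_mass dx dy (\<lambda>i j. sol (Suc m) i j - sol m i j)
    \<le> ennreal dt * (Cx dx dy \<epsilon> v f \<eta> \<rho>\<^sub>o (real n * dt) + 2 * Ct dx dy \<epsilon> v f \<eta> \<rho>\<^sub>o (real n * dt))"
proof -
  define C where "C = Cx dx dy \<epsilon> v f \<eta> \<rho>\<^sub>o (real n * dt)"
  define K where "K = V + \<epsilon> * L"
  define Z where "Z = (D + 2 * \<epsilon> * N2 * M) * M"
  have nonneg: "0 \<le> K" "0 \<le> Z" unfolding K_def Z_def using nn pos by simp_all
  have TV: "grid_TV dx dy (sol m) \<le> C" unfolding C_def using assms by (intro TV_le_Cx) simp
  have src: "ennreal (source n) \<le> C" unfolding C_def Cx_eq by simp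
  have Ct: "Ct dx dy \<epsilon> v f \<eta> \<rho>\<^sub>o (real n * dt) = 2 * ennreal K * C + ennreal Z"
    unfolding Ct_def C_def[symmetric] V L D N2 M K_def Z_def using nn pos
    by (simp add: ennreal_mult ennreal_plus)
  have "grid_mass dx dy (\<lambda>i j. sol (Suc m) i j - sol m i j) \<le> ennreal (dt * K) * grid_TV dx dy (sol m)
      + ennreal (2 * (dt * (D + \<epsilon> * (2 * (q ^ m * M * N2)))) * (q ^ m * M))"
    unfolding K_def by (rule time_diff_le)
  also have "\<dots> \<le> ennreal (dt * K) * C + ennreal (2 * dt * Z + 3 * (dt * K) * source n)"
    using time_excess_le[OF assms] unfolding Z_def K_def
    by (intro add_mono mult_left_mono TV ennreal_leI) auto
  also have "\<dots> = ennreal (dt * K) * C + (ennreal (2 * dt * Z) + ennreal (3 * (dt * K)) * ennreal (source n))"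
    using nonneg pos source_nonneg by (simp add: ennreal_mult ennreal_plus)
  also have "\<dots> \<le> ennreal (dt * K) * C + (ennreal (2 * dt * Z) + ennreal (3 * (dt * K)) * C)"
    by (intro add_left_mono mult_left_mono src) simp
  also have "\<dots> = ennreal (4 * (dt * K)) * C + ennreal (2 * dt * Z)"
  proof -
    have "ennreal (4 * (dt * K)) = ennreal (dt * K) + ennreal (3 * (dt * K))"
      using nonneg pos by (subst ennreal_plus[symmetric]) auto
    then show ?thesis by (simp add: distrib_right add_ac)
  qed
  finally have "grid_mass dx dy (\<lambda>i j. sol (Suc m) i j - sol m i j) \<le> ennreal (4 * (dt * K)) * C + ennreal (2 * dt * Z)" .
  then have "ennreal dt * grid_TV dx dy (sol m) + grid_mass dx dy (\<lambda>i j. sol (Suc m) i j - sol m i j)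
      \<le> ennreal dt * C + (ennreal (4 * (dt * K)) * C + ennreal (2 * dt * Z))"
    by (intro add_mono mult_left_mono TV) auto
  also have "\<dots> = ennreal dt * (C + 2 * (2 * ennreal K * C + ennreal Z))"
  proof -
    have "ennreal (4 * (dt * K)) = ennreal dt * (2 * (2 * ennreal K))" "ennreal (2 * dt * Z) = ennreal dt * (2 * ennreal Z)"
      using nonneg pos by (simp_all add: ennreal_mult mult_ac)
    then show ?thesis by (simp only: distrib_left mult.assoc)
  qed
  finally show ?thesis unfolding Ct C_def .
qed

theorem space_time_estimate:
  "(\<Sum>m<n. ennreal dt * grid_TV dx dy (sol m)) + (\<Sum>m<n. grid_mass dx dy (\<lambda>i j. sol (Suc m) i j - sol m i j))
    \<le> Cxt dx dy \<epsilon> v f \<eta> \<rho>\<^sub>o (real n * dt)"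
proof -
  let ?B = "Cx dx dy \<epsilon> v f \<eta> \<rho>\<^sub>o (real n * dt) + 2 * Ct dx dy \<epsilon> v f \<eta> \<rho>\<^sub>o (real n * dt)"
  have "(\<Sum>m<n. ennreal dt * grid_TV dx dy (sol m) + grid_mass dx dy (\<lambda>i j. sol (Suc m) i j - sol m i j))
      \<le> (\<Sum>m<n. ennreal dt * ?B)"
    by (intro sum_mono step_le) simp
  also have "\<dots> = ennreal (real n * dt) * ?B"
    using pos by (simp add: ennreal_mult ennreal_of_nat_eq_real_of_nat mult.assoc)
  finally show ?thesis unfolding Cxt_def sum.distrib .
qed

end
section \<open>Degenerate data\<close>

lemma cfl_finite:
  assumes "ennreal l \<le> 1 / (3 * (ennreal \<epsilon> * X + Y))" "0 < l" "0 < \<epsilon>"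
  shows "X < top" "Y < top" "l * (enn2real Y + \<epsilon> * enn2real X) \<le> 1 / 3"
proof -
  have "3 * (ennreal \<epsilon> * X + Y) \<noteq> top" using assms by (auto simp: ennreal_eq_0_iff)
  then have ne: "ennreal \<epsilon> * X \<noteq> top" "Y \<noteq> top" by (auto simp: ennreal_mult_eq_top_iff)
  then have "X \<noteq> top" using assms(3) by (auto simp: ennreal_mult_eq_top_iff)
  with ne show fin: "X < top" "Y < top" by (simp_all add: less_top)
  define z where "z = enn2real Y + \<epsilon> * enn2real X"
  have z0: "0 \<le> z" unfolding z_def using assms by simp
  have "ennreal \<epsilon> * X + Y = ennreal z"
    unfolding z_def using fin assms(3) by (simp add: ennreal_plus ennreal_mult add.commute)
  then have "ennreal l \<le> 1 / (3 * ennreal z)" using assms(1) by simp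
  also have "3 * ennreal z = ennreal (3 * z)" using z0 by (simp add: ennreal_mult)
  finally have le: "ennreal l \<le> 1 / ennreal (3 * z)" .
  show "l * z \<le> 1 / 3"
  proof (cases "z = 0")
    case False
    then have z: "0 < z" using z0 by simp
    then have "ennreal l \<le> ennreal (1 / (3 * z))" using le divide_ennreal[of 1 "3 * z"] by simp
    then have "l \<le> 1 / (3 * z)" using z by simp
    then show ?thesis using z by (simp add: field_simps)
  qed simp
qed

lemma roe_vanishing_data:
  assumes "0 < dx" "0 < dy" "\<And>x. 0 \<le> \<rho>\<^sub>o x" "integrable lebesgue \<rho>\<^sub>o" "L1 \<rho>\<^sub>o = 0" "f 0 = 0"
  shows "roe dx dy dt \<epsilon> v f \<eta> \<rho>\<^sub>o n i j = 0"
proof (induction n arbitrary: i j)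
  case 0
  have "grid_mass dx dy (cell_average dx dy \<rho>\<^sub>o) = 0"
    using cell_average_mass[of dx dy \<rho>\<^sub>o] assms by simp
  then have "grid_sum (\<lambda>i j. \<bar>cell_average dx dy \<rho>\<^sub>o i j\<bar>) = 0"
    using assms(1,2) by (simp add: grid_mass_eq)
  then show ?case using grid_sum_zero_iff by simp
next
  case (Suc n)
  show ?case unfolding roe_Suc[OF refl] roe_step_def upwind_def by (simp add: Suc assms)
qed

lemma Cxt_eq_top:
  assumes "0 < t" "Cx dx dy \<epsilon> v f \<eta> \<rho>\<^sub>o t = top \<or> Ct dx dy \<epsilon> v f \<eta> \<rho>\<^sub>o t = top"
  shows "Cxt dx dy \<epsilon> v f \<eta> \<rho>\<^sub>o t = top"
  using assms unfolding Cxt_def by (auto simp: ennreal_mult_top ennreal_mult_eq_top_iff)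

lemma Ct_eq_top:
  assumes "Linf (grad_norm_vec 1 v) = top" "L1 \<rho>\<^sub>o \<noteq> 0"
  shows "Ct dx dy \<epsilon> v f \<eta> \<rho>\<^sub>o t = top"
  unfolding Ct_def assms(1) using assms(2) by (simp add: ennreal_top_mult)

text \<open>An infinite norm of the second derivatives must not be cancelled by a vanishing factor: for \<open>K1 > 0\<close>
  the factor \<open>exp (2 t K1) - 1\<close> is positive, and for \<open>K1 = 0\<close> the limiting expression is linear in \<open>K2\<close>.\<close>

lemma Cx_eq_top:
  assumes "Linf (grad_norm_vec 2 v) = top" "L1 \<rho>\<^sub>o \<noteq> 0" "K1 \<epsilon> v f \<eta> \<rho>\<^sub>o < top" "0 < t"
  shows "Cx dx dy \<epsilon> v f \<eta> \<rho>\<^sub>o t = top"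
proof -
  have K2: "K2 \<epsilon> v \<eta> \<rho>\<^sub>o = top"
    unfolding K2_def Let_def assms(1) using assms(2) by (simp add: ennreal_top_mult ennreal_mult_top)
  obtain k where k: "K1 \<epsilon> v f \<eta> \<rho>\<^sub>o = ennreal k" "0 \<le> k"
    using assms(3) by (cases "K1 \<epsilon> v f \<eta> \<rho>\<^sub>o") auto
  show ?thesis
  proof (cases "k = 0")
    case True
    then show ?thesis unfolding Cx_def Let_def k K2 using assms(4)
      by (simp add: ennreal_mult_top ennreal_mult_eq_top_iff)
  next
    case False
    have "2 * ennreal t * ennreal k = ennreal (2 * t * k)" using assms(4) k by (simp add: ennreal_mult)
    then have E: "ennexp (2 * ennreal t * ennreal k) = ennreal (exp (2 * t * k))"
      unfolding ennexp_def using assms(4) k by simp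
    have "ennreal (exp (2 * t * k)) - 1 = ennreal (exp (2 * t * k) - 1)"
      using ennreal_minus[of 1 "exp (2 * t * k)"] by simp
    then have "ennreal (exp (2 * t * k)) - 1 \<noteq> 0" using assms(4) k False by (simp add: ennreal_eq_0_iff not_le)
    then show ?thesis unfolding Cx_def Let_def k K2 E using False k
      by (simp add: ennreal_mult_top ennreal_top_mult ennreal_top_divide)
  qed
qed

theorem corollary3p7:
  fixes \<epsilon> \<rho>max T \<Delta>x \<Delta>y \<Delta>t :: real
    and v :: "real^2 \<Rightarrow> real^2"
    and H f :: "real \<Rightarrow> real"
    and \<eta> \<rho>\<^sub>o :: "real^2 \<Rightarrow> real"
    and \<rho> :: "nat \<Rightarrow> int \<Rightarrow> int \<Rightarrow> real"
  assumes "\<epsilon> > 0" and "\<rho>max > 0" and "T > 0"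
    and "\<Delta>x > 0" and "\<Delta>y > 0" and "\<Delta>t > 0"
    and "C_diff_vec 2 v"
    and "smooth_heaviside H"
    and "f = flux_fun H \<rho>max"
    and "bounded (range (deriv f))"
    and "C_W_inf 3 \<eta>" and "\<forall>x. \<eta> x \<ge> 0"
    and "BV \<rho>\<^sub>o" and "Linf \<rho>\<^sub>o < \<infinity>" and "\<forall>x. \<rho>\<^sub>o x \<ge> 0"
    and "ennreal (\<Delta>t / \<Delta>x) \<le> 1 / (3 * (ennreal \<epsilon> * Linf (deriv f) + Linf (\<lambda>x. v x $ 1)))"
    and "ennreal (\<Delta>t / \<Delta>y) \<le> 1 / (3 * (ennreal \<epsilon> * Linf (deriv f) + Linf (\<lambda>x. v x $ 2)))"
    and "\<rho> = roe \<Delta>x \<Delta>y \<Delta>t \<epsilon> v f \<eta> \<rho>\<^sub>o"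
  shows "\<forall>n\<in>{1..nat \<lfloor>T / \<Delta>t\<rfloor>}.
     (\<Sum>m<n. \<Sum>\<^sub>\<infinity>(i, j)\<in>UNIV.
        ennreal (\<Delta>t * (\<Delta>y * \<bar>\<rho> m (i + 1) j - \<rho> m i j\<bar> + \<Delta>x * \<bar>\<rho> m i (j + 1) - \<rho> m i j\<bar>)))
     + (\<Sum>m<n. \<Sum>\<^sub>\<infinity>(i, j)\<in>UNIV.
        ennreal (\<Delta>x * \<Delta>y * \<bar>\<rho> (Suc m) i j - \<rho> m i j\<bar>))
     \<le> Cxt \<Delta>x \<Delta>y \<epsilon> v f \<eta> \<rho>\<^sub>o (real n * \<Delta>t)"
proof (intro ballI)
  fix n assume "n \<in> {1..nat \<lfloor>T / \<Delta>t\<rfloor>}"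
  then have t: "0 < real n * \<Delta>t" using assms(6) by simp
  have int: "integrable lebesgue \<rho>\<^sub>o" using assms(13) by (simp add: BV_def)
  have tv: "(\<Sum>\<^sub>\<infinity>(i, j)\<in>UNIV. ennreal (\<Delta>t * (\<Delta>y * \<bar>\<rho> m (i + 1) j - \<rho> m i j\<bar> + \<Delta>x * \<bar>\<rho> m i (j + 1) - \<rho> m i j\<bar>)))
      = ennreal \<Delta>t * grid_TV \<Delta>x \<Delta>y (\<rho> m)" for m
    using grid_sum_cmult[of \<Delta>t "\<lambda>i j. \<Delta>x * \<bar>\<rho> m i (j + 1) - \<rho> m i j\<bar> + \<Delta>y * \<bar>\<rho> m (i + 1) j - \<rho> m i j\<bar>"] assms(6)
    unfolding grid_TV_def grid_sum_def by (simp add: add.commute)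
  have ms: "(\<Sum>\<^sub>\<infinity>(i, j)\<in>UNIV. ennreal (\<Delta>x * \<Delta>y * \<bar>\<rho> (Suc m) i j - \<rho> m i j\<bar>))
      = grid_mass \<Delta>x \<Delta>y (\<lambda>i j. \<rho> (Suc m) i j - \<rho> m i j)" for m
    unfolding grid_mass_def grid_sum_def ..
  let ?lhs = "(\<Sum>m<n. ennreal \<Delta>t * grid_TV \<Delta>x \<Delta>y (\<rho> m))
      + (\<Sum>m<n. grid_mass \<Delta>x \<Delta>y (\<lambda>i j. \<rho> (Suc m) i j - \<rho> m i j))"
  let ?rhs = "Cxt \<Delta>x \<Delta>y \<epsilon> v f \<eta> \<rho>\<^sub>o (real n * \<Delta>t)"
  have "?lhs \<le> ?rhs"
  proof (cases "L1 \<rho>\<^sub>o = 0")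
    case True
    have "\<rho> m i j = 0" for m i j
      unfolding assms(18) by (rule roe_vanishing_data) (use assms True int in \<open>auto simp: flux_fun_def\<close>)
    then show ?thesis by (simp add: grid_TV_def grid_mass_def grid_sum_def case_prod_unfold)
  next
    case L1: False
    have l: "0 < \<Delta>t / \<Delta>x" "0 < \<Delta>t / \<Delta>y" using assms(4,5,6) by simp_all
    note cfl1 = cfl_finite[OF assms(16) l(1) assms(1)] and cfl2 = cfl_finite[OF assms(17) l(2) assms(1)]
    have cont: "continuous_on UNIV (\<lambda>x. v x $ k)" for k
      using assms(7) by (auto simp: C_diff_vec_def C_diff_def dest!: spec[of _ "[]"])
    have vk: "\<bar>v x $ k\<bar> \<le> enn2real (Linf (\<lambda>x. v x $ k))" if "Linf (\<lambda>x. v x $ k) < top" for x k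
    proof -
      have "ennreal \<bar>v x $ k\<bar> \<le> ennreal (enn2real (Linf (\<lambda>x. v x $ k)))"
        using norm_le_Linf[OF cont[of k], of x] that by simp
      then show ?thesis by simp
    qed
    note v1 = vk[OF cfl1(2)] and v2 = vk[OF cfl2(2)]
    have "norm (v x) \<le> enn2real (Linf (\<lambda>x. v x $ 1)) + enn2real (Linf (\<lambda>x. v x $ 2))" for x
      using norm_le_l1_cart[of "v x"] v1[of x] v2[of x] by (simp add: sum_2)
    from Linf_le_bound[OF C_diff_vec_continuous[OF assms(7)] this]
    have V: "Linf v < top" by (rule order.strict_trans1) simp
    have M: "L1 \<rho>\<^sub>o < top"
    proof -
      have "L1 \<rho>\<^sub>o = ennreal (LINT x|lebesgue. norm (\<rho>\<^sub>o x))"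
        unfolding L1_def by (rule nn_integral_eq_integral) (use int in auto)
      then show ?thesis by simp
    qed
    have N: "Linf (grad_norm 2 \<eta>) < top" "Linf (grad_norm 3 \<eta>) < top"
      using assms(11) by (auto simp: C_W_inf_def)
    consider "Linf (grad_norm_vec 1 v) = top"
      | "Linf (grad_norm_vec 1 v) < top" "Linf (grad_norm_vec 2 v) = top"
      | "Linf (grad_norm_vec 1 v) < top" "Linf (grad_norm_vec 2 v) < top"
      using top.not_eq_extremum by blast
    then show ?thesis
    proof cases
      case 1
      have "?rhs = top" by (intro Cxt_eq_top t disjI2 Ct_eq_top 1 L1)
      then show ?thesis by simp
    next
      case 2
      have "K1 \<epsilon> v f \<eta> \<rho>\<^sub>o < top"
        unfolding K1_def using 2(1) cfl1(1) M N(1) by (auto simp: less_top[symmetric] ennreal_mult_eq_top_iff)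
      then have "?rhs = top" by (intro Cxt_eq_top t disjI1 Cx_eq_top 2(2) L1)
      then show ?thesis by simp
    next
      case 3
      interpret nonlocal_scheme \<epsilon> \<rho>max \<Delta>x \<Delta>y \<Delta>t v H \<eta> \<rho>\<^sub>o "enn2real (L1 \<rho>\<^sub>o)"
        "enn2real (Linf (grad_norm_vec 1 v))" "enn2real (Linf (grad_norm_vec 2 v))" "enn2real (Linf v)"
        "enn2real (Linf (\<lambda>x. v x $ 1))" "enn2real (Linf (\<lambda>x. v x $ 2))" "enn2real (Linf (deriv f))"
        "enn2real (Linf (grad_norm 2 \<eta>))" "enn2real (Linf (grad_norm 3 \<eta>))" f
        by unfold_locales (use assms int 3 V M N cfl1 cfl2 v1 v2 in simp_all)
      show ?thesis unfolding assms(18) by (rule space_time_estimate)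
    qed
  qed
  then show "(\<Sum>m<n. \<Sum>\<^sub>\<infinity>(i, j)\<in>UNIV.
        ennreal (\<Delta>t * (\<Delta>y * \<bar>\<rho> m (i + 1) j - \<rho> m i j\<bar> + \<Delta>x * \<bar>\<rho> m i (j + 1) - \<rho> m i j\<bar>)))
     + (\<Sum>m<n. \<Sum>\<^sub>\<infinity>(i, j)\<in>UNIV.
        ennreal (\<Delta>x * \<Delta>y * \<bar>\<rho> (Suc m) i j - \<rho> m i j\<bar>)) \<le> ?rhs"
    unfolding tv ms .
qed

end
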